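(* Let $H\neq\{0\}$ be a complex-valued $L^2$-space over an arbitrary measure space, let $u\in H_+$ be a quasi-interior point of $H_+$ and let $(e^{tA})_{t\ge0}$ be a self-adjoint and real $C_0$-semigroup on $H$, with generator $A$, such that $D(A)\subseteq H_u$. Suppose that there is a $\lambda_1>s(A)$ such that $\mathcal{R}(\lambda,A)\gg_u0$ for all $\lambda\in(s(A),\lambda_1)$. If $B\in\mathcal{L}(H)$ is positive and self-adjoint with $\|B\|<\lambda_1-s(A)$, then the semigroup $(e^{t(A+B)})_{t\ge0}$ is uniformly eventually strongly positive with respect to $u$.
   Context: $H$ is regarded as a complex Banach lattice with the almost-everywhere pointwise order; $H_{\mathbb{R}}$ denotes the real-valued functions in $H$, $H_+$ the positive cone, and $f>0$ means $f\ge0$, $f\ne0$. $\mathcal{L}(H)$ is the space of bounded linear operators on $H$; here $B\in\mathcal{L}(H)$ is positive in the lattice sense, i.e. $BH_+\subseteq H_+$. A $C_0$-semigroup is self-adjoint if each $e^{tA}$ is self-adjoint (equivalently, $A$ is self-adjoint), and real if each $e^{tA}$ maps $H_{\mathbb{R}}$ into $H_{\mathbb{R}}$. $s(A)=\sup\{\operatorname{Re}\lambda:\lambda\in\sigma(A)\}$ is the spectral bound and $\mathcal{R}(\lambda,A)=(\lambda I-A)^{-1}$ for $\lambda\in\rho(A)$. For $u\in H_+$ let $H_u=\{x\in H:\ |x|\le cu\text{ for some }c\ge0\}$; $u\in H_+$ is a quasi-interior point of $H_+$ if $H_u$ is dense in $H$. For $f\in H$ write $f\gg_u0$ if there is $\varepsilon>0$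 with $f\ge\varepsilon u$; for $T\in\mathcal{L}(H)$ write $T\gg_u0$ if $Tf\gg_u0$ for all $0<f\in H$. A $C_0$-semigroup $(e^{tC})_{t\ge0}$ on $H$ is uniformly eventually strongly positive with respect to $u$ if there is $t_0\ge0$ such that $e^{tC}f\gg_u0$ for all $t\ge t_0$ and all $0<f\in H$. *)

theory Defs
  imports "HOL-Analysis.Analysis"
begin

text \<open>
  The complex Hilbert lattice $L^2(M)$ is handled through representatives: its vectors are the
  square integrable functions, and two of them denote the same vector iff they agree almost
  everywhere.  Accordingly every equation between vectors below is an almost-everywhere equation,
  and an operator has to respect this identification (see \<open>bounded_op\<close>).  No
  $\sigma$-finiteness is assumed.
\<close>

type_synonym 'a cfun = "'a \<Rightarrow> complex"
type_synonym 'a operator = "'a cfun \<Rightarrow> 'a cfun"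

definition L2 :: "'a measure \<Rightarrow> 'a cfun set" where
  "L2 M = {f. f \<in> borel_measurable M \<and> integrable M (\<lambda>x. (cmod (f x))\<^sup>2)}"

definition eq_ae :: "'a measure \<Rightarrow> 'a cfun \<Rightarrow> 'a cfun \<Rightarrow> bool" where
  "eq_ae M f g \<longleftrightarrow> (AE x in M. f x = g x)"

definition l2_inner :: "'a measure \<Rightarrow> 'a cfun \<Rightarrow> 'a cfun \<Rightarrow> complex" where
  "l2_inner M f g = (\<integral>x. f x * cnj (g x) \<partial>M)"

definition l2_norm :: "'a measure \<Rightarrow> 'a cfun \<Rightarrow> real" where
  "l2_norm M f = sqrt (\<integral>x. (cmod (f x))\<^sup>2 \<partial>M)"


section \<open>The lattice structure\<close>

definition real_part :: "'a measure \<Rightarrow> 'a cfun set" where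
  "real_part M = {f \<in> L2 M. AE x in M. Im (f x) = 0}"

text \<open>The order $f \le g$ of the complex Banach lattice: $g - f$ is real and nonnegative.\<close>

definition le_ae :: "'a measure \<Rightarrow> 'a cfun \<Rightarrow> 'a cfun \<Rightarrow> bool" where
  "le_ae M f g \<longleftrightarrow> (AE x in M. Im (f x) = Im (g x) \<and> Re (f x) \<le> Re (g x))"

definition pos_cone :: "'a measure \<Rightarrow> 'a cfun set" where
  "pos_cone M = {f \<in> L2 M. le_ae M (\<lambda>x. 0) f}"

definition positive_nonzero :: "'a measure \<Rightarrow> 'a cfun \<Rightarrow> bool" where
  "positive_nonzero M f \<longleftrightarrow> f \<in> pos_cone M \<and> \<not> eq_ae M f (\<lambda>x. 0)"

definition principal_ideal :: "'a measure \<Rightarrow> 'a cfun \<Rightarrow> 'a cfun set" where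
  "principal_ideal M u =
     {f \<in> L2 M. \<exists>c\<ge>0::real.
        le_ae M (\<lambda>x. complex_of_real (cmod (f x))) (\<lambda>x. complex_of_real c * u x)}"

definition quasi_interior :: "'a measure \<Rightarrow> 'a cfun \<Rightarrow> bool" where
  "quasi_interior M u \<longleftrightarrow> u \<in> pos_cone M \<and>
     (\<forall>f\<in>L2 M. \<forall>e>0. \<exists>g\<in>principal_ideal M u. l2_norm M (\<lambda>x. f x - g x) < e)"

definition strongly_positive :: "'a measure \<Rightarrow> 'a cfun \<Rightarrow> 'a cfun \<Rightarrow> bool" where
  "strongly_positive M u f \<longleftrightarrow> (\<exists>\<epsilon>>0::real. le_ae M (\<lambda>x. complex_of_real \<epsilon> * u x) f)"

definition strongly_positive_op :: "'a measure \<Rightarrow> 'a cfun \<Rightarrow> 'a operator \<Rightarrow> bool" where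
  "strongly_positive_op M u T \<longleftrightarrow>
     (\<forall>f. positive_nonzero M f \<longrightarrow> strongly_positive M u (T f))"


section \<open>Bounded operators\<close>

definition bounded_op :: "'a measure \<Rightarrow> 'a operator \<Rightarrow> bool" where
  "bounded_op M T \<longleftrightarrow>
     (\<forall>f\<in>L2 M. T f \<in> L2 M) \<and>
     (\<forall>f\<in>L2 M. \<forall>g\<in>L2 M. eq_ae M f g \<longrightarrow> eq_ae M (T f) (T g)) \<and>
     (\<forall>f\<in>L2 M. \<forall>g\<in>L2 M. \<forall>a b.
        eq_ae M (T (\<lambda>x. a * f x + b * g x)) (\<lambda>x. a * T f x + b * T g x)) \<and>
     (\<exists>K. \<forall>f\<in>L2 M. l2_norm M (T f) \<le> K * l2_norm M f)"

definition op_norm :: "'a measure \<Rightarrow> 'a operator \<Rightarrow> real" where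
  "op_norm M T = Sup {l2_norm M (T f) | f. f \<in> L2 M \<and> l2_norm M f \<le> 1}"

definition self_adjoint_op :: "'a measure \<Rightarrow> 'a operator \<Rightarrow> bool" where
  "self_adjoint_op M T \<longleftrightarrow> bounded_op M T \<and>
     (\<forall>f\<in>L2 M. \<forall>g\<in>L2 M. l2_inner M (T f) g = l2_inner M f (T g))"

definition positive_op :: "'a measure \<Rightarrow> 'a operator \<Rightarrow> bool" where
  "positive_op M T \<longleftrightarrow> T ` pos_cone M \<subseteq> pos_cone M"

definition real_op :: "'a measure \<Rightarrow> 'a operator \<Rightarrow> bool" where
  "real_op M T \<longleftrightarrow> T ` real_part M \<subseteq> real_part M"


section \<open>Unbounded operators\<close>

text \<open>
  An unbounded operator $A$ is given by its graph, the set of all pairs $(f, g)$ of representatives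
  with $f \in D(A)$ and $g = Af$; in particular $D(A)$ is \<open>Domain A\<close>.
\<close>

type_synonym 'a graph = "('a cfun \<times> 'a cfun) set"

definition add_bounded :: "'a measure \<Rightarrow> 'a graph \<Rightarrow> 'a operator \<Rightarrow> 'a graph" where
  "add_bounded M A B =
     {(f, h). h \<in> L2 M \<and> (\<exists>g. (f, g) \<in> A \<and> eq_ae M h (\<lambda>x. g x + B f x))}"

definition resolvent_eq :: "'a measure \<Rightarrow> 'a graph \<Rightarrow> complex \<Rightarrow> 'a cfun \<Rightarrow> 'a cfun \<Rightarrow> bool" where
  "resolvent_eq M A \<mu> g f \<longleftrightarrow> (\<exists>h. (g, h) \<in> A \<and> eq_ae M (\<lambda>x. \<mu> * g x - h x) f)"

text \<open>
  For \<open>\<mu>\<close> in the resolvent set, $(\mu I - A)^{-1} f$ is determined up to null sets, which is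
  all that matters; the choice operator picks a representative.
\<close>

definition resolvent :: "'a measure \<Rightarrow> 'a graph \<Rightarrow> complex \<Rightarrow> 'a operator" where
  "resolvent M A \<mu> f = (SOME g. resolvent_eq M A \<mu> g f)"

definition resolvent_set :: "'a measure \<Rightarrow> 'a graph \<Rightarrow> complex set" where
  "resolvent_set M A = {\<mu>.
     (\<forall>f\<in>L2 M. \<exists>g. resolvent_eq M A \<mu> g f) \<and>
     (\<forall>g. resolvent_eq M A \<mu> g (\<lambda>x. 0) \<longrightarrow> eq_ae M g (\<lambda>x. 0)) \<and>
     bounded_op M (resolvent M A \<mu>)}"

definition op_spectrum :: "'a measure \<Rightarrow> 'a graph \<Rightarrow> complex set" where
  "op_spectrum M A = - resolvent_set M A"

definition spectral_bound :: "'a measure \<Rightarrow> 'a graph \<Rightarrow> ereal" where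
  "spectral_bound M A = (SUP \<mu>\<in>op_spectrum M A. ereal (Re \<mu>))"


section \<open>Semigroups\<close>

definition C0_semigroup :: "'a measure \<Rightarrow> (real \<Rightarrow> 'a operator) \<Rightarrow> bool" where
  "C0_semigroup M T \<longleftrightarrow>
     (\<forall>t\<ge>0. bounded_op M (T t)) \<and>
     (\<forall>f\<in>L2 M. eq_ae M (T 0 f) f) \<and>
     (\<forall>s\<ge>0. \<forall>t\<ge>0. \<forall>f\<in>L2 M. eq_ae M (T (s + t) f) (T s (T t f))) \<and>
     (\<forall>f\<in>L2 M. ((\<lambda>t. l2_norm M (\<lambda>x. T t f x - f x)) \<longlongrightarrow> 0) (at_right 0))"

definition generator :: "'a measure \<Rightarrow> (real \<Rightarrow> 'a operator) \<Rightarrow> 'a graph" where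
  "generator M T = {(f, g). f \<in> L2 M \<and> g \<in> L2 M \<and>
     ((\<lambda>t. l2_norm M (\<lambda>x. (T t f x - f x) / complex_of_real t - g x)) \<longlongrightarrow> 0) (at_right 0)}"

definition self_adjoint_semigroup :: "'a measure \<Rightarrow> (real \<Rightarrow> 'a operator) \<Rightarrow> bool" where
  "self_adjoint_semigroup M T \<longleftrightarrow> (\<forall>t\<ge>0. self_adjoint_op M (T t))"

definition real_semigroup :: "'a measure \<Rightarrow> (real \<Rightarrow> 'a operator) \<Rightarrow> bool" where
  "real_semigroup M T \<longleftrightarrow> (\<forall>t\<ge>0. real_op M (T t))"

definition unif_eventually_strongly_positive ::
    "'a measure \<Rightarrow> 'a cfun \<Rightarrow> (real \<Rightarrow> 'a operator) \<Rightarrow> bool" where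
  "unif_eventually_strongly_positive M u T \<longleftrightarrow>
     (\<exists>t0\<ge>0. \<forall>t\<ge>t0. \<forall>f. positive_nonzero M f \<longrightarrow> strongly_positive M u (T t f))"

end

(*
  A = gen T is bounded above by s = s(A): otherwise the supremum of its quadratic form would be a
  point of the resolvent set, which is impossible for a symmetric operator.  Hence, for
  s + |B| < l < mu1, the inverse K of l - (A + B) is the sum of the Neumann series R (B R)^n with
  R = R(l, A); it is symmetric, positive definite, and K f >= R f >>_u 0 for f > 0.

  D(A) in H_u and positivity give |K f| <= k |f|_2 u almost everywhere.  A bound of this kind makes K
  a Hilbert-Schmidt operator, so that K has a complete sequence of eigenvectors e_n, with decreasing
  eigenvalues kappa_n, and mu_n = l - 1/kappa_n are the eigenvalues of A + B.  Every semigroup S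
  generated by A + B is given by S_t f = sum_n exp(t mu_n) <f, e_n> e_n, which also defines one.

  Since K f >>_u 0 for f > 0, the eigenvalue kappa_0 is simple and e_0 is, up to a phase, at least
  delta u.  The leading term of S_t f is therefore at least c exp(t mu_0) <f, u> u, while the bound
  |K g| <= k |g|_2 u, applied once pointwise and once by duality, estimates the remaining terms by
  o(1) exp(t mu_0) <f, u> u with o(1) independent of f; this makes the positivity time uniform.
*)

theory Submission
  imports Defs "HOL-Library.Function_Algebras"
begin

section \<open>Semi-inner product spaces\<close>

text \<open>The bound on the spectrum is turned into two facts about A: l - A is surjective, and its
  quadratic form is coercive. The inverse of l - (A + B) is built from these alone, so no spectral
  theorem for A is involved. Compactness has D(A) \<subseteq> H_u as its source, and it is used only
  as a bound on sums of \<open>(nrm (K (e i)))\<^sup>2\<close> over finite orthonormal families that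
  does not depend on their length; separability of H is never an issue.

  A semigroup S generated by A + B is not known in advance to be symmetric, positive or real, so
  each of its properties has to be read off from its action on eigenvectors.

  Uniformity in f demands a remainder controlled by <f, u>, and the norm of f is in general not
  bounded by a multiple of <f, u>. Hence the remainder carries one factor K in front, which produces
  u, and another next to f, which produces <f, u>. Undoing both costs kappa_n^-2 = (l - mu_n)^2,
  which the spectral gap lets exp(t (mu_n - mu_0)) absorb at the rate t^-2.\<close>

lemma exp_quotient: "((\<lambda>t. (exp (t * m) - 1) / t) \<longlongrightarrow> m) (at_right (0::real))"
proof -
  have "((\<lambda>t. exp (t * m)) has_real_derivative m) (at 0)"
    by (auto intro!: derivative_eq_intros)
  hence "((\<lambda>h. (exp (h * m) - 1) / h) \<longlongrightarrow> m) (at 0)" by (simp add: DERIV_def)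
  thus ?thesis by (rule tendsto_mono[rotated]) (simp add: at_within_le_at)
qed

text \<open>For negative \<open>x\<close> the extra factor is 1, so the bound stays linear. It
  dominates difference quotients of the exponential uniformly over exponents that need not be
  bounded below.\<close>

lemma exp_minus_1_bound: "\<bar>exp x - 1\<bar> \<le> \<bar>x\<bar> * exp (max x (0::real))"
proof (cases "x \<ge> 0")
  case True
  have "exp x * (1 - x) \<le> exp x * exp (- x)" using exp_ge_add_one_self[of "- x"] by (intro mult_left_mono) auto
  hence "exp x - 1 \<le> x * exp x" by (simp add: exp_minus algebra_simps)
  thus ?thesis using True by simp
next
  case False
  moreover have "1 - exp x \<le> - x" using exp_ge_add_one_self[of x] by linarith
  ultimately show ?thesis by simp
qed

lemma at_right_01: "\<forall>\<^sub>F t in at_right 0. 0 < t \<and> t < (1::real)"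
  unfolding eventually_at_right_field by (rule exI[of _ 1]) auto

text \<open>With \<open>y = t (\<mu>\<^sub>0 - \<mu>)\<close> and \<open>l - \<mu> \<le> (1 + (l - \<mu>\<^sub>0) / \<gamma>) (\<mu>\<^sub>0 - \<mu>)\<close> this reduces to \<open>y\<^sup>2 \<le> 4 e\<^sup>y\<close>.\<close>

lemma exp_gap_bound:
  fixes t l \<mu> \<mu>0 \<gamma> :: real
  assumes t: "t > 0" and g: "\<gamma> > 0" "\<mu> \<le> \<mu>0 - \<gamma>" and l: "\<mu>0 \<le> l"
  shows "exp (t * \<mu>) * (l - \<mu>)\<^sup>2 \<le> exp (t * \<mu>0) * (4 * (1 + (l - \<mu>0) / \<gamma>)\<^sup>2 / t\<^sup>2)"
proof -
  define d where "d = \<mu>0 - \<mu>"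
  have d: "d \<ge> \<gamma>" "d > 0" using g by (auto simp: d_def)
  have "l - \<mu> = d + (l - \<mu>0)" by (simp add: d_def)
  also have "l - \<mu>0 \<le> (l - \<mu>0) / \<gamma> * d"
    using d g l mult_left_mono[OF d(1), of "(l - \<mu>0) / \<gamma>"] by simp
  finally have "l - \<mu> \<le> (1 + (l - \<mu>0) / \<gamma>) * d" by (simp add: algebra_simps)
  hence 1: "(l - \<mu>)\<^sup>2 \<le> (1 + (l - \<mu>0) / \<gamma>)\<^sup>2 * d\<^sup>2"
    using g l power_mono[of "l - \<mu>" "(1 + (l - \<mu>0) / \<gamma>) * d" 2] by (simp add: power_mult_distrib)
  have "t * d / 2 \<le> exp (t * d / 2)" using exp_ge_add_one_self[of "t * d / 2"] by linarith
  hence "(t * d / 2)\<^sup>2 \<le> (exp (t * d / 2))\<^sup>2" using t d by (intro power_mono) auto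
  hence "t\<^sup>2 * d\<^sup>2 \<le> 4 * exp (t * d)" by (simp add: power_mult_distrib power_divide flip: exp_double)
  hence "exp (- (t * d)) * (t\<^sup>2 * d\<^sup>2) \<le> exp (- (t * d)) * (4 * exp (t * d))" by (intro mult_left_mono) auto
  also have "\<dots> = 4" by (simp add: exp_minus)
  finally have "exp (- (t * d)) * (t\<^sup>2 * d\<^sup>2) \<le> 4" .
  hence 2: "exp (- (t * d)) * d\<^sup>2 \<le> 4 / t\<^sup>2" using t by (simp add: field_simps)
  have "exp (t * \<mu>) * (l - \<mu>)\<^sup>2 = exp (t * \<mu>0) * (exp (- (t * d)) * (l - \<mu>)\<^sup>2)"
    by (simp add: d_def algebra_simps flip: exp_add)
  also have "\<dots> \<le> exp (t * \<mu>0) * (exp (- (t * d)) * ((1 + (l - \<mu>0) / \<gamma>)\<^sup>2 * d\<^sup>2))"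
    using 1 by (intro mult_left_mono) auto
  also have "\<dots> = exp (t * \<mu>0) * ((1 + (l - \<mu>0) / \<gamma>)\<^sup>2 * (exp (- (t * d)) * d\<^sup>2))" by (simp only: ac_simps)
  also have "\<dots> \<le> exp (t * \<mu>0) * ((1 + (l - \<mu>0) / \<gamma>)\<^sup>2 * (4 / t\<^sup>2))"
    using 2 by (intro mult_left_mono) auto
  finally show ?thesis by (simp add: ac_simps)
qed

text \<open>The form is only semidefinite, because vectors will be representatives of classes modulo
  null functions; the relation \<open>\<simeq>\<close> below takes the place of equality.\<close>

locale semi_hilbert = vector_space scl
  for scl :: "complex \<Rightarrow> 'v::ab_group_add \<Rightarrow> 'v" (infixr "\<cdot>" 75) +
  fixes H :: "'v set" and ip :: "'v \<Rightarrow> 'v \<Rightarrow> complex"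
  assumes H_subspace: "subspace H"
    and ip_add_left: "\<lbrakk>f \<in> H; g \<in> H; h \<in> H\<rbrakk> \<Longrightarrow> ip (f + g) h = ip f h + ip g h"
    and ip_scl_left: "\<lbrakk>f \<in> H; g \<in> H\<rbrakk> \<Longrightarrow> ip (c \<cdot> f) g = c * ip f g"
    and ip_cnj: "\<lbrakk>f \<in> H; g \<in> H\<rbrakk> \<Longrightarrow> cnj (ip f g) = ip g f"
    and ip_self_ge_0: "f \<in> H \<Longrightarrow> 0 \<le> Re (ip f f)"
    and ip_complete: "\<lbrakk>\<And>n. X n \<in> H;
       \<And>e. e > 0 \<Longrightarrow> \<exists>N::nat. \<forall>m\<ge>N. \<forall>n\<ge>N. sqrt (Re (ip (X m - X n) (X m - X n))) < e\<rbrakk>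
       \<Longrightarrow> \<exists>l\<in>H. (\<lambda>n. sqrt (Re (ip (X n - l) (X n - l)))) \<longlonglongrightarrow> 0"
begin

definition nrm :: "'v \<Rightarrow> real" where
  "nrm f = sqrt (Re (ip f f))"

definition eqv :: "'v \<Rightarrow> 'v \<Rightarrow> bool" (infix "\<simeq>" 50) where
  "f \<simeq> g \<longleftrightarrow> nrm (f - g) = 0"

lemma H_add [simp, intro]: "f \<in> H \<Longrightarrow> g \<in> H \<Longrightarrow> f + g \<in> H"
  and H_diff [simp, intro]: "f \<in> H \<Longrightarrow> g \<in> H \<Longrightarrow> f - g \<in> H"
  and H_scl [simp, intro]: "f \<in> H \<Longrightarrow> c \<cdot> f \<in> H"
  and H_0 [simp, intro]: "0 \<in> H"
  and H_minus [simp, intro]: "f \<in> H \<Longrightarrow> - f \<in> H"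
  using H_subspace by (auto intro: subspace_add subspace_diff subspace_scale subspace_0 subspace_neg)

lemma H_sum [simp, intro]: "(\<And>i. i \<in> I \<Longrightarrow> f i \<in> H) \<Longrightarrow> sum f I \<in> H"
  using H_subspace by (rule subspace_sum)

lemma ip_add_right: "\<lbrakk>f \<in> H; g \<in> H; h \<in> H\<rbrakk> \<Longrightarrow> ip h (f + g) = ip h f + ip h g"
  by (metis H_add complex_cnj_add ip_add_left ip_cnj)

lemma ip_scl_right: "\<lbrakk>f \<in> H; g \<in> H\<rbrakk> \<Longrightarrow> ip g (c \<cdot> f) = cnj c * ip g f"
  by (metis H_scl complex_cnj_mult ip_scl_left ip_cnj)

lemma ip_minus_left: "\<lbrakk>f \<in> H; g \<in> H\<rbrakk> \<Longrightarrow> ip (- f) g = - ip f g"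
  using ip_scl_left[of f g "-1"] by simp

lemma ip_minus_right: "\<lbrakk>f \<in> H; g \<in> H\<rbrakk> \<Longrightarrow> ip g (- f) = - ip g f"
  using ip_scl_right[of f g "-1"] by simp

lemma ip_diff_left: "\<lbrakk>f \<in> H; g \<in> H; h \<in> H\<rbrakk> \<Longrightarrow> ip (f - g) h = ip f h - ip g h"
  using ip_add_left[of f "-g" h] by (simp add: ip_minus_left)

lemma ip_diff_right: "\<lbrakk>f \<in> H; g \<in> H; h \<in> H\<rbrakk> \<Longrightarrow> ip h (f - g) = ip h f - ip h g"
  using ip_add_right[of f "-g" h] by (simp add: ip_minus_right)

lemma ip_zero_left [simp]: "f \<in> H \<Longrightarrow> ip 0 f = 0"
  using ip_scl_left[of f f 0] by simp

lemma ip_zero_right [simp]: "f \<in> H \<Longrightarrow> ip f 0 = 0"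
  using ip_scl_right[of f f 0] by simp

lemma ip_sum_left:
  assumes "\<And>i. i \<in> I \<Longrightarrow> f i \<in> H" "g \<in> H"
  shows "ip (\<Sum>i\<in>I. f i) g = (\<Sum>i\<in>I. ip (f i) g)"
  using assms(1) by (induction I rule: infinite_finite_induct) (auto simp: ip_add_left assms(2))

lemma ip_sum_right:
  assumes "\<And>i. i \<in> I \<Longrightarrow> f i \<in> H" "g \<in> H"
  shows "ip g (\<Sum>i\<in>I. f i) = (\<Sum>i\<in>I. ip g (f i))"
  using assms(1) by (induction I rule: infinite_finite_induct) (auto simp: ip_add_right assms(2))

lemmas ip_simps = ip_add_left ip_add_right ip_diff_left ip_diff_right ip_scl_left ip_scl_right
  ip_minus_left ip_minus_right

lemma ip_self_real: "f \<in> H \<Longrightarrow> Im (ip f f) = 0"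
  using ip_cnj[of f f] by (metis Reals_cnj_iff complex_is_Real_iff)

lemma nrm_ge_0 [simp]: "f \<in> H \<Longrightarrow> 0 \<le> nrm f"
  by (simp add: nrm_def ip_self_ge_0)

lemma nrm_sq: "f \<in> H \<Longrightarrow> (nrm f)\<^sup>2 = Re (ip f f)"
  by (simp add: nrm_def ip_self_ge_0)

lemma ip_self: "f \<in> H \<Longrightarrow> ip f f = complex_of_real ((nrm f)\<^sup>2)"
  by (simp add: nrm_sq complex_eq_iff ip_self_real)

lemma Re_ip_commute: "f \<in> H \<Longrightarrow> g \<in> H \<Longrightarrow> Re (ip f g) = Re (ip g f)"
  by (metis ip_cnj cnj.simps(1))

lemma nrm_scl: "f \<in> H \<Longrightarrow> nrm (c \<cdot> f) = cmod c * nrm f"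
proof -
  assume f: "f \<in> H"
  have "(nrm (c \<cdot> f))\<^sup>2 = (cmod c * nrm f)\<^sup>2"
    using f by (simp add: nrm_sq ip_simps power_mult_distrib cmod_power2 ip_self_real algebra_simps)
      (simp add: power2_eq_square algebra_simps)
  thus ?thesis using f by (auto simp: power2_eq_iff_nonneg)
qed

lemma nrm_zero [simp]: "nrm 0 = 0"
  by (simp add: nrm_def)

lemma nrm_minus [simp]: "f \<in> H \<Longrightarrow> nrm (- f) = nrm f"
  using nrm_scl[of f "-1"] by simp

lemma nrm_minus_commute: "f \<in> H \<Longrightarrow> g \<in> H \<Longrightarrow> nrm (f - g) = nrm (g - f)"
  using nrm_minus[of "f - g"] by simp

lemma nrm_add_sq:
  "f \<in> H \<Longrightarrow> g \<in> H \<Longrightarrow> (nrm (f + g))\<^sup>2 = (nrm f)\<^sup>2 + 2 * Re (ip f g) + (nrm g)\<^sup>2"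
  by (simp add: nrm_sq ip_simps Re_ip_commute[of g f])

lemma nrm_diff_sq:
  "f \<in> H \<Longrightarrow> g \<in> H \<Longrightarrow> (nrm (f - g))\<^sup>2 = (nrm f)\<^sup>2 - 2 * Re (ip f g) + (nrm g)\<^sup>2"
  by (simp add: nrm_sq ip_simps Re_ip_commute[of g f])

text \<open>The discriminant argument for Cauchy-Schwarz. The form may be degenerate, so the cases
  \<open>nrm g = 0\<close> and \<open>nrm f = 0\<close> are not trivial, and each gets its own value
  of \<open>t\<close>.\<close>

lemma Re_ip_le: assumes "f \<in> H" "g \<in> H" shows "Re (ip f g) \<le> nrm f * nrm g"
proof -
  have q: "0 \<le> (nrm f)\<^sup>2 - 2 * t * Re (ip f g) + t\<^sup>2 * (nrm g)\<^sup>2" for t :: real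
  proof -
    have "(nrm (f - of_real t \<cdot> g))\<^sup>2 = (nrm f)\<^sup>2 - 2 * t * Re (ip f g) + t\<^sup>2 * (nrm g)\<^sup>2"
      using assms by (subst nrm_diff_sq) (simp_all add: ip_scl_right nrm_scl power_mult_distrib)
    thus ?thesis by (metis zero_le_power2)
  qed
  show ?thesis
  proof (cases "nrm g = 0")
    case True
    have "Re (ip f g) = 0"
    proof (rule ccontr)
      assume a: "Re (ip f g) \<noteq> 0"
      \<comment> \<open>At this \<open>t\<close> the linear term outweighs
        \<open>(nrm f)\<^sup>2\<close> by 1, while the quadratic term vanishes.\<close>
      have "((nrm f)\<^sup>2 + 1) / (2 * Re (ip f g)) * Re (ip f g) = ((nrm f)\<^sup>2 + 1) / 2"
        using a by simp
      thus False using q[of "((nrm f)\<^sup>2 + 1) / (2 * Re (ip f g))"] True by (simp add: field_simps)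
    qed
    thus ?thesis using True by simp
  next
    case False
    define t where "t = nrm f / nrm g"
    have gp: "nrm g > 0" using False assms by (simp add: less_le)
    show ?thesis
    proof (cases "nrm f = 0")
      case True
      show ?thesis
      proof (rule ccontr)
        assume a: "\<not> ?thesis"
        define r where "r = Re (ip f g)"
        have r: "r > 0" using a True by (simp add: r_def)
        have "0 \<le> - 2 * (r / (nrm g)\<^sup>2) * r + (r / (nrm g)\<^sup>2)\<^sup>2 * (nrm g)\<^sup>2"
          using q[of "r / (nrm g)\<^sup>2"] True by (simp add: r_def)
        also have "\<dots> = - (r\<^sup>2 / (nrm g)\<^sup>2)" using gp by (simp add: field_simps power2_eq_square)
        finally show False using r gp by (simp add: field_simps)
      qed
    next
      case f0: False
      have fp: "nrm f > 0" using f0 assms by (simp add: less_le)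
      have "0 \<le> (nrm f)\<^sup>2 - 2 * t * Re (ip f g) + t\<^sup>2 * (nrm g)\<^sup>2" by (rule q)
      also have "t\<^sup>2 * (nrm g)\<^sup>2 = (nrm f)\<^sup>2" using gp by (simp add: t_def field_simps)
      finally have "t * Re (ip f g) \<le> (nrm f)\<^sup>2" by simp
      thus ?thesis using fp gp by (simp add: t_def field_simps power2_eq_square)
    qed
  qed
qed

text \<open>The unimodular factor \<open>c\<close> rotates the inner product onto the positive real
  axis.\<close>

lemma norm_ip_le: assumes "f \<in> H" "g \<in> H" shows "norm (ip f g) \<le> nrm f * nrm g"
proof (cases "ip f g = 0")
  case False
  define c where "c = cnj (sgn (ip f g))"
  have "c * ip f g = of_real (norm (ip f g))"
    using False by (simp add: c_def sgn_eq complex_norm_square[symmetric] mult.commute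
        power2_eq_square field_simps)
  hence "norm (ip f g) = Re (ip (c \<cdot> f) g)" using assms by (simp add: ip_simps)
  also have "\<dots> \<le> nrm (c \<cdot> f) * nrm g" using assms by (intro Re_ip_le) auto
  also have "nrm (c \<cdot> f) = nrm f" using assms False by (simp add: nrm_scl c_def norm_sgn)
  finally show ?thesis .
qed (use assms in simp)

lemma nrm_triangle: assumes "f \<in> H" "g \<in> H" shows "nrm (f + g) \<le> nrm f + nrm g"
proof -
  have "(nrm (f + g))\<^sup>2 \<le> (nrm f + nrm g)\<^sup>2"
    using nrm_add_sq[of f g] Re_ip_le[of f g] assms by (simp add: power2_sum)
  thus ?thesis using assms by (meson add_nonneg_nonneg nrm_ge_0 power2_le_imp_le)
qed

lemma nrm_triangle_diff: assumes "f \<in> H" "g \<in> H" shows "nrm (f - g) \<le> nrm f + nrm g"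
  using nrm_triangle[of f "-g"] assms by simp

lemma nrm_triangle3:
  assumes "f \<in> H" "g \<in> H" "h \<in> H" shows "nrm (f - h) \<le> nrm (f - g) + nrm (g - h)"
  using nrm_triangle[of "f - g" "g - h"] assms by simp

lemma nrm_le_add: assumes "f \<in> H" "g \<in> H" shows "nrm f \<le> nrm g + nrm (f - g)"
  using nrm_triangle[of g "f - g"] assms by simp

lemma nrm_diff_abs: assumes "f \<in> H" "g \<in> H" shows "\<bar>nrm f - nrm g\<bar> \<le> nrm (f - g)"
  using nrm_le_add[of f g] nrm_le_add[of g f] assms nrm_minus_commute[of f g] by simp

lemma nrm_sum_le:
  assumes "\<And>i. i \<in> I \<Longrightarrow> f i \<in> H" shows "nrm (\<Sum>i\<in>I. f i) \<le> (\<Sum>i\<in>I. nrm (f i))"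
  using assms
proof (induction I rule: infinite_finite_induct)
  case (insert x F)
  thus ?case using nrm_triangle[of "f x" "sum f F"] by (force simp: H_sum)
qed auto

lemma eqv_refl [simp]: "f \<simeq> f" by (simp add: eqv_def)

lemma eqv_sym: "f \<simeq> g \<Longrightarrow> f \<in> H \<Longrightarrow> g \<in> H \<Longrightarrow> g \<simeq> f"
  by (simp add: eqv_def nrm_minus_commute)

lemma eqv_trans: "\<lbrakk>f \<simeq> g; g \<simeq> h; f \<in> H; g \<in> H; h \<in> H\<rbrakk> \<Longrightarrow> f \<simeq> h"
  using nrm_triangle3[of f g h] unfolding eqv_def by (intro order_antisym) auto

lemma eqv_ip_left: "\<lbrakk>f \<simeq> g; f \<in> H; g \<in> H; h \<in> H\<rbrakk> \<Longrightarrow> ip f h = ip g h"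
  using norm_ip_le[of "f - g" h] by (simp add: eqv_def ip_simps)

lemma eqv_ip_right: "\<lbrakk>f \<simeq> g; f \<in> H; g \<in> H; h \<in> H\<rbrakk> \<Longrightarrow> ip h f = ip h g"
  using norm_ip_le[of h "f - g"] by (simp add: eqv_def ip_simps)

text \<open>Operators are linear only up to \<open>\<simeq>\<close>, so most vector identities are
  proved by pairing with an arbitrary \<open>h\<close>, where linearity becomes an equation between
  complex numbers.\<close>

lemma eqvI: assumes "f \<in> H" "g \<in> H" "\<And>h. h \<in> H \<Longrightarrow> ip f h = ip g h" shows "f \<simeq> g"
proof -
  have "ip (f - g) (f - g) = 0" using assms(3)[of "f - g"] assms(1,2) by (simp add: ip_diff_left)
  thus ?thesis by (simp add: eqv_def nrm_def)
qed

lemma eqv_nrm: "\<lbrakk>f \<simeq> g; f \<in> H; g \<in> H\<rbrakk> \<Longrightarrow> nrm f = nrm g"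
  using nrm_diff_abs[of f g] by (simp add: eqv_def)

lemma eqv_0_iff: "f \<simeq> 0 \<longleftrightarrow> nrm f = 0"
  by (simp add: eqv_def)

lemma eqv_add: "\<lbrakk>f \<simeq> g; f' \<simeq> g'; f \<in> H; g \<in> H; f' \<in> H; g' \<in> H\<rbrakk> \<Longrightarrow> f + f' \<simeq> g + g'"
  by (intro eqvI) (auto simp: ip_simps eqv_ip_left[of f g] eqv_ip_left[of f' g'])

lemma eqv_diff: "\<lbrakk>f \<simeq> g; f' \<simeq> g'; f \<in> H; g \<in> H; f' \<in> H; g' \<in> H\<rbrakk> \<Longrightarrow> f - f' \<simeq> g - g'"
  by (intro eqvI) (auto simp: ip_simps eqv_ip_left[of f g] eqv_ip_left[of f' g'])

lemma eqv_scl: "\<lbrakk>f \<simeq> g; f \<in> H; g \<in> H\<rbrakk> \<Longrightarrow> c \<cdot> f \<simeq> c \<cdot> g"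
  by (intro eqvI) (auto simp: ip_simps eqv_ip_left[of f g])

section \<open>Convergence of sequences in the seminorm\<close>

definition lim_to :: "(nat \<Rightarrow> 'v) \<Rightarrow> 'v \<Rightarrow> bool" where
  "lim_to X l \<longleftrightarrow> (\<lambda>n. nrm (X n - l)) \<longlonglongrightarrow> 0"

lemma complete:
  assumes "\<And>n. X n \<in> H" "\<And>e. e > 0 \<Longrightarrow> \<exists>N. \<forall>m\<ge>N. \<forall>n\<ge>N. nrm (X m - X n) < e"
  obtains l where "l \<in> H" "lim_to X l"
  using ip_complete[of X] assms unfolding nrm_def lim_to_def by blast

text \<open>Orthogonality and monotonicity arguments naturally bound squared distances by increments
  of a convergent scalar sequence: squared norms for the powers of an operator, partial sums of
  squared coefficients for an orthogonal series.\<close>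

lemma complete_sq:
  assumes X: "\<And>n. X n \<in> H" and c: "convergent c"
    and le: "\<And>m n. m \<le> n \<Longrightarrow> (nrm (X m - X n))\<^sup>2 \<le> \<bar>c m - c n\<bar>"
  obtains l where "l \<in> H" "lim_to X (l::'v)"
proof (rule complete[of X])
  fix e :: real assume e: "e > 0"
  have "Cauchy c" using c by (simp add: convergent_Cauchy)
  then obtain N where N: "\<And>m n. m \<ge> N \<Longrightarrow> n \<ge> N \<Longrightarrow> norm (c m - c n) < e\<^sup>2"
    using e unfolding Cauchy_iff by (meson zero_less_power)
  have "nrm (X m - X n) < e" if "m \<ge> N" "n \<ge> N" for m n
  proof -
    have "(nrm (X m - X n))\<^sup>2 \<le> \<bar>c m - c n\<bar>"
      using le[of m n] le[of n m] X nrm_minus_commute[of "X m" "X n"]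
      by (cases "m \<le> n") (auto simp: abs_minus_commute)
    also have "\<dots> < e\<^sup>2" using N that by simp
    finally show ?thesis using e by (meson less_le_not_le linorder_not_le power2_less_imp_less)
  qed
  thus "\<exists>N. \<forall>m\<ge>N. \<forall>n\<ge>N. nrm (X m - X n) < e" by blast
qed (use X that in auto)

lemma lim_to_ip:
  assumes "lim_to X l" "\<And>n. X n \<in> H" "l \<in> H" "g \<in> H"
  shows "(\<lambda>n. ip (X n) g) \<longlonglongrightarrow> ip l g"
proof -
  have "(\<lambda>n. nrm (X n - l) * nrm g) \<longlonglongrightarrow> 0"
    using tendsto_mult_left_zero assms(1) unfolding lim_to_def by blast
  hence "(\<lambda>n. ip (X n) g - ip l g) \<longlonglongrightarrow> 0"
    by (rule Lim_null_comparison[rotated])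
      (use norm_ip_le assms in \<open>auto simp flip: ip_diff_left\<close>)
  thus ?thesis by (simp add: LIM_zero_iff)
qed

lemma lim_to_nrm:
  assumes "lim_to X l" "\<And>n. X n \<in> H" "l \<in> H"
  shows "(\<lambda>n. nrm (X n)) \<longlonglongrightarrow> nrm l"
proof -
  have "(\<lambda>n. nrm (X n) - nrm l) \<longlonglongrightarrow> 0"
    by (rule Lim_null_comparison[OF _ assms(1)[unfolded lim_to_def]])
      (use nrm_diff_abs assms in auto)
  thus ?thesis by (simp add: LIM_zero_iff)
qed

lemma lim_to_unique:
  assumes "lim_to X l" "lim_to X l'" "\<And>n. X n \<in> H" "l \<in> H" "l' \<in> H"
  shows "l \<simeq> l'"
  by (rule eqvI[OF assms(4,5)]) (rule LIMSEQ_unique[OF lim_to_ip[OF assms(1,3,4)] lim_to_ip[OF assms(2,3,5)]])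

section \<open>Bounded and symmetric operators\<close>

definition bdd_op :: "('v \<Rightarrow> 'v) \<Rightarrow> bool" where
  "bdd_op T \<longleftrightarrow> (\<forall>f\<in>H. T f \<in> H) \<and> (\<forall>f\<in>H. \<forall>g\<in>H. f \<simeq> g \<longrightarrow> T f \<simeq> T g) \<and>
     (\<forall>f\<in>H. \<forall>g\<in>H. \<forall>a b. T (a \<cdot> f + b \<cdot> g) \<simeq> a \<cdot> T f + b \<cdot> T g) \<and>
     (\<exists>K. \<forall>f\<in>H. nrm (T f) \<le> K * nrm f)"

definition sym_op :: "('v \<Rightarrow> 'v) \<Rightarrow> bool" where
  "sym_op T \<longleftrightarrow> (\<forall>f\<in>H. T f \<in> H) \<and> (\<forall>f\<in>H. \<forall>g\<in>H. ip (T f) g = ip f (T g))"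

lemma bdd_opD:
  assumes "bdd_op T"
  shows "f \<in> H \<Longrightarrow> T f \<in> H"
    and "f \<in> H \<Longrightarrow> g \<in> H \<Longrightarrow> f \<simeq> g \<Longrightarrow> T f \<simeq> T g"
    and "f \<in> H \<Longrightarrow> g \<in> H \<Longrightarrow> T (a \<cdot> f + b \<cdot> g) \<simeq> a \<cdot> T f + b \<cdot> T g"
    and "f \<in> H \<Longrightarrow> g \<in> H \<Longrightarrow> T (f + g) \<simeq> T f + T g"
    and "f \<in> H \<Longrightarrow> g \<in> H \<Longrightarrow> T (f - g) \<simeq> T f - T g"
    and "f \<in> H \<Longrightarrow> T (a \<cdot> f) \<simeq> a \<cdot> T f"
proof -
  note d = assms[unfolded bdd_op_def]
  show "f \<in> H \<Longrightarrow> T f \<in> H" "f \<in> H \<Longrightarrow> g \<in> H \<Longrightarrow> f \<simeq> g \<Longrightarrow> T f \<simeq> T g" using d by auto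
  show l: "f \<in> H \<Longrightarrow> g \<in> H \<Longrightarrow> T (a \<cdot> f + b \<cdot> g) \<simeq> a \<cdot> T f + b \<cdot> T g" for f g a b
    using d by auto
  show "f \<in> H \<Longrightarrow> g \<in> H \<Longrightarrow> T (f + g) \<simeq> T f + T g" using l[of f g 1 1] by simp
  show "f \<in> H \<Longrightarrow> g \<in> H \<Longrightarrow> T (f - g) \<simeq> T f - T g" using l[of f g 1 "-1"] by simp
  show "f \<in> H \<Longrightarrow> T (a \<cdot> f) \<simeq> a \<cdot> T f" using l[of f f a 0] by simp
qed

lemma bdd_op_bound:
  assumes "bdd_op T" obtains K where "K > 0" "\<And>f. f \<in> H \<Longrightarrow> nrm (T f) \<le> K * nrm f"
proof -
  obtain K where K: "\<And>f. f \<in> H \<Longrightarrow> nrm (T f) \<le> K * nrm f"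
    using assms unfolding bdd_op_def by blast
  show ?thesis
  proof (rule that[of "\<bar>K\<bar> + 1"])
    fix f assume f: "f \<in> H"
    have "nrm (T f) \<le> K * nrm f" by (rule K[OF f])
    also have "\<dots> \<le> (\<bar>K\<bar> + 1) * nrm f" using f by (intro mult_right_mono) auto
    finally show "nrm (T f) \<le> (\<bar>K\<bar> + 1) * nrm f" .
  qed auto
qed

text \<open>Linearity and compatibility with \<open>\<simeq>\<close> follow from symmetry alone:
  \<open>ip (T f) h = ip f (T h)\<close> is linear in \<open>f\<close> and depends only on the class
  of \<open>f\<close>.\<close>

lemma sym_opD:
  assumes "sym_op T"
  shows "f \<in> H \<Longrightarrow> T f \<in> H"
    and "f \<in> H \<Longrightarrow> g \<in> H \<Longrightarrow> ip (T f) g = ip f (T g)"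
    and "f \<in> H \<Longrightarrow> g \<in> H \<Longrightarrow> f \<simeq> g \<Longrightarrow> T f \<simeq> T g"
    and "f \<in> H \<Longrightarrow> g \<in> H \<Longrightarrow> T (f + g) \<simeq> T f + T g"
    and "f \<in> H \<Longrightarrow> g \<in> H \<Longrightarrow> T (f - g) \<simeq> T f - T g"
    and "f \<in> H \<Longrightarrow> T (a \<cdot> f) \<simeq> a \<cdot> T f"
proof -
  note d = assms[unfolded sym_op_def]
  show "f \<in> H \<Longrightarrow> T f \<in> H" using d by auto
  show "f \<in> H \<Longrightarrow> g \<in> H \<Longrightarrow> ip (T f) g = ip f (T g)" using d by auto
  show "f \<in> H \<Longrightarrow> g \<in> H \<Longrightarrow> f \<simeq> g \<Longrightarrow> T f \<simeq> T g"
    using d by (intro eqvI) (auto intro: eqv_ip_left)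
  show "f \<in> H \<Longrightarrow> g \<in> H \<Longrightarrow> T (f + g) \<simeq> T f + T g"
    using d by (intro eqvI) (auto simp: ip_add_left)
  show "f \<in> H \<Longrightarrow> g \<in> H \<Longrightarrow> T (f - g) \<simeq> T f - T g"
    using d by (intro eqvI) (auto simp: ip_diff_left)
  show "f \<in> H \<Longrightarrow> T (a \<cdot> f) \<simeq> a \<cdot> T f"
    using d by (intro eqvI) (auto simp: ip_scl_left)
qed

lemma sym_op_bdd:
  assumes "sym_op T" "\<And>f. f \<in> H \<Longrightarrow> nrm (T f) \<le> K * nrm f"
  shows "bdd_op T"
proof -
  have "T (a \<cdot> f + b \<cdot> g) \<simeq> a \<cdot> T f + b \<cdot> T g" if "f \<in> H" "g \<in> H" for f g a b
    using assms(1) that unfolding sym_op_def by (intro eqvI) (auto simp: ip_simps)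
  thus ?thesis unfolding bdd_op_def
    by (intro conjI ballI impI allI exI[of _ K] sym_opD(1,3)[OF assms(1)] assms(2))
qed

end

section \<open>Eigenvectors of compact positive operators\<close>

context semi_hilbert
begin

definition orthonormal :: "nat \<Rightarrow> (nat \<Rightarrow> 'v) \<Rightarrow> bool" where
  "orthonormal n e \<longleftrightarrow> (\<forall>i<n. e i \<in> H) \<and> (\<forall>i<n. \<forall>j<n. ip (e i) (e j) = (if i = j then 1 else 0))"

lemma sym_op_power:
  assumes L: "sym_op L" and f: "f \<in> H" and g: "g \<in> H"
  shows "(L ^^ n) f \<in> H" "ip ((L ^^ n) f) g = ip f ((L ^^ n) g)"
proof -
  have 1: "(L ^^ n) h \<in> H" if "h \<in> H" for h n
    using that by (induction n) (auto intro: sym_opD(1)[OF L])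
  show "(L ^^ n) f \<in> H" using 1 f .
  show "ip ((L ^^ n) f) g = ip f ((L ^^ n) g)" using f g
  proof (induction n arbitrary: g)
    case (Suc n)
    have "ip ((L ^^ Suc n) f) g = ip ((L ^^ n) f) (L g)"
      using Suc.prems 1 sym_opD(2)[OF L] by simp
    also have "\<dots> = ip f ((L ^^ n) (L g))" using Suc.prems sym_opD(1)[OF L] Suc.IH by simp
    finally show ?case by (simp add: funpow_swap1)
  qed simp
qed

text \<open>For 0 \<le> L \<le> 1 on \<open>G\<close> the numbers \<open>a k\<close> decrease, and
  the squared distance of two iterates is \<open>a (2 * m) - 2 * a (m + n) + a (2 * n)\<close>. The
  limit is the component of \<open>f\<close> in the fixed space of \<open>L\<close>, obtained
  without a spectral projection.\<close>

lemma power_limit: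
  assumes L: "sym_op L" and GH: "G \<subseteq> H" and LG: "\<And>f. f \<in> G \<Longrightarrow> L f \<in> G"
    and lo: "\<And>f. f \<in> G \<Longrightarrow> (nrm (L f))\<^sup>2 \<le> Re (ip (L f) f)"
    and hi: "\<And>f. f \<in> G \<Longrightarrow> Re (ip (L f) f) \<le> (nrm f)\<^sup>2"
    and f: "f \<in> G"
  obtains p where "p \<in> H" "lim_to (\<lambda>n. (L ^^ n) f) p" "L p \<simeq> p"
proof -
  have fH: "f \<in> H" using f GH by auto
  have nG: "(L ^^ n) f \<in> G" for n using f by (induction n) (auto intro: LG)
  have nH: "(L ^^ n) f \<in> H" for n using nG GH by auto
  define a where "a = (\<lambda>k. Re (ip ((L ^^ k) f) f))"
  have ipa: "Re (ip ((L ^^ m) f) ((L ^^ n) f)) = a (m + n)" for m n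
    using sym_op_power(2)[OF L nH[of m] fH, of n] unfolding a_def
    by (simp add: funpow_add[symmetric, THEN fun_cong, unfolded comp_def] add.commute)
  have even: "a (2 * j) = (nrm ((L ^^ j) f))\<^sup>2" for j
    using ipa[of j j] by (simp add: nrm_sq[OF nH] mult_2)
  have odd: "a (Suc (2 * j)) = Re (ip (L ((L ^^ j) f)) ((L ^^ j) f))" for j
    using ipa[of "Suc j" j] by (simp add: mult_2)
  \<comment> \<open>The two hypotheses alternate: \<open>hi\<close> gives the step from even to odd
    index, \<open>lo\<close> the step from odd to even.\<close>
  have dec1: "a (Suc k) \<le> a k" for k
  proof (cases "even k")
    case True
    then obtain j where "k = 2 * j" by (auto elim: evenE)
    thus ?thesis using hi[OF nG, of j] even odd by simp
  next
    case False
    then obtain j where k: "k = Suc (2 * j)" by (auto elim: oddE)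
    have "a (2 * Suc j) \<le> a (Suc (2 * j))"
      unfolding even odd using lo[OF nG, of j] by simp
    thus ?thesis using k by simp
  qed
  have dec: "a n \<le> a m" if "m \<le> n" for m n using that dec1 by (rule lift_Suc_antimono_le[rotated])
  have a0: "a k \<ge> 0" for k
  proof -
    have "a k \<ge> a (2 * k)" by (rule dec) simp
    thus ?thesis using even[of k] by (metis order_trans zero_le_power2)
  qed
  have "decseq (\<lambda>j. a (2 * j))" by (auto simp: decseq_def intro: dec)
  hence conv: "convergent (\<lambda>j. a (2 * j))"
    by (rule decseq_convergent[of _ 0]) (auto simp: a0 convergentI)
  have "(nrm ((L ^^ m) f - (L ^^ n) f))\<^sup>2 \<le> \<bar>a (2 * m) - a (2 * n)\<bar>" if "m \<le> n" for m n
  proof -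
    have "(nrm ((L ^^ m) f - (L ^^ n) f))\<^sup>2 = a (2 * m) - 2 * a (m + n) + a (2 * n)"
      by (simp add: nrm_diff_sq nH ipa even)
    also have "\<dots> \<le> a (2 * m) - a (2 * n)" using dec[of "m + n" "2 * n"] that by simp
    finally show ?thesis by linarith
  qed
  then obtain p where p: "p \<in> H" "lim_to (\<lambda>n. (L ^^ n) f) p"
    using complete_sq[of "\<lambda>n. (L ^^ n) f", OF nH conv] by blast
  have "L p \<simeq> p"
  proof (rule eqvI)
    fix h assume h: "h \<in> H"
    have "(\<lambda>n. ip ((L ^^ n) f) (L h)) \<longlonglongrightarrow> ip p (L h)"
      using p h nH sym_opD(1)[OF L] by (intro lim_to_ip) auto
    moreover have "ip ((L ^^ n) f) (L h) = ip ((L ^^ Suc n) f) h" for n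
      using sym_opD(2)[OF L nH h] by simp
    ultimately have "(\<lambda>n. ip ((L ^^ Suc n) f) h) \<longlonglongrightarrow> ip p (L h)" by simp
    moreover have "(\<lambda>n. ip ((L ^^ Suc n) f) h) \<longlonglongrightarrow> ip p h"
      using lim_to_ip[OF p(2) nH p(1) h] by (rule LIMSEQ_Suc)
    ultimately have "ip p (L h) = ip p h" by (rule LIMSEQ_unique)
    thus "ip (L p) h = ip p h" using sym_opD(2)[OF L p(1) h] by simp
  qed (use p sym_opD(1)[OF L] in auto)
  with p show ?thesis by (rule that)
qed

text \<open>If all powers of \<open>L\<close> tend to \<open>0\<close>, an approximate fixed vector \<open>f\<close> gives \<open>h = L\<^sup>n f\<close> with
  \<open>h\<close> almost fixed and \<open>\<langle>h, e i\<rangle> = \<langle>f, L\<^sup>n (e i)\<rangle>\<close> small, so \<open>h\<close> is almost orthogonal to the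
  given family.\<close>

lemma orthonormal_extend:
  assumes L: "sym_op L" and G: "G \<subseteq> H" "subspace G" and LG: "\<And>f. f \<in> G \<Longrightarrow> L f \<in> G"
    and lo: "\<And>f. f \<in> G \<Longrightarrow> (nrm (L f))\<^sup>2 \<le> Re (ip (L f) f)"
    and hi: "\<And>f. f \<in> G \<Longrightarrow> Re (ip (L f) f) \<le> (nrm f)\<^sup>2"
    and sup: "\<And>\<epsilon>. \<epsilon> > 0 \<Longrightarrow> \<exists>f\<in>G. nrm f \<le> 1 \<and> Re (ip (L f) f) > 1 - \<epsilon>"
    and null: "\<And>f. f \<in> G \<Longrightarrow> (\<lambda>n. nrm ((L ^^ n) f)) \<longlonglongrightarrow> 0"
  shows "\<exists>e. orthonormal N e \<and> (\<forall>i<N. e i \<in> G \<and> 1/2 \<le> nrm (L (e i)))"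
proof (induction N)
  case 0
  show ?case by (simp add: orthonormal_def)
next
  case (Suc N)
  then obtain e where e: "orthonormal N e" "\<And>i. i < N \<Longrightarrow> e i \<in> G"
    and e12: "\<And>i. i < N \<Longrightarrow> 1/2 \<le> nrm (L (e i))" by auto
  have eH: "e i \<in> H" if "i < N" for i using e(2)[OF that] G by auto
  have ipe: "ip (e i) (e j) = (if i = j then 1 else 0)" if "i < N" "j < N" for i j
    using e(1) that by (auto simp: orthonormal_def)
  have LH: "L f \<in> H" if "f \<in> H" for f using that sym_opD(1)[OF L] by auto
  have contr: "nrm (L f) \<le> nrm f" if "f \<in> G" for f
    using lo[OF that] hi[OF that] that G by (intro power2_le_imp_le[of "nrm (L f)"]) auto
  \<comment> \<open>Error budget: \<open>\<eta>\<close> keeps the component of \<open>h\<close>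
    along the \<open>N\<close> old vectors within 1/20, and \<open>\<delta>\<close> keeps the drift
    from \<open>f\<close> to \<open>(L ^^ Suc n) f\<close> within 1/20. The order of choice matters:
    \<open>n\<close> depends on the old family only, and \<open>f\<close> is taken after
    \<open>n\<close>.\<close>
  define \<eta> where "\<eta> = 1 / (20 * (real N + 1))"
  have \<eta>: "\<eta> > 0" "real N * \<eta> \<le> 1/20" by (auto simp: \<eta>_def field_simps)
  have "\<forall>i<N. \<forall>\<^sub>F n in sequentially. nrm ((L ^^ n) (e i)) < \<eta>"
    by (intro allI impI order_tendstoD(2)[OF null[OF e(2)] \<eta>(1)])
  hence "\<forall>\<^sub>F n in sequentially. \<forall>i\<in>{..<N}. nrm ((L ^^ n) (e i)) < \<eta>"
    by (subst eventually_ball_finite_distrib) auto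
  then obtain n where n: "\<And>i. i < N \<Longrightarrow> nrm ((L ^^ n) (e i)) < \<eta>"
    by (auto simp: eventually_sequentially)
  define \<delta> where "\<delta> = 1 / (20 * (real n + 1))"
  have \<delta>: "\<delta> > 0" "\<delta> \<le> 1/20" "real (Suc n) * \<delta> = 1/20" by (auto simp: \<delta>_def field_simps)
  \<comment> \<open>A defect of \<open>\<delta>\<^sup>2/2\<close> in the form yields
    \<open>nrm (f - L f) \<le> \<delta>\<close>, because the squared distance is at most
    \<open>1 - 2 * (1 - \<delta>\<^sup>2/2) + 1\<close>.\<close>
  obtain f where f: "f \<in> G" "nrm f \<le> 1" "Re (ip (L f) f) > 1 - \<delta>\<^sup>2/2"
    using sup[of "\<delta>\<^sup>2/2"] \<delta>(1) by auto
  have fH: "f \<in> H" using f G by auto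
  have powG: "(L ^^ k) f \<in> G" for k using f by (induction k) (auto intro: LG)
  have powH: "(L ^^ k) f \<in> H" for k using powG G by auto
  have fL: "nrm (f - L f) \<le> \<delta>"
  proof -
    have "(nrm (L f))\<^sup>2 \<le> 1"
      using contr[OF f(1)] f(2) fH LH by (intro power_le_one) auto
    moreover have "(nrm f)\<^sup>2 \<le> 1" using f(2) fH by (intro power_le_one) auto
    moreover have "(nrm (f - L f))\<^sup>2 = (nrm f)\<^sup>2 - 2 * Re (ip (L f) f) + (nrm (L f))\<^sup>2"
      using fH LH by (simp add: nrm_diff_sq Re_ip_commute[of f])
    ultimately have "(nrm (f - L f))\<^sup>2 \<le> \<delta>\<^sup>2" using f(3) by linarith
    thus ?thesis using \<delta>(1) by (meson less_le power2_le_imp_le)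
  qed
  have step: "nrm ((L ^^ k) f - (L ^^ Suc k) f) \<le> \<delta>" for k
  proof (induction k)
    case (Suc k)
    have d: "(L ^^ k) f - (L ^^ Suc k) f \<in> G" using powG G(2) by (blast intro: subspace_diff)
    have "L ((L ^^ k) f - (L ^^ Suc k) f) \<simeq> L ((L ^^ k) f) - L ((L ^^ Suc k) f)"
      using sym_opD(5)[OF L powH powH] .
    hence "nrm (L ((L ^^ k) f - (L ^^ Suc k) f)) = nrm ((L ^^ Suc k) f - (L ^^ Suc (Suc k)) f)"
      using powH LH by (subst eqv_nrm[of _ "L ((L ^^ k) f) - L ((L ^^ Suc k) f)"]) auto
    thus ?case using contr[OF d] Suc by simp
  qed (use fL in simp)
  have far: "nrm (f - (L ^^ k) f) \<le> real k * \<delta>" for k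
  proof (induction k)
    case (Suc k)
    show ?case using nrm_triangle3[OF fH powH[of k] powH[of "Suc k"]] step[of k] Suc
      by (simp add: algebra_simps)
  qed simp
  define h where "h = (L ^^ n) f"
  have h: "h \<in> G" "h \<in> H" using powG powH by (auto simp: h_def)
  have "nrm ((L ^^ k) f) \<le> 1" for k
    by (induction k) (use contr[OF powG] f(2) in \<open>auto intro: order_trans\<close>)
  hence h1: "nrm h \<le> 1" by (simp add: h_def)
  have Lh: "nrm (L h) \<ge> 9/10"
  proof -
    have "nrm f \<ge> (nrm f)\<^sup>2" using f(2) fH by (simp add: power2_eq_square mult_left_le)
    hence "nrm f \<ge> 1 - \<delta>\<^sup>2/2" using hi[OF f(1)] f(3) by simp
    moreover have "\<delta>\<^sup>2 \<le> 1/20"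
      using mult_mono[OF \<delta>(2), of \<delta> 1] \<delta>(1,2) by (simp add: power2_eq_square)
    moreover have "nrm f \<le> nrm ((L ^^ Suc n) f) + nrm (f - (L ^^ Suc n) f)"
      using nrm_le_add fH powH by blast
    ultimately show ?thesis using far[of "Suc n"] \<delta>(3) by (simp add: h_def)
  qed
  define s where "s = (\<Sum>i<N. ip h (e i) \<cdot> e i)"
  have sG: "s \<in> G" unfolding s_def using e(2) G(2) by (intro subspace_sum subspace_scale) auto
  have sH: "s \<in> H" using sG G by auto
  have small: "cmod (ip h (e i)) \<le> \<eta>" if "i < N" for i
  proof -
    have "ip h (e i) = ip f ((L ^^ n) (e i))"
      unfolding h_def using sym_op_power(2)[OF L fH eH[OF that]] .
    hence "cmod (ip h (e i)) \<le> nrm f * nrm ((L ^^ n) (e i))"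
      using norm_ip_le[OF fH sym_op_power(1)[OF L eH[OF that] fH]] by simp
    also have "\<dots> \<le> 1 * nrm ((L ^^ n) (e i))"
      using f(2) sym_op_power(1)[OF L eH[OF that] fH] by (intro mult_right_mono) auto
    finally show ?thesis using n[OF that] by simp
  qed
  have s1: "nrm s \<le> 1/20"
  proof -
    have "nrm s \<le> (\<Sum>i<N. nrm (ip h (e i) \<cdot> e i))" unfolding s_def using eH by (intro nrm_sum_le) auto
    also have "\<dots> \<le> (\<Sum>i<N. \<eta>)"
    proof (intro sum_mono)
      fix i assume "i \<in> {..<N}"
      hence i: "i < N" by simp
      have "nrm (e i) = 1" using ipe[OF i i] by (simp add: nrm_def)
      thus "nrm (ip h (e i) \<cdot> e i) \<le> \<eta>" using small[OF i] eH[OF i] by (simp add: nrm_scl)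
    qed
    finally show ?thesis using \<eta>(2) by simp
  qed
  define v where "v = h - s"
  have v: "v \<in> G" "v \<in> H" using h sG sH G(2) by (auto simp: v_def intro: subspace_diff)
  have vi: "ip v (e i) = 0" if "i < N" for i
  proof -
    have "ip s (e i) = (\<Sum>j<N. ip h (e j) * ip (e j) (e i))"
      unfolding s_def using eH that by (subst ip_sum_left) (auto simp: ip_scl_left)
    also have "\<dots> = (\<Sum>j<N. if j = i then ip h (e i) else 0)"
      using that by (intro sum.cong) (auto simp: ipe)
    also have "\<dots> = ip h (e i)" using that by simp
    finally show ?thesis using h(2) sH eH[OF that] by (simp add: v_def ip_diff_left)
  qed
  have v1: "nrm v \<le> 21/20" using nrm_triangle_diff[OF h(2) sH] h1 s1 by (simp add: v_def)
  \<comment> \<open>The value is 9/10 - 1/20. Normalising \<open>v\<close>, whose norm is at most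
    21/20, leaves ample room above 1/2.\<close>
  have Lv: "nrm (L v) \<ge> 17/20"
  proof -
    have "L v \<simeq> L h - L s" unfolding v_def using sym_opD(5)[OF L h(2) sH] .
    hence "nrm (L v) = nrm (L h - L s)" using v h sH LH by (intro eqv_nrm) auto
    moreover have "nrm (L h) \<le> nrm (L h - L s) + nrm (L s)"
      using nrm_triangle[of "L h - L s" "L s"] h sH LH by simp
    ultimately show ?thesis using Lh contr[OF sG] s1 by simp
  qed
  have v0: "nrm v > 0" using Lv contr[OF v(1)] by linarith
  define w where "w = of_real (1 / nrm v) \<cdot> v"
  have w: "w \<in> G" "w \<in> H" using v G(2) by (auto simp: w_def intro: subspace_scale)
  have ww: "ip w w = 1"
    using v v0 w(2) by (simp add: ip_self w_def nrm_scl norm_divide)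
  have we: "ip w (e i) = 0" "ip (e i) w = 0" if "i < N" for i
    using vi[OF that] v eH[OF that] ip_cnj[of w "e i"] w by (auto simp: w_def ip_simps)
  have Lw: "1/2 \<le> nrm (L w)"
  proof -
    have "L w \<simeq> of_real (1 / nrm v) \<cdot> L v" unfolding w_def using sym_opD(6)[OF L v(2)] .
    hence "nrm (L w) = nrm (L v) / nrm v"
      using eqv_nrm[of "L w" "of_real (1 / nrm v) \<cdot> L v"] v w LH v0 by (simp add: nrm_scl norm_divide)
    also have "\<dots> \<ge> 1/2" using Lv v1 v0 by (simp add: field_simps)
    finally show ?thesis .
  qed
  define e' where "e' = e(N := w)"
  have "orthonormal (Suc N) e'"
    unfolding orthonormal_def e'_def using w eH ww we ipe by (auto simp: less_Suc_eq)
  moreover have "\<forall>i<Suc N. e' i \<in> G \<and> 1/2 \<le> nrm (L (e' i))"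
    using w Lw e(2) e12 by (auto simp: e'_def less_Suc_eq)
  ultimately show ?case by blast
qed

end

text \<open>\<open>K_psd\<close> says that the form of the inverse of \<open>K\<close> is bounded
  below by \<open>c\<close>. \<open>K_hs\<close> is compactness in usable form: no orthonormal
  family can have infinitely many members on which \<open>K\<close> stays away from 0.\<close>

locale compact_psd = semi_hilbert scl H ip
  for scl :: "complex \<Rightarrow> 'v::ab_group_add \<Rightarrow> 'v" (infixr "\<cdot>" 75) and H ip +
  fixes K :: "'v \<Rightarrow> 'v" and c Q :: real
  assumes K_sym: "sym_op K" and c_pos: "c > 0"
    and K_psd: "f \<in> H \<Longrightarrow> c * (nrm (K f))\<^sup>2 \<le> Re (ip (K f) f)"
    and K_inj: "f \<in> H \<Longrightarrow> nrm (K f) = 0 \<Longrightarrow> nrm f = 0"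
    and K_hs: "orthonormal n e \<Longrightarrow> (\<Sum>i<n. (nrm (K (e i)))\<^sup>2) \<le> Q"
begin

lemmas K_H [simp, intro] = sym_opD(1)[OF K_sym]
lemmas K_ip = sym_opD(2)[OF K_sym]

lemma K_bound: assumes "f \<in> H" shows "nrm (K f) \<le> 1 / c * nrm f"
proof (cases "nrm (K f) = 0")
  case False
  hence "nrm (K f) > 0" using assms by (simp add: less_le)
  moreover have "c * nrm (K f) * nrm (K f) \<le> nrm f * nrm (K f)"
    using K_psd[OF assms] Re_ip_le[of "K f" f] assms by (simp add: power2_eq_square ac_simps)
  ultimately have "c * nrm (K f) \<le> nrm f" by (simp only: mult_le_cancel_right_pos)
  thus ?thesis using c_pos by (simp add: field_simps)
qed (use assms c_pos in simp)

lemma K_psd0: "f \<in> H \<Longrightarrow> 0 \<le> Re (ip (K f) f)"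
  using K_psd[of f] c_pos by (smt (verit) mult_nonneg_nonneg zero_le_power2)

text \<open>The supremum \<open>k\<close> of the form on the unit ball of \<open>G\<close> is an
  eigenvalue. For \<open>L = K / k\<close> one has 0 \<le> L \<le> 1 on \<open>G\<close> with
  supremum 1; were all powers of \<open>L\<close> to tend to 0 pointwise, there would be orthonormal
  families of any length with \<open>nrm (K (e i)) \<ge> k / 2\<close>, against \<open>K_hs\<close>.
  So some orbit has a nonzero limit, which \<open>L\<close> fixes. \<open>G\<close> is invariant
  because \<open>X\<close> consists of eigenvectors of the symmetric \<open>K\<close>.\<close>

lemma eigenvector_exists:
  assumes XH: "X \<subseteq> H" and eig: "\<And>w. w \<in> X \<Longrightarrow> \<exists>k. K w \<simeq> k \<cdot> w"
    and G: "G = {f \<in> H. \<forall>w\<in>X. ip f w = 0}" and f0: "f\<^sub>0 \<in> G" "nrm f\<^sub>0 \<noteq> 0"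
  shows "\<exists>w k. w \<in> G \<and> nrm w = 1 \<and> k > 0 \<and> K w \<simeq> of_real k \<cdot> w \<and>
           (\<forall>f\<in>G. Re (ip (K f) f) \<le> k * (nrm f)\<^sup>2)"
proof -
  have GH: "G \<subseteq> H" using G by auto
  have Gs: "subspace G" unfolding G using XH by (intro subspaceI) (auto simp: ip_simps subset_iff)
  have KG: "K f \<in> G" if "f \<in> G" for f
  proof -
    have "ip (K f) w = 0" if "w \<in> X" for w
    proof -
      obtain k where "K w \<simeq> k \<cdot> w" using eig \<open>w \<in> X\<close> by auto
      hence "ip f (K w) = ip f (k \<cdot> w)" using \<open>w \<in> X\<close> \<open>f \<in> G\<close> GH XH by (intro eqv_ip_right) auto
      thus ?thesis using \<open>w \<in> X\<close> \<open>f \<in> G\<close> GH XH G by (auto simp: K_ip ip_scl_right)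
    qed
    thus ?thesis using that GH G by auto
  qed
  define V where "V = {Re (ip (K f) f) | f. f \<in> G \<and> nrm f \<le> 1}"
  have "0 \<in> V" unfolding V_def
    by (rule CollectI, rule exI[of _ 0]) (use Gs in \<open>auto intro: subspace_0\<close>)
  hence V0: "V \<noteq> {}" by auto
  have Vb: "bdd_above V"
  proof (rule bdd_aboveI[of _ "1 / c"])
    fix x assume "x \<in> V"
    then obtain f where f: "f \<in> G" "nrm f \<le> 1" "x = Re (ip (K f) f)" by (auto simp: V_def)
    have fH: "f \<in> H" using f GH by auto
    have "x \<le> nrm (K f) * nrm f" using f fH by (simp add: Re_ip_le)
    also have "\<dots> \<le> nrm (K f) * 1" using f fH by (intro mult_left_mono) auto
    also have "\<dots> \<le> 1 / c * nrm f" using K_bound[OF fH] by simp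
    also have "\<dots> \<le> 1 / c * 1" using f c_pos by (intro mult_left_mono) auto
    finally show "x \<le> 1 / c" by simp
  qed
  define k where "k = Sup V"
  have kle: "Re (ip (K f) f) \<le> k * (nrm f)\<^sup>2" if "f \<in> G" for f
  proof -
    have fH: "f \<in> H" using that GH by auto
    show ?thesis
    proof (cases "nrm f = 0")
      case True
      thus ?thesis using Re_ip_le[of "K f" f] fH by simp
    next
      case False
      hence p: "nrm f > 0" using fH by (simp add: less_le)
      define g where "g = of_real (1 / nrm f) \<cdot> f"
      have g: "g \<in> G" "g \<in> H" "nrm g = 1"
        using that fH Gs p by (auto simp: g_def nrm_scl norm_divide intro: subspace_scale)
      have "Re (ip (K g) g) \<le> k" unfolding k_def
        by (rule cSup_upper[OF _ Vb]) (use g in \<open>auto simp: V_def\<close>)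
      moreover have "ip (K g) g = ip (of_real (1 / nrm f) \<cdot> K f) g"
        using g fH by (intro eqv_ip_left) (auto simp: g_def intro: sym_opD(6)[OF K_sym])
      hence "ip (K g) g = of_real (1 / (nrm f)\<^sup>2) * ip (K f) f"
        using fH by (simp add: g_def ip_simps power2_eq_square)
      hence "Re (ip (K g) g) = (1 / (nrm f)\<^sup>2) * Re (ip (K f) f)"
        by simp
      ultimately show ?thesis using p by (simp add: field_simps)
    qed
  qed
  have kp: "k > 0"
  proof (rule ccontr)
    assume "\<not> k > 0"
    hence "k * (nrm f\<^sub>0)\<^sup>2 \<le> 0" by (simp add: mult_nonpos_nonneg)
    hence "c * (nrm (K f\<^sub>0))\<^sup>2 \<le> 0" using K_psd[of f\<^sub>0] kle[OF f0(1)] f0 GH by force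
    hence "nrm (K f\<^sub>0) = 0" using c_pos by (simp add: mult_le_0_iff)
    thus False using K_inj f0 GH by auto
  qed
  define L where "L f = of_real (1 / k) \<cdot> K f" for f
  have L: "sym_op L" unfolding sym_op_def L_def by (auto simp: ip_simps K_ip)
  have LG: "L f \<in> G" if "f \<in> G" for f
    using KG[OF that] Gs by (auto simp: L_def intro: subspace_scale)
  have ipL: "Re (ip (L f) f) = Re (ip (K f) f) / k" if "f \<in> H" for f
    using that by (simp add: L_def ip_simps)
  have hi: "Re (ip (L f) f) \<le> (nrm f)\<^sup>2" if "f \<in> G" for f
    using kle[OF that] kp that GH by (subst ipL) (auto simp: field_simps)
  \<comment> \<open>Nonnegativity of the form of \<open>L\<close> at \<open>f - L f\<close>,
    combined with \<open>hi\<close> at \<open>L f\<close>.\<close>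
  have lo: "(nrm (L f))\<^sup>2 \<le> Re (ip (L f) f)" if f: "f \<in> G" for f
  proof -
    have fH: "f \<in> H" using f GH by auto
    define g where "g = f - L f"
    have g: "g \<in> H" using fH by (auto simp: g_def L_def)
    have "0 \<le> Re (ip (L g) g)" using K_psd0[OF g] kp g by (simp add: ipL)
    also have "ip (L g) g = ip (L f - L (L f)) g"
      unfolding g_def by (intro eqv_ip_left sym_opD(5)[OF L]) (use fH in \<open>auto intro: sym_opD(1)[OF L]\<close>)
    also have "Re \<dots> = Re (ip (L f) f) - 2 * (nrm (L f))\<^sup>2 + Re (ip (L (L f)) (L f))"
      unfolding g_def using fH sym_opD(1)[OF L] sym_opD(2)[OF L, of "L f" f]
      by (simp add: ip_simps nrm_sq)
    also have "\<dots> \<le> Re (ip (L f) f) - 2 * (nrm (L f))\<^sup>2 + (nrm (L f))\<^sup>2"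
      using hi[OF LG[OF f]] by simp
    finally show ?thesis by simp
  qed
  have sup: "\<exists>f\<in>G. nrm f \<le> 1 \<and> Re (ip (L f) f) > 1 - \<epsilon>" if "\<epsilon> > 0" for \<epsilon>
  proof -
    have "k - k * \<epsilon> < Sup V" using kp that by (simp add: k_def)
    then obtain f where "f \<in> G" "nrm f \<le> 1" "k - k * \<epsilon> < Re (ip (K f) f)"
      using less_cSup_iff[OF V0 Vb] by (auto simp: V_def)
    thus ?thesis using kp GH by (intro bexI[of _ f]) (auto simp: ipL field_simps)
  qed
  have "\<exists>f\<in>G. \<not> (\<lambda>n. nrm ((L ^^ n) f)) \<longlonglongrightarrow> 0"
  proof (rule ccontr)
    assume "\<not> ?thesis"
    hence null: "\<And>f. f \<in> G \<Longrightarrow> (\<lambda>n. nrm ((L ^^ n) f)) \<longlonglongrightarrow> 0" by blast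
    have "real N * (k / 2)\<^sup>2 \<le> Q" for N
    proof -
      obtain e where e: "orthonormal N e" "\<And>i. i < N \<Longrightarrow> e i \<in> G"
        "\<And>i. i < N \<Longrightarrow> 1/2 \<le> nrm (L (e i))"
        using orthonormal_extend[OF L GH Gs LG lo hi sup null, of N] by auto
      have "real N * (k / 2)\<^sup>2 = (\<Sum>i<N. (k / 2)\<^sup>2)" by simp
      also have "\<dots> \<le> (\<Sum>i<N. (nrm (K (e i)))\<^sup>2)"
      proof (intro sum_mono power_mono)
        fix i assume "i \<in> {..<N}"
        hence "1/2 \<le> nrm (L (e i))" "e i \<in> H" using e GH by auto
        thus "k / 2 \<le> nrm (K (e i))" using kp by (simp add: L_def nrm_scl norm_divide field_simps)
      qed (use kp in simp)
      also have "\<dots> \<le> Q" by (rule K_hs[OF e(1)])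
      finally show ?thesis .
    qed
    moreover obtain N :: nat where "real N > Q / (k / 2)\<^sup>2" using reals_Archimedean2 by blast
    ultimately show False using kp by (simp add: field_simps) (metis not_less)
  qed
  then obtain f where f: "f \<in> G" "\<not> (\<lambda>n. nrm ((L ^^ n) f)) \<longlonglongrightarrow> 0" by auto
  have fH: "f \<in> H" using f GH by auto
  obtain p where p: "p \<in> H" "lim_to (\<lambda>n. (L ^^ n) f) p" "L p \<simeq> p"
    using power_limit[OF L GH LG lo hi f(1)] by auto
  have nH: "(L ^^ n) f \<in> H" for n using sym_op_power(1)[OF L fH fH] .
  have "nrm p \<noteq> 0" using lim_to_nrm[OF p(2) nH p(1)] f(2) by auto
  hence p0: "nrm p > 0" using p(1) by (simp add: less_le)
  have nG: "(L ^^ n) f \<in> G" for n using f(1) by (induction n) (auto intro: LG)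
  have pG: "p \<in> G"
  proof -
    have "ip p w = 0" if "w \<in> X" for w
    proof -
      have "(\<lambda>n. ip ((L ^^ n) f) w) \<longlonglongrightarrow> ip p w" using that XH by (intro lim_to_ip p nH) auto
      moreover have "ip ((L ^^ n) f) w = 0" for n using nG[of n] that G by auto
      ultimately show ?thesis by (simp add: LIMSEQ_const_iff)
    qed
    thus ?thesis using p G by auto
  qed
  define w where "w = of_real (1 / nrm p) \<cdot> p"
  have w: "w \<in> G" "w \<in> H" "nrm w = 1"
    using pG Gs p0 p(1) by (auto simp: w_def nrm_scl norm_divide intro: subspace_scale)
  have "K w \<simeq> of_real k \<cdot> w"
  proof (rule eqvI)
    fix h assume h: "h \<in> H"
    have "ip (L p) h = ip p h" using p h sym_opD(1)[OF L] by (intro eqv_ip_left) auto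
    hence "ip (K p) h = of_real k * ip p h" using p h kp by (simp add: L_def ip_simps field_simps)
    moreover have "ip (K w) h = ip (of_real (1 / nrm p) \<cdot> K p) h"
      unfolding w_def using p h by (intro eqv_ip_left sym_opD(6)[OF K_sym]) auto
    ultimately show "ip (K w) h = ip (of_real k \<cdot> w) h" using p h w by (simp add: w_def ip_simps)
  qed (use w in auto)
  thus ?thesis using w kp kle by blast
qed

end

section \<open>Eigenvector expansions\<close>

locale orth_basis = semi_hilbert scl H ip
  for scl :: "complex \<Rightarrow> 'v::ab_group_add \<Rightarrow> 'v" (infixr "\<cdot>" 75) and H ip +
  fixes w :: "nat \<Rightarrow> 'v"
  assumes w_H [simp, intro]: "w n \<in> H"
    and w_orth: "m \<noteq> n \<Longrightarrow> ip (w m) (w n) = 0"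
    and w_norm: "w n \<noteq> 0 \<Longrightarrow> nrm (w n) = 1"
    and w_complete: "f \<in> H \<Longrightarrow> (\<And>n. ip f (w n) = 0) \<Longrightarrow> nrm f = 0"
begin

lemma eqv_coef: "f \<in> H \<Longrightarrow> g \<in> H \<Longrightarrow> (\<And>n. ip f (w n) = ip g (w n)) \<Longrightarrow> f \<simeq> g"
  unfolding eqv_def by (rule w_complete) (auto simp: ip_diff_left)

lemma ip_combination:
  assumes "c m = 0 \<or> w m \<noteq> 0"
  shows "ip (\<Sum>n<N. c n \<cdot> w n) (w m) = (if m < N then c m else 0)"
proof -
  have "ip (\<Sum>n<N. c n \<cdot> w n) (w m) = (\<Sum>n<N. c n * ip (w n) (w m))"
    by (subst ip_sum_left) (auto simp: ip_scl_left)
  also have "\<dots> = (\<Sum>n<N. if n = m then c m else 0)"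
    using assms w_norm[of m] by (intro sum.cong) (auto simp: w_orth ip_self)
  finally show ?thesis by simp
qed

lemma nrm_combination:
  "(nrm (\<Sum>n\<in>I. c n \<cdot> w n))\<^sup>2 \<le> (\<Sum>n\<in>I. (cmod (c n))\<^sup>2)"
proof (cases "finite I")
  case fin: True
  have "ip (\<Sum>n\<in>I. c n \<cdot> w n) (\<Sum>n\<in>I. c n \<cdot> w n) = (\<Sum>n\<in>I. \<Sum>m\<in>I. c n * cnj (c m) * ip (w n) (w m))"
    by (subst ip_sum_left, auto intro!: sum.cong simp: ip_sum_right)
      (auto simp: ip_scl_left ip_scl_right sum_distrib_left algebra_simps)
  also have "\<dots> = (\<Sum>n\<in>I. \<Sum>m\<in>I. if m = n then c n * cnj (c n) * ip (w n) (w n) else 0)"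
    by (intro sum.cong) (auto simp: w_orth)
  also have "\<dots> = (\<Sum>n\<in>I. c n * cnj (c n) * ip (w n) (w n))" using fin by simp
  also have "\<dots> = of_real (\<Sum>n\<in>I. (cmod (c n))\<^sup>2 * (nrm (w n))\<^sup>2)"
    by (auto simp: ip_self simp flip: complex_norm_square intro!: sum.cong)
  finally have "(nrm (\<Sum>n\<in>I. c n \<cdot> w n))\<^sup>2 = (\<Sum>n\<in>I. (cmod (c n))\<^sup>2 * (nrm (w n))\<^sup>2)"
    by (subst nrm_sq) auto
  also have "\<dots> \<le> (\<Sum>n\<in>I. (cmod (c n))\<^sup>2)"
  proof (intro sum_mono)
    fix n show "(cmod (c n))\<^sup>2 * (nrm (w n))\<^sup>2 \<le> (cmod (c n))\<^sup>2"
      by (cases "w n = 0") (auto simp: w_norm)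
  qed
  finally show ?thesis .
qed simp

lemma bessel:
  assumes f: "f \<in> H" shows "(\<Sum>n<N. (cmod (ip f (w n)))\<^sup>2) \<le> (nrm f)\<^sup>2"
proof -
  define s where "s = (\<Sum>n<N. ip f (w n) \<cdot> w n)"
  have s: "s \<in> H" by (auto simp: s_def)
  have "ip s f = of_real (\<Sum>n<N. (cmod (ip f (w n)))\<^sup>2)"
  proof -
    have "ip f (w n) * ip (w n) f = of_real ((cmod (ip f (w n)))\<^sup>2)" for n
      using f complex_norm_square[of "ip f (w n)"] by (simp add: ip_cnj)
    thus ?thesis unfolding s_def using f by (subst ip_sum_left) (auto simp: ip_scl_left)
  qed
  hence "Re (ip f s) = (\<Sum>n<N. (cmod (ip f (w n)))\<^sup>2)" using Re_ip_commute[OF f s] by simp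
  moreover have "(nrm s)\<^sup>2 \<le> (\<Sum>n<N. (cmod (ip f (w n)))\<^sup>2)" unfolding s_def by (rule nrm_combination)
  ultimately show ?thesis using nrm_diff_sq[OF f s] zero_le_power2[of "nrm (f - s)"] by linarith
qed

lemma coef_summable: assumes "f \<in> H" shows "summable (\<lambda>n. (cmod (ip f (w n)))\<^sup>2)"
  by (rule summableI_nonneg_bounded[of _ "(nrm f)\<^sup>2"]) (use bessel assms in auto)

lemma riesz_fischer:
  assumes c: "summable (\<lambda>n. (cmod (c n))\<^sup>2)" and c0: "\<And>n. w n = 0 \<Longrightarrow> c n = 0"
  obtains g where "g \<in> H" "\<And>n. ip g (w n) = c n" "lim_to (\<lambda>N. \<Sum>n<N. c n \<cdot> w n) g"
proof -
  define X where "X N = (\<Sum>n<N. c n \<cdot> w n)" for N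
  define S where "S N = (\<Sum>n<N. (cmod (c n))\<^sup>2)" for N
  have X: "X N \<in> H" for N by (auto simp: X_def)
  have "(nrm (X m - X n))\<^sup>2 \<le> \<bar>S m - S n\<bar>" if "m \<le> n" for m n
  proof -
    have "X n - X m = (\<Sum>k\<in>{m..<n}. c k \<cdot> w k)" unfolding X_def
      using that by (subst sum_diff[symmetric]) (auto intro!: sum.cong)
    hence "(nrm (X n - X m))\<^sup>2 \<le> (\<Sum>k\<in>{m..<n}. (cmod (c k))\<^sup>2)" by (simp add: nrm_combination)
    also have "\<dots> = S n - S m" unfolding S_def
      using that by (subst sum_diff[symmetric]) (auto intro!: sum.cong)
    finally show ?thesis using nrm_minus_commute[OF X X, of m n] by simp
  qed
  moreover have "convergent S" using c by (simp add: S_def[abs_def] summable_iff_convergent)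
  ultimately obtain g where g: "g \<in> H" "lim_to X g" using complete_sq[of X S] X by blast
  have "ip g (w m) = c m" for m
  proof -
    have "(\<lambda>N. ip (X N) (w m)) \<longlonglongrightarrow> ip g (w m)" using g X by (intro lim_to_ip) auto
    moreover have "\<forall>\<^sub>F N in sequentially. ip (X N) (w m) = c m"
      using eventually_gt_at_top[of m]
    proof eventually_elim
      case (elim N)
      have "c m = 0 \<or> w m \<noteq> 0" using c0 by auto
      thus ?case using elim by (simp add: X_def ip_combination)
    qed
    ultimately show ?thesis by (rule LIMSEQ_unique[OF _ tendsto_eventually])
  qed
  with g show ?thesis by (intro that) (auto simp: X_def[abs_def])
qed

lemma expansion:
  assumes f: "f \<in> H" shows "lim_to (\<lambda>N. \<Sum>n<N. ip f (w n) \<cdot> w n) f"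
proof -
  obtain g where g: "g \<in> H" "\<And>n. ip g (w n) = ip f (w n)"
    "lim_to (\<lambda>N. \<Sum>n<N. ip f (w n) \<cdot> w n) g"
    using riesz_fischer[of "\<lambda>n. ip f (w n)"] coef_summable[OF f] f by auto
  have "g \<simeq> f" using g f by (intro eqv_coef)
  have "nrm ((\<Sum>n<N. ip f (w n) \<cdot> w n) - g) = nrm ((\<Sum>n<N. ip f (w n) \<cdot> w n) - f)" for N
    using \<open>g \<simeq> f\<close> g f by (intro eqv_nrm eqv_diff) auto
  thus ?thesis using g(3) by (simp add: lim_to_def)
qed

lemma ip_sums: assumes "f \<in> H" "g \<in> H"
  shows "(\<lambda>n. ip f (w n) * cnj (ip g (w n))) sums ip f g"
proof -
  have "(\<lambda>N. ip (\<Sum>n<N. ip f (w n) \<cdot> w n) g) \<longlonglongrightarrow> ip f g"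
    using assms by (intro lim_to_ip expansion) auto
  moreover have "ip (\<Sum>n<N. ip f (w n) \<cdot> w n) g = (\<Sum>n<N. ip f (w n) * cnj (ip g (w n)))" for N
    using assms by (subst ip_sum_left) (auto simp: ip_scl_left ip_cnj)
  ultimately show ?thesis by (simp add: sums_def)
qed

lemma parseval: assumes "f \<in> H" shows "(\<lambda>n. (cmod (ip f (w n)))\<^sup>2) sums (nrm f)\<^sup>2"
proof -
  have "(\<lambda>n. Re (ip f (w n) * cnj (ip f (w n)))) sums Re (ip f f)"
    using ip_sums[OF assms assms] by (rule sums_Re)
  moreover have "Re (z * cnj z) = (cmod z)\<^sup>2" for z by (metis Re_complex_of_real complex_norm_square of_real_power)
  ultimately show ?thesis using assms by (simp add: nrm_sq)
qed

lemma nrm_le_coef: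
  assumes "f \<in> H" "g \<in> H" "M \<ge> 0" "\<And>n. cmod (ip f (w n)) \<le> M * cmod (ip g (w n))"
  shows "nrm f \<le> M * nrm g"
proof -
  have "(nrm f)\<^sup>2 \<le> M\<^sup>2 * (nrm g)\<^sup>2"
    by (rule sums_le[OF _ parseval[OF assms(1)] sums_mult[OF parseval[OF assms(2)], of "M\<^sup>2"]])
      (use assms(4) in \<open>simp flip: power_mult_distrib add: power_mono\<close>)
  hence "(nrm f)\<^sup>2 \<le> (M * nrm g)\<^sup>2" by (simp add: power_mult_distrib)
  thus ?thesis by (rule power2_le_imp_le) (use assms in simp)
qed

text \<open>Dominated convergence on the coefficient side: Tannery's theorem applied to the Parseval
  series.\<close>

lemma coef_dominated:
  fixes F :: "real filter"
  assumes F: "F \<noteq> bot" and x: "\<forall>\<^sub>F t in F. x t \<in> H \<and> (\<forall>n. cmod (ip (x t) (w n)) \<le> b n)"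
    and b: "summable (\<lambda>n. (b n)\<^sup>2)" and lim: "\<And>n. ((\<lambda>t. ip (x t) (w n)) \<longlongrightarrow> 0) F"
  shows "((\<lambda>t. nrm (x t)) \<longlongrightarrow> 0) F"
proof -
  have "((\<lambda>t. suminf (\<lambda>n. (cmod (ip (x t) (w n)))\<^sup>2)) \<longlongrightarrow> suminf (\<lambda>n::nat. 0::real)) F"
  proof (rule conjunct2[OF conjunct2[OF tannerys_theorem[OF _ _ b F]]])
    show "((\<lambda>t. (cmod (ip (x t) (w n)))\<^sup>2) \<longlongrightarrow> 0) F" for n
      using tendsto_power[OF tendsto_norm[OF lim[of n]], of 2] by simp
    have "\<forall>\<^sub>F (n, t) in sequentially \<times>\<^sub>F F. x t \<in> H \<and> (\<forall>n. cmod (ip (x t) (w n)) \<le> b n)"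
      using eventually_prod2[of sequentially, THEN iffD2, OF _ x] by simp
    thus "\<forall>\<^sub>F (n, t) in sequentially \<times>\<^sub>F F. norm ((cmod (ip (x t) (w n)))\<^sup>2) \<le> (b n)\<^sup>2"
      by eventually_elim (auto intro!: power_mono)
  qed
  moreover have "\<forall>\<^sub>F t in F. suminf (\<lambda>n. (cmod (ip (x t) (w n)))\<^sup>2) = (nrm (x t))\<^sup>2"
    using x by eventually_elim (use parseval sums_unique in force)
  ultimately have "((\<lambda>t. (nrm (x t))\<^sup>2) \<longlongrightarrow> suminf (\<lambda>n::nat. 0::real)) F"
    by (rule Lim_transform_eventually)
  hence "((\<lambda>t. (nrm (x t))\<^sup>2) \<longlongrightarrow> 0) F" by simp
  hence "((\<lambda>t. sqrt ((nrm (x t))\<^sup>2)) \<longlongrightarrow> sqrt 0) F" by (rule tendsto_real_sqrt)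
  moreover have "\<forall>\<^sub>F t in F. sqrt ((nrm (x t))\<^sup>2) = nrm (x t)" using x by eventually_elim auto
  ultimately show ?thesis using tendsto_cong by force
qed

text \<open>Values of \<open>\<phi>\<close> at indices with \<open>w n = 0\<close> are irrelevant.\<close>

definition bounded_mult :: "(nat \<Rightarrow> real) \<Rightarrow> bool" where
  "bounded_mult \<phi> \<longleftrightarrow> (\<exists>M\<ge>0. \<forall>n. w n \<noteq> 0 \<longrightarrow> \<bar>\<phi> n\<bar> \<le> M)"

text \<open>The function \<phi> of a diagonal operator. Coefficients determine a vector only up to
  \<open>\<simeq>\<close>, so a representative is chosen.\<close>

definition mult_op :: "(nat \<Rightarrow> real) \<Rightarrow> 'v \<Rightarrow> 'v" where
  "mult_op \<phi> f = (SOME g. g \<in> H \<and> (\<forall>n. ip g (w n) = of_real (\<phi> n) * ip f (w n)))"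

lemma mult_op:
  assumes \<phi>: "bounded_mult \<phi>" and f: "f \<in> H"
  shows "mult_op \<phi> f \<in> H" "ip (mult_op \<phi> f) (w n) = of_real (\<phi> n) * ip f (w n)"
proof -
  obtain M where M: "M \<ge> 0" "\<And>n. w n \<noteq> 0 \<Longrightarrow> \<bar>\<phi> n\<bar> \<le> M" using \<phi> by (auto simp: bounded_mult_def)
  have le: "cmod (of_real (\<phi> n) * ip f (w n)) \<le> M * cmod (ip f (w n))" for n
    using M f by (cases "w n = 0") (auto simp: norm_mult mult_right_mono)
  have "summable (\<lambda>n. M\<^sup>2 * (cmod (ip f (w n)))\<^sup>2)" using coef_summable[OF f] by (rule summable_mult)
  hence "summable (\<lambda>n. (cmod (of_real (\<phi> n) * ip f (w n)))\<^sup>2)"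
    by (rule summable_comparison_test'[where N = 0])
      (use le in \<open>auto simp flip: power_mult_distrib intro!: power_mono\<close>)
  hence "\<exists>g. g \<in> H \<and> (\<forall>n. ip g (w n) = of_real (\<phi> n) * ip f (w n))"
  proof (rule riesz_fischer)
    fix g assume "g \<in> H" "\<And>n. ip g (w n) = of_real (\<phi> n) * ip f (w n)"
    thus ?thesis by blast
  qed (use f in simp)
  from someI_ex[OF this]
  show "mult_op \<phi> f \<in> H" "ip (mult_op \<phi> f) (w n) = of_real (\<phi> n) * ip f (w n)"
    by (auto simp: mult_op_def)
qed

lemma mult_op_sym: assumes "bounded_mult \<phi>" shows "sym_op (mult_op \<phi>)"
proof -
  have "ip (mult_op \<phi> f) g = ip f (mult_op \<phi> g)" if "f \<in> H" "g \<in> H" for f g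
    using ip_sums[of "mult_op \<phi> f" g] ip_sums[of f "mult_op \<phi> g"] mult_op[OF assms] that
    by (auto simp: ac_simps intro: sums_unique2)
  thus ?thesis using mult_op[OF assms] by (auto simp: sym_op_def)
qed

lemma mult_op_bdd: assumes \<phi>: "bounded_mult \<phi>" shows "bdd_op (mult_op \<phi>)"
proof -
  obtain M where M: "M \<ge> 0" "\<And>n. w n \<noteq> 0 \<Longrightarrow> \<bar>\<phi> n\<bar> \<le> M" using \<phi> by (auto simp: bounded_mult_def)
  have "nrm (mult_op \<phi> f) \<le> M * nrm f" if f: "f \<in> H" for f
  proof (rule nrm_le_coef)
    fix n show "cmod (ip (mult_op \<phi> f) (w n)) \<le> M * cmod (ip f (w n))"
      using M f mult_op[OF \<phi> f] by (cases "w n = 0") (auto simp: norm_mult mult_right_mono)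
  qed (use f M mult_op[OF \<phi>] in auto)
  thus ?thesis using sym_op_bdd[OF mult_op_sym[OF \<phi>]] by blast
qed

section \<open>Exponential semigroups of diagonal operators\<close>

definition exp_op :: "(nat \<Rightarrow> real) \<Rightarrow> real \<Rightarrow> 'v \<Rightarrow> 'v" where
  "exp_op \<mu> t = mult_op (\<lambda>n. exp (t * \<mu> n))"

context
  fixes \<mu> :: "nat \<Rightarrow> real" and \<mu>' :: real
  assumes \<mu>_le: "\<And>n. w n \<noteq> 0 \<Longrightarrow> \<mu> n \<le> \<mu>'"
begin

lemma exp_bounded_mult: "t \<ge> 0 \<Longrightarrow> bounded_mult (\<lambda>n. exp (t * \<mu> n))"
  unfolding bounded_mult_def by (rule exI[of _ "exp (t * \<mu>')"]) (auto intro!: mult_left_mono \<mu>_le)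

lemma exp_op:
  assumes "t \<ge> 0" "f \<in> H"
  shows "exp_op \<mu> t f \<in> H" "ip (exp_op \<mu> t f) (w n) = of_real (exp (t * \<mu> n)) * ip f (w n)"
  using mult_op[OF exp_bounded_mult[OF assms(1)] assms(2)] by (auto simp: exp_op_def)

lemma exp_op_0: "f \<in> H \<Longrightarrow> exp_op \<mu> 0 f \<simeq> f"
  by (intro eqv_coef) (auto simp: exp_op)

lemma exp_op_add: "s \<ge> 0 \<Longrightarrow> t \<ge> 0 \<Longrightarrow> f \<in> H \<Longrightarrow> exp_op \<mu> (s + t) f \<simeq> exp_op \<mu> s (exp_op \<mu> t f)"
  by (intro eqv_coef) (auto simp: exp_op algebra_simps exp_add)

lemma exp_bound: assumes "w n \<noteq> 0" "0 \<le> t" "t \<le> 1" shows "exp (t * \<mu> n) \<le> exp (max \<mu>' 0)"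
proof -
  have "t * \<mu> n \<le> t * max \<mu>' 0" using \<mu>_le[OF assms(1)] assms by (intro mult_left_mono) auto
  also have "\<dots> \<le> 1 * max \<mu>' 0" using assms by (intro mult_right_mono) auto
  finally show ?thesis by simp
qed

lemma exp_op_cont: assumes f: "f \<in> H" shows "((\<lambda>t. nrm (exp_op \<mu> t f - f)) \<longlongrightarrow> 0) (at_right 0)"
proof (rule coef_dominated[where b = "\<lambda>n. (exp (max \<mu>' 0) + 1) * cmod (ip f (w n))"])
  have c: "ip (exp_op \<mu> t f - f) (w n) = (of_real (exp (t * \<mu> n)) - 1) * ip f (w n)" if "t \<ge> 0" for t n
    using that f by (simp add: ip_diff_left exp_op algebra_simps)
  show "\<forall>\<^sub>F t in at_right 0. exp_op \<mu> t f - f \<in> H \<and>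
      (\<forall>n. cmod (ip (exp_op \<mu> t f - f) (w n)) \<le> (exp (max \<mu>' 0) + 1) * cmod (ip f (w n)))"
    using at_right_01
  proof eventually_elim
    case (elim t)
    have "cmod (ip (exp_op \<mu> t f - f) (w n)) \<le> (exp (max \<mu>' 0) + 1) * cmod (ip f (w n))" for n
    proof (cases "w n = 0")
      case False
      have "cmod (of_real (exp (t * \<mu> n)) - 1) \<le> cmod (of_real (exp (t * \<mu> n))) + cmod 1"
        by (rule norm_triangle_ineq4)
      also have "\<dots> \<le> exp (max \<mu>' 0) + 1" using exp_bound[OF False, of t] elim by simp
      finally show ?thesis using elim by (simp add: c norm_mult mult_right_mono)
    qed (use elim f exp_op in auto)
    thus ?case using elim f exp_op by auto
  qed
  show "summable (\<lambda>n. ((exp (max \<mu>' 0) + 1) * cmod (ip f (w n)))\<^sup>2)"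
    using coef_summable[OF f] by (simp add: power_mult_distrib summable_mult)
  show "((\<lambda>t. ip (exp_op \<mu> t f - f) (w n)) \<longlongrightarrow> 0) (at_right 0)" for n
  proof -
    have "((\<lambda>t. (of_real (exp (t * \<mu> n)) - 1) * ip f (w n)) \<longlongrightarrow> (of_real (exp (0 * \<mu> n)) - 1) * ip f (w n)) (at_right 0)"
      by (intro tendsto_intros)
    moreover have "\<forall>\<^sub>F t in at_right 0. (of_real (exp (t * \<mu> n)) - 1) * ip f (w n) = ip (exp_op \<mu> t f - f) (w n)"
      using at_right_01 by eventually_elim (simp add: c)
    ultimately show ?thesis using tendsto_cong by force
  qed
qed simp

text \<open>The equivalence also fixes the domain of the generator: \<open>f\<close> belongs to it
  as soon as the sequence of the \<open>\<mu> n * ip f (w n)\<close> is the coefficient sequence of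
  some vector.\<close>

lemma exp_op_generator_iff:
  assumes f: "f \<in> H" and g: "g \<in> H"
  shows "((\<lambda>t. nrm (of_real (1 / t) \<cdot> (exp_op \<mu> t f - f) - g)) \<longlongrightarrow> 0) (at_right 0) \<longleftrightarrow>
           (\<forall>n. ip g (w n) = of_real (\<mu> n) * ip f (w n))"
    (is "?L \<longleftrightarrow> ?R")
proof -
  define x where "x t = of_real (1 / t) \<cdot> (exp_op \<mu> t f - f) - g" for t
  have xH: "t \<ge> 0 \<Longrightarrow> x t \<in> H" for t using f g exp_op by (auto simp: x_def)
  have c: "ip (x t) (w n) = of_real ((exp (t * \<mu> n) - 1) / t) * ip f (w n) - ip g (w n)" if "t \<ge> 0" for t n
    using that f g exp_op by (simp add: x_def ip_simps ip_diff_left exp_op algebra_simps diff_divide_distrib)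
  have lim: "((\<lambda>t. ip (x t) (w n)) \<longlongrightarrow> of_real (\<mu> n) * ip f (w n) - ip g (w n)) (at_right 0)" for n
  proof -
    have "((\<lambda>t. of_real ((exp (t * \<mu> n) - 1) / t) * ip f (w n) - ip g (w n))
        \<longlongrightarrow> of_real (\<mu> n) * ip f (w n) - ip g (w n)) (at_right 0)"
      by (intro tendsto_intros exp_quotient)
    moreover have "\<forall>\<^sub>F t in at_right 0. of_real ((exp (t * \<mu> n) - 1) / t) * ip f (w n) - ip g (w n) = ip (x t) (w n)"
      using at_right_01 by eventually_elim (simp add: c)
    ultimately show ?thesis using tendsto_cong by force
  qed
  show ?thesis unfolding x_def[symmetric]
  proof
    assume L: "((\<lambda>t. nrm (x t)) \<longlongrightarrow> 0) (at_right 0)"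
    show ?R
    proof
      fix n
      have "((\<lambda>t. nrm (x t) * nrm (w n)) \<longlongrightarrow> 0) (at_right 0)" using L by (rule tendsto_mult_left_zero)
      hence "((\<lambda>t. ip (x t) (w n)) \<longlongrightarrow> 0) (at_right 0)"
      proof (rule Lim_null_comparison[rotated])
        show "\<forall>\<^sub>F t in at_right 0. norm (ip (x t) (w n)) \<le> nrm (x t) * nrm (w n)"
          using at_right_01 by eventually_elim (auto intro!: norm_ip_le xH)
      qed
      hence "of_real (\<mu> n) * ip f (w n) - ip g (w n) = 0"
        using lim[of n] tendsto_unique[OF trivial_limit_at_right_real] by blast
      thus "ip g (w n) = of_real (\<mu> n) * ip f (w n)" by simp
    qed
  next
    assume R: ?R
    show "((\<lambda>t. nrm (x t)) \<longlongrightarrow> 0) (at_right 0)"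
    \<comment> \<open>The dominating sequence comes from \<open>g\<close>, not from
      \<open>f\<close>: the difference quotient has size about \<open>\<bar>\<mu> n\<bar>\<close>,
      and by \<open>R\<close> the coefficients of \<open>g\<close> have already absorbed that
      factor.\<close>
    proof (rule coef_dominated[where b = "\<lambda>n. (exp (max \<mu>' 0) + 1) * cmod (ip g (w n))"])
      show "\<forall>\<^sub>F t in at_right 0. x t \<in> H \<and>
          (\<forall>n. cmod (ip (x t) (w n)) \<le> (exp (max \<mu>' 0) + 1) * cmod (ip g (w n)))"
        using at_right_01
      proof eventually_elim
        case (elim t)
        have "cmod (ip (x t) (w n)) \<le> (exp (max \<mu>' 0) + 1) * cmod (ip g (w n))" for n
        proof (cases "w n = 0")
          case False
          have m: "max (t * \<mu> n) 0 \<le> max \<mu>' 0"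
            using exp_bound[OF False, of t] elim by (auto simp: max_def split: if_splits)
          have "\<bar>(exp (t * \<mu> n) - 1) / t\<bar> \<le> \<bar>\<mu> n\<bar> * exp (max \<mu>' 0)"
          proof -
            have "\<bar>exp (t * \<mu> n) - 1\<bar> \<le> \<bar>t * \<mu> n\<bar> * exp (max (t * \<mu> n) 0)" by (rule exp_minus_1_bound)
            also have "\<dots> \<le> \<bar>t * \<mu> n\<bar> * exp (max \<mu>' 0)" using m by (intro mult_left_mono) auto
            finally show ?thesis using elim by (simp add: abs_mult field_simps)
          qed
          from mult_right_mono[OF this, of "cmod (ip f (w n))"]
          have "\<bar>(exp (t * \<mu> n) - 1) / t\<bar> * cmod (ip f (w n)) \<le> exp (max \<mu>' 0) * (\<bar>\<mu> n\<bar> * cmod (ip f (w n)))"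
            by (simp add: ac_simps)
          also have "\<bar>\<mu> n\<bar> * cmod (ip f (w n)) = cmod (ip g (w n))" using R by (simp add: norm_mult)
          finally have "cmod (of_real ((exp (t * \<mu> n) - 1) / t) * ip f (w n)) \<le> exp (max \<mu>' 0) * cmod (ip g (w n))"
            by (simp only: norm_mult norm_of_real)
          thus ?thesis using elim norm_triangle_ineq4[of "of_real ((exp (t * \<mu> n) - 1) / t) * ip f (w n)" "ip g (w n)"]
            by (simp add: c algebra_simps)
        qed (use elim g xH in auto)
        thus ?case using xH elim by auto
      qed
      show "summable (\<lambda>n. ((exp (max \<mu>' 0) + 1) * cmod (ip g (w n)))\<^sup>2)"
        using coef_summable[OF g] by (simp add: power_mult_distrib summable_mult)
      show "((\<lambda>t. ip (x t) (w n)) \<longlongrightarrow> 0) (at_right 0)" for n using lim[of n] R by simp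
    qed simp
  qed
qed

end

end

section \<open>The sequence of eigenvectors and its completeness\<close>

context compact_psd
begin

text \<open>Once the previous eigenvectors span a dense subspace, the sequence continues with zeros.\<close>

definition next_eigvec :: "'v set \<Rightarrow> 'v" where
  "next_eigvec X =
     (if \<exists>f\<in>H. (\<forall>x\<in>X. ip f x = 0) \<and> nrm f \<noteq> 0
      then SOME w. w \<in> H \<and> (\<forall>x\<in>X. ip w x = 0) \<and> nrm w = 1 \<and>
        (\<exists>k>0. K w \<simeq> of_real k \<cdot> w \<and> (\<forall>f\<in>H. (\<forall>x\<in>X. ip f x = 0) \<longrightarrow> Re (ip (K f) f) \<le> k * (nrm f)\<^sup>2))
      else 0)"

primrec eig_prefix :: "nat \<Rightarrow> 'v set" where
  "eig_prefix 0 = {}"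
| "eig_prefix (Suc n) = insert (next_eigvec (eig_prefix n)) (eig_prefix n)"

definition eigvec :: "nat \<Rightarrow> 'v" where "eigvec n = next_eigvec (eig_prefix n)"

definition eigval :: "nat \<Rightarrow> real" where "eigval n = Re (ip (K (eigvec n)) (eigvec n))"

lemma eig_prefix: "eig_prefix n = eigvec ` {..<n}"
  by (induction n) (auto simp: eigvec_def lessThan_Suc)

lemma next_eigvec:
  assumes XH: "X \<subseteq> H" and eig: "\<And>w. w \<in> X \<Longrightarrow> \<exists>k. K w \<simeq> k \<cdot> w"
  shows "next_eigvec X = 0 \<and> (\<forall>f\<in>H. (\<forall>x\<in>X. ip f x = 0) \<longrightarrow> nrm f = 0) \<or>
    next_eigvec X \<in> H \<and> (\<forall>x\<in>X. ip (next_eigvec X) x = 0) \<and> nrm (next_eigvec X) = 1 \<and>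
        (\<exists>k>0. K (next_eigvec X) \<simeq> of_real k \<cdot> next_eigvec X \<and>
          (\<forall>f\<in>H. (\<forall>x\<in>X. ip f x = 0) \<longrightarrow> Re (ip (K f) f) \<le> k * (nrm f)\<^sup>2))"
proof (cases "\<exists>f\<in>H. (\<forall>x\<in>X. ip f x = 0) \<and> nrm f \<noteq> 0")
  case True
  then obtain f where "f \<in> {f \<in> H. \<forall>w\<in>X. ip f w = 0}" "nrm f \<noteq> 0" by auto
  from eigenvector_exists[OF XH eig refl this] obtain w k where
    "w \<in> H" "\<forall>x\<in>X. ip w x = 0" "nrm w = 1" "k > 0" "K w \<simeq> of_real k \<cdot> w"
    "\<forall>f\<in>{f \<in> H. \<forall>w\<in>X. ip f w = 0}. Re (ip (K f) f) \<le> k * (nrm f)\<^sup>2" by blast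
  hence "\<exists>w. w \<in> H \<and> (\<forall>x\<in>X. ip w x = 0) \<and> nrm w = 1 \<and>
        (\<exists>k>0. K w \<simeq> of_real k \<cdot> w \<and> (\<forall>f\<in>H. (\<forall>x\<in>X. ip f x = 0) \<longrightarrow> Re (ip (K f) f) \<le> k * (nrm f)\<^sup>2))"
    by (intro exI[of _ w] conjI exI[of _ k]) auto
  from someI_ex[OF this] True show ?thesis unfolding next_eigvec_def by (intro disjI2) simp
next
  case False
  thus ?thesis by (auto simp: next_eigvec_def)
qed

lemma K_0: "K 0 \<simeq> 0"
  using sym_opD(6)[OF K_sym H_0, of 0] by simp

lemma eig_prefix_ok: "eig_prefix n \<subseteq> H \<and> (\<forall>w\<in>eig_prefix n. \<exists>k. K w \<simeq> k \<cdot> w)"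
proof (induction n)
  case (Suc n)
  have "next_eigvec (eig_prefix n) \<in> H \<and> (\<exists>k. K (next_eigvec (eig_prefix n)) \<simeq> k \<cdot> next_eigvec (eig_prefix n))"
    using next_eigvec[of "eig_prefix n"] Suc K_0 by auto
  thus ?case using Suc by simp
qed simp

text \<open>Either the construction has stopped, or \<open>eigval n\<close> is the eigenvalue just
  found. The maximality clause is the source of monotonicity and completeness.\<close>

lemma eigvec_cases:
  obtains "eigvec n = 0" "\<And>f. f \<in> H \<Longrightarrow> (\<And>m. m < n \<Longrightarrow> ip f (eigvec m) = 0) \<Longrightarrow> nrm f = 0"
  | "nrm (eigvec n) = 1" "eigvec n \<in> H" "\<And>m. m < n \<Longrightarrow> ip (eigvec n) (eigvec m) = 0" "eigval n > 0"
    "K (eigvec n) \<simeq> of_real (eigval n) \<cdot> eigvec n"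
    "\<And>f. f \<in> H \<Longrightarrow> (\<And>m. m < n \<Longrightarrow> ip f (eigvec m) = 0) \<Longrightarrow> Re (ip (K f) f) \<le> eigval n * (nrm f)\<^sup>2"
proof -
  let ?X = "eig_prefix n"
  have "?X \<subseteq> H" "\<And>w. w \<in> ?X \<Longrightarrow> \<exists>k. K w \<simeq> k \<cdot> w" using eig_prefix_ok[of n] by auto
  from next_eigvec[OF this] consider
    (a) "eigvec n = 0" "\<forall>f\<in>H. (\<forall>x\<in>?X. ip f x = 0) \<longrightarrow> nrm f = 0"
  | (b) k where "nrm (eigvec n) = 1" "eigvec n \<in> H" "\<forall>x\<in>?X. ip (eigvec n) x = 0" "k > 0"
      "K (eigvec n) \<simeq> of_real k \<cdot> eigvec n"
      "\<forall>f\<in>H. (\<forall>x\<in>?X. ip f x = 0) \<longrightarrow> Re (ip (K f) f) \<le> k * (nrm f)\<^sup>2"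
    unfolding eigvec_def[symmetric] by blast
  thus ?thesis
  proof cases
    case a
    thus ?thesis by (intro that(1)) (auto simp: eig_prefix)
  next
    case (b k)
    have "ip (K (eigvec n)) (eigvec n) = ip (of_real k \<cdot> eigvec n) (eigvec n)"
      using b by (intro eqv_ip_left) auto
    hence "eigval n = k" using b by (simp add: eigval_def ip_scl_left ip_self)
    thus ?thesis using b by (intro that(2)) (auto simp: eig_prefix)
  qed
qed

lemma eigvec_H [simp, intro]: "eigvec n \<in> H"
  by (rule eigvec_cases[of n]) auto

lemma eigvec_orth: assumes "m \<noteq> n" shows "ip (eigvec m) (eigvec n) = 0"
proof -
  have *: "ip (eigvec n) (eigvec m) = 0" if "m < n" for m n
    by (rule eigvec_cases[of n]) (use that in auto)
  show ?thesis
  proof (cases "m < n")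
    case True
    thus ?thesis using *[OF True] ip_cnj[of "eigvec n" "eigvec m"] by simp
  qed (use assms * in auto)
qed

lemma eigvec_norm: "eigvec n \<noteq> 0 \<Longrightarrow> nrm (eigvec n) = 1"
  by (rule eigvec_cases[of n]) auto

lemma eigval_pos: "eigvec n \<noteq> 0 \<Longrightarrow> eigval n > 0"
  by (rule eigvec_cases[of n]) auto

lemma eigvec_eq: "K (eigvec n) \<simeq> of_real (eigval n) \<cdot> eigvec n"
  by (rule eigvec_cases[of n]) (auto simp: K_0)

lemma eigval_top: assumes "f \<in> H" shows "Re (ip (K f) f) \<le> eigval 0 * (nrm f)\<^sup>2"
proof (rule eigvec_cases[of 0])
  assume "\<And>f. f \<in> H \<Longrightarrow> (\<And>m. m < 0 \<Longrightarrow> ip f (eigvec m) = 0) \<Longrightarrow> nrm f = 0"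
  hence "nrm f = 0" using assms by auto
  thus ?thesis using Re_ip_le[of "K f" f] assms by simp
qed (use assms in auto)

text \<open>A later eigenvector is a competitor in the maximisation that produced the earlier one;
  and had the sequence stopped at \<open>m\<close>, this competitor would be null.\<close>

lemma eigval_antimono: assumes "m \<le> n" "eigvec n \<noteq> 0" shows "eigvec m \<noteq> 0" "eigval n \<le> eigval m"
proof -
  have n: "nrm (eigvec n) = 1" using assms eigvec_norm by auto
  have o: "ip (eigvec n) (eigvec i) = 0" if "i < m" for i using that assms by (intro eigvec_orth) auto
  show m: "eigvec m \<noteq> 0" by (rule eigvec_cases[of m]) (use n o in force)+
  show "eigval n \<le> eigval m"
  proof (cases rule: eigvec_cases[of m])
    case 2
    have "Re (ip (K (eigvec n)) (eigvec n)) \<le> eigval m * (nrm (eigvec n))\<^sup>2"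
      by (rule 2(6)) (use o in auto)
    thus ?thesis using n by (simp add: eigval_def)
  qed (use m in auto)
qed

text \<open>A vector orthogonal to all eigenvectors competes in every maximisation, so its form is
  at most \<open>eigval n * (nrm f)\<^sup>2\<close> for every \<open>n\<close>. Since
  \<open>K_hs\<close> forces the eigenvalues to 0, the form vanishes, and \<open>K_psd\<close> and
  \<open>K_inj\<close> finish.\<close>

lemma eigvec_complete: assumes f: "f \<in> H" and 0: "\<And>n. ip f (eigvec n) = 0" shows "nrm f = 0"
proof (cases "\<exists>n. eigvec n = 0")
  case True
  then obtain n where "eigvec n = 0" by auto
  thus ?thesis by (cases rule: eigvec_cases[of n]) (use f 0 in auto)
next
  case False
  have le: "Re (ip (K f) f) \<le> eigval n * (nrm f)\<^sup>2" for n
    by (rule eigvec_cases[of n]) (use f 0 False in auto)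
  have sq: "real n * (eigval n)\<^sup>2 \<le> Q" for n
  proof -
    have "real n * (eigval n)\<^sup>2 = (\<Sum>i<n. (eigval n)\<^sup>2)" by simp
    also have "\<dots> \<le> (\<Sum>i<n. (nrm (K (eigvec i)))\<^sup>2)"
    proof (intro sum_mono power_mono)
      fix i assume "i \<in> {..<n}"
      hence "eigval n \<le> eigval i" using eigval_antimono[of i n] False by auto
      also have "eigval i = nrm (of_real (eigval i) \<cdot> eigvec i)"
        using eigvec_norm[of i] eigval_pos[of i] False by (simp add: nrm_scl)
      also have "\<dots> = nrm (K (eigvec i))" using eqv_nrm[OF eigvec_eq[of i]] by auto
      finally show "eigval n \<le> nrm (K (eigvec i))" .
    qed (use eigval_pos False in \<open>auto simp: less_imp_le\<close>)
    also have "(\<Sum>i<n. (nrm (K (eigvec i)))\<^sup>2) \<le> Q"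
    proof -
      have "nrm (eigvec i) = 1" for i using eigvec_norm False by auto
      thus ?thesis by (intro K_hs) (auto simp: orthonormal_def eigvec_orth ip_self)
    qed
    finally show ?thesis .
  qed
  have "Re (ip (K f) f) \<le> 0"
  proof (rule ccontr)
    assume "\<not> ?thesis"
    hence p: "Re (ip (K f) f) > 0" by simp
    define b where "b = Re (ip (K f) f) / (nrm f)\<^sup>2"
    have fp: "(nrm f)\<^sup>2 > 0" using p le[of 0] by (cases "nrm f = 0") auto
    have b: "b > 0" using p fp by (simp add: b_def)
    have "b \<le> eigval n" for n using le[of n] fp by (simp add: b_def field_simps)
    hence "b\<^sup>2 \<le> (eigval n)\<^sup>2" for n using b by (intro power_mono) auto
    hence "real n * b\<^sup>2 \<le> Q" for n using sq[of n] by (meson mult_left_mono of_nat_0_le_iff order_trans)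
    moreover obtain n :: nat where "real n > Q / b\<^sup>2" using reals_Archimedean2 by blast
    ultimately show False using b by (simp add: field_simps) (metis not_less)
  qed
  hence "c * (nrm (K f))\<^sup>2 \<le> 0" using K_psd[OF f] by simp
  hence "nrm (K f) = 0" using c_pos by (simp add: mult_le_0_iff)
  thus ?thesis using K_inj f by auto
qed

sublocale orth_basis scl H ip eigvec
  by unfold_locales (auto simp: eigvec_orth eigvec_norm intro: eigvec_complete)

end

section \<open>Semigroups and their generators\<close>

context semi_hilbert
begin

text \<open>The explicit error bound, and not merely convergence, is what
  \<open>uniform_boundedness\<close> consumes.\<close>

lemma geometric_limit:
  assumes X: "\<And>n. X n \<in> H" and le: "\<And>n. nrm (X (Suc n) - X n) \<le> C * q ^ n" and q: "0 \<le> q" "q < 1"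
  obtains l where "l \<in> H" "lim_to X l" "\<And>n. nrm (X n - l) \<le> C * q ^ n / (1 - q)"
proof -
  have "0 \<le> nrm (X (Suc 0) - X 0)" using X by (intro nrm_ge_0) auto
  also have "\<dots> \<le> C" using le[of 0] by simp
  finally have C0: "C \<ge> 0" .
  have part: "nrm (X (n + k) - X n) \<le> C * q ^ n * (\<Sum>i<k. q ^ i)" for n k
  proof (induction k)
    case (Suc k)
    have "nrm (X (n + Suc k) - X n) \<le> nrm (X (Suc (n + k)) - X (n + k)) + nrm (X (n + k) - X n)"
      using nrm_triangle3[OF X X X] by simp
    also have "\<dots> \<le> C * q ^ (n + k) + C * q ^ n * (\<Sum>i<k. q ^ i)" using le[of "n + k"] Suc by simp
    finally show ?case by (simp add: power_add algebra_simps)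
  qed simp
  have tail: "nrm (X m - X n) \<le> C * q ^ n / (1 - q)" if "n \<le> m" for m n
  proof -
    obtain k where k: "m = n + k" using le_Suc_ex[OF \<open>n \<le> m\<close>] by blast
    have "(\<Sum>i<k. q ^ i) = (1 - q ^ k) / (1 - q)" using q by (simp add: sum_gp_strict)
    also have "\<dots> \<le> 1 / (1 - q)" using q by (intro divide_right_mono) auto
    finally have "(\<Sum>i<k. q ^ i) \<le> 1 / (1 - q)" .
    hence "C * q ^ n * (\<Sum>i<k. q ^ i) \<le> C * q ^ n * (1 / (1 - q))"
      using C0 q by (intro mult_left_mono) auto
    thus ?thesis using part[of n k] k by simp
  qed
  have lim0: "(\<lambda>n. C * q ^ n / (1 - q)) \<longlonglongrightarrow> 0"
    using LIMSEQ_power_zero[of q] q tendsto_mult_right_zero[of "\<lambda>n. q ^ n" sequentially "C / (1 - q)"]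
    by (simp add: mult.commute)
  obtain l where l: "l \<in> H" "lim_to X l"
  proof (rule complete[of X])
    fix e :: real assume "e > 0"
    hence "\<forall>\<^sub>F n in sequentially. C * q ^ n / (1 - q) < e" using lim0 by (rule order_tendstoD(2)[rotated])
    then obtain N where N: "\<And>n. n \<ge> N \<Longrightarrow> C * q ^ n / (1 - q) < e" by (auto simp: eventually_sequentially)
    have "nrm (X m - X n) < e" if "m \<ge> N" "n \<ge> N" for m n
      using tail[of n m] tail[of m n] N[of n] N[of m] that nrm_minus_commute[OF X X, of m n]
      by (cases "n \<le> m") auto
    thus "\<exists>N. \<forall>m\<ge>N. \<forall>n\<ge>N. nrm (X m - X n) < e" by blast
  qed (use X in auto)
  have "nrm (X n - l) \<le> C * q ^ n / (1 - q)" for n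
  proof (rule LIMSEQ_le_const)
    show "(\<lambda>m. C * q ^ n / (1 - q) + nrm (X m - l)) \<longlonglongrightarrow> C * q ^ n / (1 - q)"
      using tendsto_add[OF tendsto_const l(2)[unfolded lim_to_def], of "C * q ^ n / (1 - q)"] by simp
    have "nrm (X n - l) \<le> C * q ^ n / (1 - q) + nrm (X m - l)" if "m \<ge> n" for m
      using nrm_triangle3[OF X X l(1), of n m] tail[OF that] nrm_minus_commute[OF X X, of m n] by simp
    thus "\<exists>N. \<forall>m\<ge>N. nrm (X n - l) \<le> C * q ^ n / (1 - q) + nrm (X m - l)" by blast
  qed
  with l show ?thesis by (rule that)
qed

section \<open>Operator norm and uniform boundedness\<close>

definition opn :: "('v \<Rightarrow> 'v) \<Rightarrow> real" where
  "opn T = Sup {nrm (T f) | f. f \<in> H \<and> nrm f \<le> 1}"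

lemma opn_set:
  assumes "bdd_op T"
  shows "bdd_above {nrm (T f) | f. f \<in> H \<and> nrm f \<le> 1}" "{nrm (T f) | f. f \<in> H \<and> nrm f \<le> 1} \<noteq> {}"
proof -
  obtain K where K: "K > 0" "\<And>f. f \<in> H \<Longrightarrow> nrm (T f) \<le> K * nrm f" using bdd_op_bound[OF assms] by blast
  show "bdd_above {nrm (T f) | f. f \<in> H \<and> nrm f \<le> 1}"
  proof (rule bdd_aboveI[of _ K])
    fix x assume "x \<in> {nrm (T f) | f. f \<in> H \<and> nrm f \<le> 1}"
    then obtain f where f: "f \<in> H" "nrm f \<le> 1" "x = nrm (T f)" by auto
    have "x \<le> K * nrm f" using K f by auto
    also have "\<dots> \<le> K * 1" using K f by (intro mult_left_mono) auto
    finally show "x \<le> K" by simp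
  qed
  have "nrm (T 0) \<in> {nrm (T f) | f. f \<in> H \<and> nrm f \<le> 1}" by (rule CollectI, rule exI[of _ 0]) simp
  thus "{nrm (T f) | f. f \<in> H \<and> nrm f \<le> 1} \<noteq> {}" by blast
qed

lemma opn_bound: assumes T: "bdd_op T" and f: "f \<in> H" shows "nrm (T f) \<le> opn T * nrm f"
proof (cases "nrm f = 0")
  case True
  obtain K where "\<And>f. f \<in> H \<Longrightarrow> nrm (T f) \<le> K * nrm f" using bdd_op_bound[OF T] by blast
  thus ?thesis using True f by force
next
  case False
  hence p: "nrm f > 0" using f by (simp add: less_le)
  define g where "g = of_real (1 / nrm f) \<cdot> f"
  have g: "g \<in> H" "nrm g \<le> 1" using f p by (auto simp: g_def nrm_scl norm_divide)
  have "nrm (T g) \<le> opn T" unfolding opn_def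
    by (rule cSup_upper[OF _ opn_set(1)[OF T]]) (use g in auto)
  moreover have "nrm (T g) = nrm (of_real (1 / nrm f) \<cdot> T f)"
    unfolding g_def using f by (intro eqv_nrm bdd_opD(6)[OF T] bdd_opD(1)[OF T]) (auto intro: bdd_opD(1)[OF T])
  hence "nrm (T g) = nrm (T f) / nrm f" using f p bdd_opD(1)[OF T] by (simp add: nrm_scl norm_divide)
  ultimately show ?thesis using p by (simp add: field_simps)
qed

lemma opn_approx: assumes T: "bdd_op T" and "opn T > 0"
  obtains f where "f \<in> H" "nrm f \<le> 1" "nrm (T f) \<ge> 3/4 * opn T"
proof -
  have "3/4 * opn T < opn T" using assms by simp
  then obtain x where "x \<in> {nrm (T f) | f. f \<in> H \<and> nrm f \<le> 1}" "3/4 * opn T < x"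
    using less_cSup_iff[OF opn_set(2,1)[OF T]] unfolding opn_def by blast
  thus ?thesis using that by force
qed

lemma opn_ge_0: assumes "bdd_op T" shows "opn T \<ge> 0"
proof -
  have "nrm (T 0) \<le> opn T" unfolding opn_def
    by (rule cSup_upper[OF _ opn_set(1)[OF assms]]) (use nrm_zero H_0 in force)
  thus ?thesis using bdd_opD(1)[OF assms H_0] nrm_ge_0 order_trans by blast
qed

text \<open>Sokal's proof: a series \<open>\<Sum>\<^sub>k \<plusminus>3\<^sup>-\<^sup>k f\<^sub>k\<close> whose signs are chosen so that the \<open>k\<close>-th operator,
  of norm at least \<open>4\<^sup>k\<close>, is large on the \<open>k\<close>-th partial sum.\<close>

lemma uniform_boundedness:
  fixes T :: "nat \<Rightarrow> 'v \<Rightarrow> 'v"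
  assumes T: "\<And>n. bdd_op (T n)" and b: "\<And>f. f \<in> H \<Longrightarrow> \<exists>C. \<forall>n. nrm (T n f) \<le> C"
  shows "\<exists>C. \<forall>n. opn (T n) \<le> C"
proof (rule ccontr)
  assume "\<not> ?thesis"
  hence "\<forall>k. \<exists>n. opn (T n) > 4 ^ k" by (metis not_le)
  then obtain n where n: "\<And>k. opn (T (n k)) > 4 ^ k" by metis
  define U where "U k = T (n k)" for k
  have U: "bdd_op (U k)" and U4: "opn (U k) > 4 ^ k" for k using T n by (auto simp: U_def)
  have Upos: "opn (U k) > 0" for k using U4[of k] by (meson less_trans zero_less_numeral zero_less_power)
  have UH: "f \<in> H \<Longrightarrow> U k f \<in> H" for f k using bdd_opD(1)[OF U] .
  have "\<exists>f. f \<in> H \<and> nrm f \<le> (1/3) ^ k \<and> nrm (U k f) \<ge> 3/4 * opn (U k) * (1/3) ^ k" for k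
  proof -
    obtain f where f: "f \<in> H" "nrm f \<le> 1" "nrm (U k f) \<ge> 3/4 * opn (U k)"
      using opn_approx[OF U Upos] by blast
    let ?g = "of_real ((1/3) ^ k) \<cdot> f"
    have "nrm (U k ?g) = nrm (of_real ((1/3) ^ k) \<cdot> U k f)"
      using f UH by (intro eqv_nrm bdd_opD(6)[OF U]) auto
    also have "\<dots> = (1/3) ^ k * nrm (U k f)" using f UH by (simp only: nrm_scl) (simp add: norm_divide norm_power)
    finally have 1: "nrm (U k ?g) = (1/3) ^ k * nrm (U k f)" .
    have 2: "nrm ?g = (1/3) ^ k * nrm f" using f by (simp only: nrm_scl) (simp add: norm_divide norm_power)
    show ?thesis
      by (rule exI[of _ ?g], unfold 1 2)
        (use f mult_left_mono[OF f(2), of "(1/3) ^ k"] mult_left_mono[OF f(3), of "(1/3) ^ k"] in \<open>auto simp: ac_simps\<close>)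
  qed
  then obtain f where f: "\<And>k. f k \<in> H" "\<And>k. nrm (f k) \<le> (1/3) ^ k"
    "\<And>k. nrm (U k (f k)) \<ge> 3/4 * opn (U k) * (1/3) ^ k" by metis
  define X where "X = rec_nat 0 (\<lambda>k x. if nrm (U k (x + f k)) \<ge> nrm (U k (f k)) then x + f k else x - f k)"
  have X0: "X 0 = 0" by (simp add: X_def)
  have XS: "X (Suc k) = (if nrm (U k (X k + f k)) \<ge> nrm (U k (f k)) then X k + f k else X k - f k)" for k
    by (simp add: X_def)
  have XH: "X k \<in> H" for k by (induction k) (auto simp: X0 XS f(1))
  \<comment> \<open>The norms of \<open>U k (X k + f k)\<close> and \<open>U k (X k - f k)\<close>
    add up to at least twice that of \<open>U k (f k)\<close>, so one of the two signs
    works.\<close>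
  have big: "nrm (U k (X (Suc k))) \<ge> nrm (U k (f k))" for k
  proof (cases "nrm (U k (X k + f k)) \<ge> nrm (U k (f k))")
    case False
    have "U k ((X k + f k) - (X k - f k)) \<simeq> U k (X k + f k) - U k (X k - f k)"
      using XH f(1) by (intro bdd_opD(5)[OF U]) auto
    hence "nrm (U k (2 \<cdot> f k)) = nrm (U k (X k + f k) - U k (X k - f k))"
      using XH f(1) UH by (intro eqv_nrm) (auto simp: scale_left_distrib[of 1 1, simplified])
    also have "\<dots> \<le> nrm (U k (X k + f k)) + nrm (U k (X k - f k))"
      using XH f(1) UH by (intro nrm_triangle_diff) auto
    finally have "nrm (U k (2 \<cdot> f k)) \<le> nrm (U k (X k + f k)) + nrm (U k (X k - f k))" .
    moreover have "nrm (U k (2 \<cdot> f k)) = nrm (2 \<cdot> U k (f k))"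
      using f(1) UH by (intro eqv_nrm bdd_opD(6)[OF U]) auto
    ultimately show ?thesis using False f(1)[of k] UH by (simp add: XS nrm_scl)
  qed (simp add: XS)
  have "nrm (X (Suc k) - X k) \<le> 1 * (1/3) ^ k" for k using f(1,2)[of k] XH by (auto simp: XS)
  then obtain l where l: "l \<in> H" "lim_to X l" "\<And>k. nrm (X k - l) \<le> 1 * (1/3) ^ k / (1 - 1/3)"
    using geometric_limit[of X 1 "1/3"] XH by auto
  obtain C where C: "\<And>n. nrm (T n l) \<le> C" using b[OF l(1)] by auto
  \<comment> \<open>The tail after step \<open>k\<close> costs at most 1/2 of
    \<open>opn (U k) * (1/3) ^ k\<close>, while the choice of \<open>f k\<close> secured 3/4. The
    remaining quarter grows like \<open>(4/3) ^ k\<close>.\<close>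
  have "(4/3) ^ k * (1/4) \<le> C" for k
  proof -
    have "nrm (U k (X (Suc k) - l)) \<le> opn (U k) * nrm (X (Suc k) - l)"
      using XH l by (intro opn_bound U) auto
    also have "\<dots> \<le> opn (U k) * (1 * (1/3) ^ Suc k / (1 - 1/3))"
      using Upos[of k] l(3)[of "Suc k"] by (intro mult_left_mono) auto
    finally have 1: "nrm (U k (X (Suc k) - l)) \<le> 1/2 * opn (U k) * (1/3) ^ k" by simp
    have "nrm (U k (X (Suc k) - l)) = nrm (U k (X (Suc k)) - U k l)"
      using XH l UH by (intro eqv_nrm bdd_opD(5)[OF U]) auto
    moreover have "nrm (U k (X (Suc k))) \<le> nrm (U k l) + nrm (U k (X (Suc k)) - U k l)"
      using XH l UH by (intro nrm_le_add) auto
    ultimately have "1/4 * opn (U k) * (1/3) ^ k \<le> nrm (U k l)" using big[of k] f(3)[of k] 1 by linarith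
    moreover have "1/4 * 4 ^ k * (1/3) ^ k \<le> 1/4 * opn (U k) * (1/3 :: real) ^ k"
      using U4[of k] by (intro mult_right_mono mult_left_mono) auto
    moreover have "1/4 * 4 ^ k * (1/3) ^ k = (4/3) ^ k * (1/4 :: real)"
      by (simp add: power_divide)
    ultimately show ?thesis using C[of "n k"] unfolding U_def by linarith
  qed
  note bnd = this
  obtain k where "(4/3 :: real) ^ k > 4 * C" using real_arch_pow[of "4/3" "4 * C"] by auto
  thus False using bnd[of k] by simp
qed

section \<open>Strongly continuous semigroups\<close>

definition c0_sg :: "(real \<Rightarrow> 'v \<Rightarrow> 'v) \<Rightarrow> bool" where
  "c0_sg T \<longleftrightarrow> (\<forall>t\<ge>0. bdd_op (T t)) \<and> (\<forall>f\<in>H. T 0 f \<simeq> f) \<and>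
     (\<forall>s\<ge>0. \<forall>t\<ge>0. \<forall>f\<in>H. T (s + t) f \<simeq> T s (T t f)) \<and>
     (\<forall>f\<in>H. ((\<lambda>t. nrm (T t f - f)) \<longlongrightarrow> 0) (at_right 0))"

definition gen :: "(real \<Rightarrow> 'v \<Rightarrow> 'v) \<Rightarrow> ('v \<times> 'v) set" where
  "gen T = {(f, g). f \<in> H \<and> g \<in> H \<and>
     ((\<lambda>t. nrm (of_real (1 / t) \<cdot> (T t f - f) - g)) \<longlongrightarrow> 0) (at_right 0)}"

context
  fixes T assumes sg: "c0_sg T"
begin

lemma sg_bdd: "t \<ge> 0 \<Longrightarrow> bdd_op (T t)"
  and sg_0: "f \<in> H \<Longrightarrow> T 0 f \<simeq> f"
  and sg_add: "s \<ge> 0 \<Longrightarrow> t \<ge> 0 \<Longrightarrow> f \<in> H \<Longrightarrow> T (s + t) f \<simeq> T s (T t f)"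
  and sg_cont: "f \<in> H \<Longrightarrow> ((\<lambda>t. nrm (T t f - f)) \<longlongrightarrow> 0) (at_right 0)"
  using sg by (auto simp: c0_sg_def)

lemma sg_H [simp, intro]: "t \<ge> 0 \<Longrightarrow> f \<in> H \<Longrightarrow> T t f \<in> H"
  using sg_bdd bdd_opD(1) by blast

text \<open>Otherwise there are times \<open>t n\<close> tending to 0 along which the operator norms
  are unbounded; but continuity at 0 bounds each orbit along this sequence, against
  \<open>uniform_boundedness\<close>.\<close>

lemma sg_local_bound: "\<exists>\<delta>>0. \<exists>M\<ge>1. \<forall>t. 0 \<le> t \<longrightarrow> t \<le> \<delta> \<longrightarrow> opn (T t) \<le> M"
proof (rule ccontr)
  assume *: "\<not> ?thesis"
  have "\<exists>t. 0 \<le> t \<and> t \<le> 1 / real (Suc n) \<and> opn (T t) > real (Suc n)" for n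
  proof -
    have "1 / real (Suc n) > 0" "real (Suc n) \<ge> 1" by auto
    thus ?thesis using * by (meson not_le)
  qed
  then obtain t where t: "\<And>n. 0 \<le> t n" "\<And>n. t n \<le> 1 / real (Suc n)" "\<And>n. opn (T (t n)) > real (Suc n)"
    by metis
  have "\<exists>C. \<forall>n. nrm (T (t n) f) \<le> C" if f: "f \<in> H" for f
  proof -
    have "\<forall>\<^sub>F s in at_right 0. nrm (T s f - f) < 1"
      using sg_cont[OF f] by (rule order_tendstoD) simp
    then obtain \<delta> where \<delta>: "\<delta> > 0" "\<And>s. 0 < s \<Longrightarrow> s < \<delta> \<Longrightarrow> nrm (T s f - f) < 1"
      unfolding eventually_at_right_field by auto
    obtain N :: nat where N: "1 / real (Suc N) < \<delta>"
      using \<delta>(1) reals_Archimedean by (auto simp: inverse_eq_divide)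
    have "nrm (T (t n) f) \<le> nrm f + 1" if "n \<ge> N" for n
    proof -
      have "1 / real (Suc n) \<le> 1 / real (Suc N)" using that by (intro divide_left_mono) auto
      hence "t n < \<delta>" using t(2)[of n] N by linarith
      hence "nrm (T (t n) f - f) < 1"
        using \<delta>(2)[of "t n"] t(1)[of n] sg_0[OF f] by (cases "t n = 0") (auto simp: eqv_def)
      thus ?thesis using nrm_le_add[of "T (t n) f" f] f t(1)[of n] by auto
    qed
    hence "Bseq (\<lambda>n. nrm (T (t n) f))"
      using f t(1) by (intro BfunI[where K = "nrm f + 1"]) (auto simp: eventually_sequentially)
    then obtain C where "\<And>n. norm (nrm (T (t n) f)) \<le> C" by (auto simp: Bseq_def)
    thus ?thesis by (metis abs_le_D1 real_norm_def)
  qed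
  then obtain C where C: "\<And>n. opn (T (t n)) \<le> C"
    using uniform_boundedness[of "\<lambda>n. T (t n)"] sg_bdd t(1) by blast
  obtain n :: nat where "real n > C" using reals_Archimedean2 by blast
  thus False using C[of n] t(3)[of n] by simp
qed

lemma sg_bound: obtains M where "M \<ge> 0" "\<And>t f. 0 \<le> t \<Longrightarrow> t \<le> \<tau> \<Longrightarrow> f \<in> H \<Longrightarrow> nrm (T t f) \<le> M * nrm f"
proof -
  obtain \<delta> M where d: "\<delta> > 0" "M \<ge> 1" "\<And>t. 0 \<le> t \<Longrightarrow> t \<le> \<delta> \<Longrightarrow> opn (T t) \<le> M"
    using sg_local_bound by blast
  have d': "nrm (T t f) \<le> M * nrm f" if "0 \<le> t" "t \<le> \<delta>" "f \<in> H" for t f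
    using opn_bound[OF sg_bdd[OF that(1)] that(3)] mult_right_mono[OF d(3)[OF that(1,2)], of "nrm f"] that by simp
  have *: "nrm (T t f) \<le> M ^ Suc j * nrm f" if "0 \<le> t" "t \<le> real (Suc j) * \<delta>" "f \<in> H" for t f j
    using that
  proof (induction j arbitrary: t)
    case (Suc j)
    show ?case
    proof (cases "t \<le> \<delta>")
      case True
      have "M ^ 1 \<le> M ^ Suc (Suc j)" using d(2) by (intro power_increasing) auto
      hence "M * nrm f \<le> M ^ Suc (Suc j) * nrm f" using Suc.prems by (intro mult_right_mono) auto
      thus ?thesis using d'[OF Suc.prems(1) True Suc.prems(3)] by linarith
    next
      case False
      have "nrm (T t f) = nrm (T \<delta> (T (t - \<delta>) f))"
        using sg_add[of \<delta> "t - \<delta>" f] False d(1) Suc.prems by (intro eqv_nrm) auto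
      also have "\<dots> \<le> M * nrm (T (t - \<delta>) f)" using d(1) False Suc.prems by (intro d') auto
      also have "\<dots> \<le> M * (M ^ Suc j * nrm f)"
        using d False Suc.prems by (intro mult_left_mono Suc.IH) (auto simp: algebra_simps)
      finally show ?thesis by simp
    qed
  qed (use d' in auto)
  obtain j :: nat where "\<tau> / \<delta> < real j" using reals_Archimedean2 by blast
  hence "\<tau> \<le> real (Suc j) * \<delta>" using d(1) by (simp add: field_simps)
  thus ?thesis using that[of "M ^ Suc j"] * d(2) by (meson order_trans zero_le_one zero_le_power)
qed

section \<open>Generators\<close>

lemma gen_H: "(f, g) \<in> gen T \<Longrightarrow> f \<in> H \<and> g \<in> H"
  by (simp add: gen_def)

lemma gen_ip:
  assumes "(f, g) \<in> gen T" "h \<in> H"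
  shows "((\<lambda>t. ip (of_real (1 / t) \<cdot> (T t f - f)) h) \<longlongrightarrow> ip g h) (at_right 0)"
proof -
  have f: "f \<in> H" "g \<in> H" and lim: "((\<lambda>t. nrm (of_real (1 / t) \<cdot> (T t f - f) - g)) \<longlongrightarrow> 0) (at_right 0)"
    using assms(1) by (auto simp: gen_def)
  have "((\<lambda>t. ip (of_real (1 / t) \<cdot> (T t f - f)) h - ip g h) \<longlongrightarrow> 0) (at_right 0)"
  proof (rule Lim_null_comparison[OF _ tendsto_mult_left_zero[OF lim, of "nrm h"]])
    show "\<forall>\<^sub>F t in at_right 0. norm (ip (of_real (1 / t) \<cdot> (T t f - f)) h - ip g h)
        \<le> nrm (of_real (1 / t) \<cdot> (T t f - f) - g) * nrm h"
      using at_right_01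
    proof eventually_elim
      case (elim t)
      thus ?case using f assms(2) by (subst ip_diff_left[symmetric]) (auto intro!: norm_ip_le)
    qed
  qed
  thus ?thesis by (simp add: LIM_zero_iff)
qed

lemma gen_eqv:
  assumes fg: "(f, g) \<in> gen T" and e: "f \<simeq> f'" "g \<simeq> g'" "f' \<in> H" "g' \<in> H"
  shows "(f', g') \<in> gen T"
proof -
  note H = gen_H[OF fg]
  have "\<forall>\<^sub>F t in at_right 0. nrm (of_real (1 / t) \<cdot> (T t f - f) - g) = nrm (of_real (1 / t) \<cdot> (T t f' - f') - g')"
    using at_right_01
  proof eventually_elim
    case (elim t)
    thus ?case using H e by (intro eqv_nrm eqv_diff eqv_scl bdd_opD(2)[OF sg_bdd]) auto
  qed
  moreover have "((\<lambda>t. nrm (of_real (1 / t) \<cdot> (T t f - f) - g)) \<longlongrightarrow> 0) (at_right 0)"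
    using fg by (simp add: gen_def)
  ultimately have "((\<lambda>t. nrm (of_real (1 / t) \<cdot> (T t f' - f') - g')) \<longlongrightarrow> 0) (at_right 0)"
    by (rule Lim_transform_eventually[rotated])
  thus ?thesis using e by (simp add: gen_def)
qed

lemma gen_combination:
  assumes fg: "(f, g) \<in> gen T" "(f', g') \<in> gen T"
  shows "(f + c \<cdot> f', g + c \<cdot> g') \<in> gen T"
proof -
  note H = gen_H[OF fg(1)] gen_H[OF fg(2)]
  have lim: "((\<lambda>t. nrm (of_real (1 / t) \<cdot> (T t f - f) - g) + cmod c * nrm (of_real (1 / t) \<cdot> (T t f' - f') - g'))
      \<longlongrightarrow> 0 + cmod c * 0) (at_right 0)"
    using fg by (intro tendsto_intros) (auto simp: gen_def)
  have "((\<lambda>t. nrm (of_real (1 / t) \<cdot> (T t (f + c \<cdot> f') - (f + c \<cdot> f')) - (g + c \<cdot> g'))) \<longlongrightarrow> 0) (at_right 0)"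
  proof (rule Lim_null_comparison)
    show "\<forall>\<^sub>F t in at_right 0. norm (nrm (of_real (1 / t) \<cdot> (T t (f + c \<cdot> f') - (f + c \<cdot> f')) - (g + c \<cdot> g')))
        \<le> nrm (of_real (1 / t) \<cdot> (T t f - f) - g) + cmod c * nrm (of_real (1 / t) \<cdot> (T t f' - f') - g')"
      using at_right_01
    proof eventually_elim
      case (elim t)
      let ?x = "of_real (1 / t) \<cdot> (T t f - f) - g" and ?y = "of_real (1 / t) \<cdot> (T t f' - f') - g'"
      have t: "t \<ge> 0" using elim by simp
      have TH: "T t f \<in> H" "T t f' \<in> H" "T t (f + c \<cdot> f') \<in> H" using H t by auto
      have "T t (f + c \<cdot> f') \<simeq> T t f + c \<cdot> T t f'"
        using bdd_opD(3)[OF sg_bdd[OF t], of f f' 1 c] H by simp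
      hence ipT: "ip (T t (f + c \<cdot> f')) h = ip (T t f) h + c * ip (T t f') h" if "h \<in> H" for h
        using eqv_ip_left[of "T t (f + c \<cdot> f')" "T t f + c \<cdot> T t f'" h] H TH that by (simp add: ip_simps)
      have "of_real (1 / t) \<cdot> (T t (f + c \<cdot> f') - (f + c \<cdot> f')) - (g + c \<cdot> g') \<simeq> ?x + c \<cdot> ?y"
        using H TH by (intro eqvI) (auto simp: ip_simps ipT algebra_simps)
      hence "nrm (of_real (1 / t) \<cdot> (T t (f + c \<cdot> f') - (f + c \<cdot> f')) - (g + c \<cdot> g')) = nrm (?x + c \<cdot> ?y)"
        using H TH by (intro eqv_nrm) auto
      also have "\<dots> \<le> nrm ?x + nrm (c \<cdot> ?y)" using H TH by (intro nrm_triangle) auto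
      also have "nrm (c \<cdot> ?y) = cmod c * nrm ?y" using H TH by (intro nrm_scl) auto
      finally show ?case using H TH by simp
    qed
  qed (use lim in simp)
  thus ?thesis using H by (simp add: gen_def)
qed

text \<open>Together with linearity this makes the graph single-valued modulo
  \<open>\<simeq>\<close>; it is the reason why the perturbed inverse is injective.\<close>

lemma gen_zero: assumes "(f, g) \<in> gen T" "nrm f = 0" shows "nrm g = 0"
proof -
  note H = gen_H[OF assms(1)]
  have "ip g g = 0"
  proof (rule tendsto_unique[OF trivial_limit_at_right_real gen_ip[OF assms(1)]])
    have "\<forall>\<^sub>F t in at_right 0. ip (of_real (1 / t) \<cdot> (T t f - f)) g = 0"
      using at_right_01
    proof eventually_elim
      case (elim t)
      have "bdd_op (T t)" using elim sg_bdd by simp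
      then obtain C where "nrm (T t f) \<le> C * nrm f" using bdd_op_bound H by metis
      hence "nrm (T t f) = 0" using assms(2) H elim nrm_ge_0[of "T t f"] sg_H[of t f] by (simp del: nrm_ge_0)
      hence "ip (T t f) g = 0" "ip f g = 0"
        using assms(2) norm_ip_le[of "T t f" g] norm_ip_le[of f g] H elim by auto
      thus ?case using H elim by (simp add: ip_simps)
    qed
    thus "((\<lambda>t. ip (of_real (1 / t) \<cdot> (T t f - f)) g) \<longlongrightarrow> 0) (at_right 0)" by (rule tendsto_eventually)
  qed (use H in auto)
  thus ?thesis using H by (simp add: nrm_def)
qed

text \<open>Telescoping: \<open>T\<^sub>t w - e\<^sup>\<mu>\<^sup>t w\<close> is a sum of \<open>N\<close> terms, each bounded by a constant times
  \<open>\<parallel>T\<^sub>h w - e\<^sup>\<mu>\<^sup>h w\<parallel> = o(h)\<close> with \<open>h = t/N\<close>.\<close>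

lemma sg_eigenvector:
  assumes w: "(w, of_real \<mu> \<cdot> w) \<in> gen T" and t: "t \<ge> 0"
  shows "T t w \<simeq> of_real (exp (t * \<mu>)) \<cdot> w"
proof (cases "t = 0")
  case True
  thus ?thesis using sg_0 gen_H[OF w] by simp
next
  case False
  hence tp: "t > 0" using t by simp
  have wH: "w \<in> H" using gen_H[OF w] by simp
  obtain M where M: "M \<ge> 0" "\<And>s f. 0 \<le> s \<Longrightarrow> s \<le> t \<Longrightarrow> f \<in> H \<Longrightarrow> nrm (T s f) \<le> M * nrm f"
    using sg_bound by blast
  define e where "e h = nrm (T h w - of_real (exp (h * \<mu>)) \<cdot> w)" for h
  have e0: "((\<lambda>h. e h / h) \<longlongrightarrow> 0) (at_right 0)"
  proof (rule Lim_null_comparison)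
    show "((\<lambda>h. nrm (of_real (1 / h) \<cdot> (T h w - w) - of_real \<mu> \<cdot> w) + \<bar>(exp (h * \<mu>) - 1) / h - \<mu>\<bar> * nrm w)
        \<longlongrightarrow> 0) (at_right 0)"
    proof -
      have "((\<lambda>h. nrm (of_real (1 / h) \<cdot> (T h w - w) - of_real \<mu> \<cdot> w) + \<bar>(exp (h * \<mu>) - 1) / h - \<mu>\<bar> * nrm w)
        \<longlongrightarrow> 0 + \<bar>\<mu> - \<mu>\<bar> * nrm w) (at_right 0)"
        using w by (intro tendsto_intros exp_quotient) (simp add: gen_def)
      thus ?thesis by simp
    qed
    show "\<forall>\<^sub>F h in at_right 0. norm (e h / h) \<le>
        nrm (of_real (1 / h) \<cdot> (T h w - w) - of_real \<mu> \<cdot> w) + \<bar>(exp (h * \<mu>) - 1) / h - \<mu>\<bar> * nrm w"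
      using at_right_01
    proof eventually_elim
      case (elim h)
      let ?x = "of_real (1 / h) \<cdot> (T h w - w) - of_real \<mu> \<cdot> w"
      let ?y = "of_real ((exp (h * \<mu>) - 1) / h - \<mu>) \<cdot> w"
      have TH: "T h w \<in> H" using wH elim by auto
      have "e h / h = nrm (of_real (1 / h) \<cdot> (T h w - of_real (exp (h * \<mu>)) \<cdot> w))"
        using elim TH wH unfolding e_def by (subst nrm_scl) (auto simp: norm_divide)
      also have "of_real (1 / h) \<cdot> (T h w - of_real (exp (h * \<mu>)) \<cdot> w) = ?x - ?y"
        by (simp add: scale_right_diff_distrib scale_left_diff_distrib algebra_simps diff_divide_distrib)
      also have "nrm (?x - ?y) \<le> nrm ?x + nrm ?y" using TH wH by (intro nrm_triangle_diff) auto
      also have "nrm ?y = \<bar>(exp (h * \<mu>) - 1) / h - \<mu>\<bar> * nrm w" using wH by (subst nrm_scl) (auto simp del: of_real_diff of_real_divide)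
      finally show ?case using elim TH wH by (simp add: e_def)
    qed
  qed
  define E where "E = max 1 (exp (t * \<mu>))"
  define d where "d = nrm (T t w - of_real (exp (t * \<mu>)) \<cdot> w)"
  have dN: "d \<le> real N * (M * e (t / real N)) * E" if N: "N > 0" for N :: nat
  proof -
    define h where "h = t / real N"
    have h: "h > 0" "real N * h = t" using tp N by (auto simp: h_def)
    \<comment> \<open>Truncation at 1 makes \<open>p ^ k\<close> increasing in \<open>k\<close>, so
      one power of \<open>p\<close> bounds both terms of the recursion, and \<open>p ^ N\<close>
      equals \<open>E\<close>, which does not depend on \<open>N\<close>.\<close>
    define p where "p = max 1 (exp (h * \<mu>))"
    have p1: "p \<ge> 1" by (simp add: p_def)
    have eh0: "e h \<ge> 0" using h wH by (auto simp: e_def)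
    have "nrm (T (real k * h) w - of_real (exp (real k * h * \<mu>)) \<cdot> w) \<le> real k * (M * e h) * p ^ k"
      if "k \<le> N" for k using that
    proof (induction k)
      case 0
      show ?case using sg_0[OF wH] by (simp add: eqv_def)
    next
      case (Suc k)
      have kh: "real k * h \<ge> 0" "real k * h \<le> t" "real (Suc k) * h \<ge> 0"
        using h Suc.prems by (auto simp: h(2)[symmetric] intro!: mult_right_mono)
      let ?z = "T h w - of_real (exp (h * \<mu>)) \<cdot> w"
      let ?r = "T (real k * h) w - of_real (exp (real k * h * \<mu>)) \<cdot> w"
      have zH: "?z \<in> H" "?r \<in> H" using h wH kh by auto
      note bk = sg_bdd[OF kh(1)]
      have 1: "ip (T (real (Suc k) * h) w) y = ip (T (real k * h) (T h w)) y" if "y \<in> H" for y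
        using sg_add[of "real k * h" h w] kh h wH that by (intro eqv_ip_left) (auto simp: algebra_simps)
      have 2: "ip (T (real k * h) ?z) y = ip (T (real k * h) (T h w)) y
          - of_real (exp (h * \<mu>)) * ip (T (real k * h) w) y" if y: "y \<in> H" for y
      proof -
        have "T (real k * h) (1 \<cdot> T h w + (- of_real (exp (h * \<mu>))) \<cdot> w) \<simeq>
            1 \<cdot> T (real k * h) (T h w) + (- of_real (exp (h * \<mu>))) \<cdot> T (real k * h) w"
          using h wH by (intro bdd_opD(3)[OF bk]) auto
        hence "ip (T (real k * h) ?z) y = ip (1 \<cdot> T (real k * h) (T h w) + (- of_real (exp (h * \<mu>))) \<cdot> T (real k * h) w) y"
          using h wH kh y by (intro eqv_ip_left) auto
        thus ?thesis using h wH kh y by (simp add: ip_simps)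
      qed
      \<comment> \<open>The new error is the one-step error carried along by
        \<open>T (real k * h)\<close>, plus the error after \<open>k\<close> steps times
        \<open>exp (h * \<mu>)\<close>.\<close>
      have "T (real (Suc k) * h) w - of_real (exp (real (Suc k) * h * \<mu>)) \<cdot> w
          \<simeq> T (real k * h) ?z + of_real (exp (h * \<mu>)) \<cdot> ?r"
      proof (rule eqvI)
        fix y assume y: "y \<in> H"
        have "ip (T (real (Suc k) * h) w - of_real (exp (real (Suc k) * h * \<mu>)) \<cdot> w) y
            = ip (T (real k * h) (T h w)) y - of_real (exp (real (Suc k) * h * \<mu>)) * ip w y"
          using y wH kh h by (simp only: ip_diff_left ip_scl_left 1 sg_H H_scl)
        also have "exp (real (Suc k) * h * \<mu>) = exp (h * \<mu>) * exp (real k * h * \<mu>)"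
          by (simp add: algebra_simps flip: exp_add)
        finally show "ip (T (real (Suc k) * h) w - of_real (exp (real (Suc k) * h * \<mu>)) \<cdot> w) y
            = ip (T (real k * h) ?z + of_real (exp (h * \<mu>)) \<cdot> ?r) y"
          using y wH kh h zH by (simp add: ip_add_left ip_scl_left 2) (simp add: ip_simps algebra_simps exp_add)
      qed (use wH kh h zH in auto)
      hence "nrm (T (real (Suc k) * h) w - of_real (exp (real (Suc k) * h * \<mu>)) \<cdot> w)
          = nrm (T (real k * h) ?z + of_real (exp (h * \<mu>)) \<cdot> ?r)"
        using wH kh h zH by (intro eqv_nrm) auto
      also have "\<dots> \<le> nrm (T (real k * h) ?z) + nrm (of_real (exp (h * \<mu>)) \<cdot> ?r)"
        using kh zH by (intro nrm_triangle) auto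
      also have "nrm (of_real (exp (h * \<mu>)) \<cdot> ?r) = exp (h * \<mu>) * nrm ?r" using zH by (subst nrm_scl) auto
      also have "nrm (T (real k * h) ?z) + exp (h * \<mu>) * nrm ?r
          \<le> M * e h * p ^ Suc k + p * (real k * (M * e h) * p ^ k)"
      proof (rule add_mono)
        have "nrm (T (real k * h) ?z) \<le> M * e h * 1" using M(2)[OF kh(1,2) zH(1)] by (simp add: e_def)
        also have "\<dots> \<le> M * e h * p ^ Suc k"
          by (rule mult_left_mono[OF one_le_power[OF p1]]) (use M(1) eh0 in simp)
        finally show "nrm (T (real k * h) ?z) \<le> M * e h * p ^ Suc k" .
        show "exp (h * \<mu>) * nrm ?r \<le> p * (real k * (M * e h) * p ^ k)"
          using Suc zH by (intro mult_mono) (auto simp: p_def)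
      qed
      also have "\<dots> = real (Suc k) * (M * e h) * p ^ Suc k" by (simp add: algebra_simps)
      finally show ?case .
    qed
    from this[of N] have "d \<le> real N * (M * e h) * p ^ N" by (simp add: h(2) d_def)
    also have "p ^ N = E"
    proof -
      have "p ^ N = max (1 ^ N) (exp (h * \<mu>) ^ N)" unfolding p_def
        by (cases "exp (h * \<mu>) \<le> 1") (auto simp: max_def power_le_one one_le_power dest: power_le_one antisym)
      also have "exp (h * \<mu>) ^ N = exp (t * \<mu>)" by (simp add: exp_of_nat_mult[symmetric] h(2)[symmetric] mult.assoc)
      finally show ?thesis by (simp add: E_def)
    qed
    finally show ?thesis by (simp add: h_def)
  qed
  have filt: "filterlim (\<lambda>N. t / real (Suc N)) (at_right 0) sequentially"
    unfolding filterlim_at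
  proof
    show "((\<lambda>N. t / real (Suc N)) \<longlongrightarrow> 0) sequentially"
      using tendsto_mult_right_zero[OF LIMSEQ_inverse_real_of_nat, of t] by (simp add: divide_inverse)
  qed (use tp in auto)
  have "(\<lambda>N. e (t / real (Suc N)) / (t / real (Suc N))) \<longlonglongrightarrow> 0"
    by (rule filterlim_compose[OF e0 filt])
  hence "(\<lambda>N. t * M * E * (e (t / real (Suc N)) / (t / real (Suc N)))) \<longlonglongrightarrow> 0"
    by (rule tendsto_mult_right_zero)
  moreover have "t * M * E * (e (t / real (Suc N)) / (t / real (Suc N))) = real (Suc N) * (M * e (t / real (Suc N))) * E" for N
    using tp by (simp add: field_simps)
  ultimately have "(\<lambda>N. real (Suc N) * (M * e (t / real (Suc N))) * E) \<longlonglongrightarrow> 0" by simp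
  hence "d \<le> 0" by (rule LIMSEQ_le_const) (intro exI allI impI dN, simp)
  moreover have "d \<ge> 0" using t wH by (auto simp: d_def)
  ultimately show ?thesis by (simp add: eqv_def d_def)
qed

section \<open>Symmetric semigroups\<close>

context
  assumes sym: "\<And>t. t \<ge> 0 \<Longrightarrow> sym_op (T t)"
begin

lemma gen_sym: assumes "(f, g) \<in> gen T" "(f', g') \<in> gen T" shows "ip g f' = ip f g'"
proof (rule tendsto_unique[OF trivial_limit_at_right_real gen_ip[OF assms(1)]])
  note H = gen_H[OF assms(1)] gen_H[OF assms(2)]
  have "((\<lambda>t. cnj (ip (of_real (1 / t) \<cdot> (T t f' - f')) f)) \<longlongrightarrow> cnj (ip g' f)) (at_right 0)"
    using H by (intro tendsto_cnj gen_ip assms) auto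
  moreover have "\<forall>\<^sub>F t in at_right 0. cnj (ip (of_real (1 / t) \<cdot> (T t f' - f')) f) = ip (of_real (1 / t) \<cdot> (T t f - f)) f'"
    using at_right_01
  proof eventually_elim
    case (elim t)
    hence "ip (T t f) f' = ip f (T t f')" using sym_opD(2)[OF sym] H by simp
    thus ?case using H elim by (subst ip_cnj) (auto simp: ip_simps)
  qed
  ultimately have "((\<lambda>t. ip (of_real (1 / t) \<cdot> (T t f - f)) f') \<longlongrightarrow> cnj (ip g' f)) (at_right 0)"
    by (rule Lim_transform_eventually)
  thus "((\<lambda>t. ip (of_real (1 / t) \<cdot> (T t f - f)) f') \<longlongrightarrow> ip f g') (at_right 0)"
    using H by (simp add: ip_cnj)
qed (use gen_H assms in auto)

text \<open>\<open>\<parallel>T\<^sub>t f\<parallel>\<^sup>2 = \<langle>T\<^sub>2\<^sub>t f, f\<rangle>\<close> propagates the exponential bound from \<open>t = 1\<close> to \<open>t = 2\<^sup>-\<^sup>n\<close>.\<close>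

lemma gen_bounded_above: "\<exists>\<omega>. \<forall>(f, g) \<in> gen T. Re (ip g f) \<le> \<omega> * (nrm f)\<^sup>2"
proof -
  obtain K where K: "K > 0" "\<And>f. f \<in> H \<Longrightarrow> nrm (T 1 f) \<le> K * nrm f"
    using bdd_op_bound[OF sg_bdd[of 1]] by auto
  define \<omega> where "\<omega> = ln K"
  have b: "nrm (T ((1/2) ^ n) f) \<le> exp ((1/2) ^ n * \<omega>) * nrm f" if "f \<in> H" for n f
    using that
  proof (induction n arbitrary: f)
    case 0
    thus ?case using K by (simp add: \<omega>_def)
  next
    case (Suc n)
    define t :: real where "t = (1/2) ^ Suc n"
    have t: "t \<ge> 0" "t + t = (1/2) ^ n" by (auto simp: t_def)
    have "(nrm (T t f))\<^sup>2 = Re (ip (T t (T t f)) f)"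
      using sym_opD(2)[OF sym[OF t(1)], of "T t f" f] Suc.prems t by (simp add: nrm_sq)
    also have "ip (T t (T t f)) f = ip (T (t + t) f) f"
      using sg_add[of t t f] Suc.prems t by (intro eqv_ip_left[symmetric]) auto
    also have "Re \<dots> \<le> nrm (T (t + t) f) * nrm f" using Suc.prems t by (intro Re_ip_le) auto
    also have "\<dots> \<le> (exp ((1/2) ^ n * \<omega>) * nrm f) * nrm f"
      unfolding t(2) using Suc by (intro mult_right_mono) auto
    also have "exp ((1/2) ^ n * \<omega>) = (exp (t * \<omega>))\<^sup>2"
      by (simp add: exp_double[symmetric] t(2)[symmetric] algebra_simps)
    finally have "(nrm (T t f))\<^sup>2 \<le> (exp (t * \<omega>) * nrm f)\<^sup>2"
      by (simp only: power_mult_distrib power2_eq_square ac_simps)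
    hence "nrm (T t f) \<le> exp (t * \<omega>) * nrm f"
      by (rule power2_le_imp_le) (use Suc.prems in simp)
    thus ?case by (simp add: t_def)
  qed
  \<comment> \<open>The difference quotients converge as t tends to 0 from the right, so comparing
    them along the powers of 1/2 suffices.\<close>
  have filt: "filterlim (\<lambda>n. (1/2) ^ n :: real) (at_right 0) sequentially"
    unfolding filterlim_at using LIMSEQ_power_zero[of "1/2 :: real"] by auto
  have "Re (ip g f) \<le> \<omega> * (nrm f)\<^sup>2" if fg: "(f, g) \<in> gen T" for f g
  proof (rule LIMSEQ_le)
    note H = gen_H[OF fg]
    have "((\<lambda>t. Re (ip (of_real (1 / t) \<cdot> (T t f - f)) f)) \<longlongrightarrow> Re (ip g f)) (at_right 0)"
      using gen_ip[OF fg] H by (intro tendsto_Re) auto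
    thus "(\<lambda>n. Re (ip (of_real (1 / (1/2) ^ n) \<cdot> (T ((1/2) ^ n) f - f)) f)) \<longlonglongrightarrow> Re (ip g f)"
      by (rule filterlim_compose[OF _ filt])
    have "((\<lambda>t. (exp (t * \<omega>) - 1) / t * (nrm f)\<^sup>2) \<longlongrightarrow> \<omega> * (nrm f)\<^sup>2) (at_right 0)"
      by (intro tendsto_intros exp_quotient)
    thus "(\<lambda>n. (exp ((1/2) ^ n * \<omega>) - 1) / (1/2) ^ n * (nrm f)\<^sup>2) \<longlonglongrightarrow> \<omega> * (nrm f)\<^sup>2"
      by (rule filterlim_compose[OF _ filt])
    have "Re (ip (of_real (1 / t) \<cdot> (T t f - f)) f) \<le> (exp (t * \<omega>) - 1) / t * (nrm f)\<^sup>2"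
      if t: "t = (1/2) ^ n" for n and t :: real
    proof -
      have tp: "t > 0" by (simp add: t)
      have "Re (ip (T t f) f) \<le> nrm (T t f) * nrm f" using H tp by (intro Re_ip_le) auto
      also have "\<dots> \<le> exp (t * \<omega>) * nrm f * nrm f" using b[of f n] H t by (intro mult_right_mono) auto
      finally have "Re (ip (T t f) f) \<le> exp (t * \<omega>) * (nrm f)\<^sup>2" by (simp add: power2_eq_square)
      hence le: "(Re (ip (T t f) f) - (nrm f)\<^sup>2) / t \<le> (exp (t * \<omega>) * (nrm f)\<^sup>2 - (nrm f)\<^sup>2) / t"
        using tp by (intro divide_right_mono) auto
      have e1: "Re (ip (of_real (1 / t) \<cdot> (T t f - f)) f) = (Re (ip (T t f) f) - (nrm f)\<^sup>2) / t"
        using H tp by (simp add: ip_simps nrm_sq)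
      have e2: "(exp (t * \<omega>) - 1) / t * (nrm f)\<^sup>2 = (exp (t * \<omega>) * (nrm f)\<^sup>2 - (nrm f)\<^sup>2) / t"
        by (simp add: left_diff_distrib diff_divide_distrib)
      show ?thesis unfolding e1 e2 by (rule le)
    qed
    thus "\<exists>N. \<forall>n\<ge>N. Re (ip (of_real (1 / (1/2) ^ n) \<cdot> (T ((1/2) ^ n) f - f)) f)
        \<le> (exp ((1/2) ^ n * \<omega>) - 1) / (1/2) ^ n * (nrm f)\<^sup>2" by blast
  qed
  thus ?thesis by blast
qed

text \<open>The supremum \<open>\<omega>\<close> of the quadratic form cannot lie in the resolvent set: with
  \<open>C = \<parallel>(\<omega> - A)\<^sup>-\<^sup>1\<parallel>\<close>, positivity of the form \<open>\<langle>(\<omega> - A) x, x\<rangle>\<close> at \<open>x = f - (\<omega> - A)\<^sup>-\<^sup>1 f / C\<close> yields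
  \<open>\<langle>(\<omega> - A) f, f\<rangle> \<ge> \<parallel>f\<parallel>\<^sup>2 / C\<close>.\<close>

lemma gen_form_bound:
  assumes res: "\<And>r. r > s \<Longrightarrow> \<exists>C. \<forall>f\<in>H. \<exists>g h. (g, h) \<in> gen T \<and> of_real r \<cdot> g - h \<simeq> f \<and> nrm g \<le> C * nrm f"
    and fg: "(f, g) \<in> gen T"
  shows "Re (ip g f) \<le> s * (nrm f)\<^sup>2"
proof -
  define V where "V = {\<omega>. \<forall>(f, g) \<in> gen T. Re (ip g f) \<le> \<omega> * (nrm f)\<^sup>2}"
  have VD: "Re (ip g f) \<le> \<omega> * (nrm f)\<^sup>2" if "\<omega> \<in> V" "(f, g) \<in> gen T" for \<omega> f g
    using that by (auto simp: V_def)
  have up: "\<omega>' \<in> V" if "\<omega> \<in> V" "\<omega> \<le> \<omega>'" for \<omega> \<omega>'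
  proof -
    have "Re (ip g f) \<le> \<omega>' * (nrm f)\<^sup>2" if "(f, g) \<in> gen T" for f g
      using VD[OF \<open>\<omega> \<in> V\<close> that] mult_right_mono[OF \<open>\<omega> \<le> \<omega>'\<close>, of "(nrm f)\<^sup>2"] by simp
    thus ?thesis by (auto simp: V_def)
  qed
  have V0: "V \<noteq> {}" using gen_bounded_above unfolding V_def by blast
  have "s \<in> V"
  proof (rule ccontr)
    assume s: "s \<notin> V"
    hence low: "s \<le> \<omega>" if "\<omega> \<in> V" for \<omega> using up[OF that, of s] by linarith
    hence bdd: "bdd_below V" by (auto simp: bdd_below_def)
    define \<omega> where "\<omega> = Inf V"
    \<comment> \<open>The infimum is attained, because each single inequality passes to the limit.
      Hence the form of \<omega> - A is nonnegative at \<omega> itself.\<close>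
    have "Re (ip g f) \<le> \<omega> * (nrm f)\<^sup>2" if fg: "(f, g) \<in> gen T" for f g
    proof (cases "nrm f = 0")
      case True
      obtain \<omega>' where "\<omega>' \<in> V" using V0 by auto
      thus ?thesis using VD[OF _ fg, of \<omega>'] True by simp
    next
      case False
      hence p: "(nrm f)\<^sup>2 > 0" by simp
      have "Re (ip g f) / (nrm f)\<^sup>2 \<le> \<omega>" unfolding \<omega>_def
        by (rule cInf_greatest[OF V0]) (use VD[OF _ fg] p in \<open>simp add: field_simps\<close>)
      thus ?thesis using p by (simp add: field_simps)
    qed
    hence \<omega>V: "\<omega> \<in> V" by (auto simp: V_def)
    hence "\<omega> > s" using low[OF \<omega>V] s by (cases "\<omega> = s") auto
    then obtain C0 where C0: "\<And>f. f \<in> H \<Longrightarrow> \<exists>g h. (g, h) \<in> gen T \<and> of_real \<omega> \<cdot> g - h \<simeq> f \<and> nrm g \<le> C0 * nrm f"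
      using res by blast
    define C where "C = max C0 1"
    have Cp: "C > 0" by (simp add: C_def)
    have "Re (ip h1 f1) \<le> (\<omega> - 1 / C) * (nrm f1)\<^sup>2" if f1: "(f1, h1) \<in> gen T" for f1 h1
    proof -
      note H1 = gen_H[OF f1]
      obtain f2 h2 where f2: "(f2, h2) \<in> gen T" "of_real \<omega> \<cdot> f2 - h2 \<simeq> f1" "nrm f2 \<le> C0 * nrm f1"
        using C0 H1 by blast
      note H2 = gen_H[OF f2(1)]
      have "C0 * nrm f1 \<le> C * nrm f1" using H1 by (intro mult_right_mono) (auto simp: C_def)
      hence C2: "nrm f2 \<le> C * nrm f1" using f2(3) by linarith
      \<comment> \<open>This value minimises \<open>2 * a + a\<^sup>2 * C\<close>, and the minimum
        is \<open>- 1 / C\<close>.\<close>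
      define a where "a = - 1 / C"
      have "Re (ip (h1 + of_real a \<cdot> h2) (f1 + of_real a \<cdot> f2)) \<le> \<omega> * (nrm (f1 + of_real a \<cdot> f2))\<^sup>2"
        by (rule VD[OF \<omega>V gen_combination[OF f1 f2(1)]])
      hence 1: "Re (ip h1 f1) + a * Re (ip h1 f2) + a * Re (ip h2 f1) + a\<^sup>2 * Re (ip h2 f2)
          \<le> \<omega> * ((nrm f1)\<^sup>2 + 2 * a * Re (ip f1 f2) + a\<^sup>2 * (nrm f2)\<^sup>2)"
        using H1 H2 by (simp add: nrm_add_sq nrm_scl ip_simps power_mult_distrib)
          (simp add: power2_eq_square algebra_simps)
      have eq: "\<omega> * Re (ip f2 y) - Re (ip h2 y) = Re (ip f1 y)" if "y \<in> H" for y
        using eqv_ip_left[OF f2(2), of y] H1 H2 that by (simp add: ip_simps complex_eq_iff)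
      have e1: "\<omega> * Re (ip f1 f2) - Re (ip h2 f1) = (nrm f1)\<^sup>2"
        using eq[of f1] H1 H2 by (simp add: nrm_sq Re_ip_commute[of f2 f1])
      have e2: "Re (ip h1 f2) = Re (ip h2 f1)"
        using gen_sym[OF f1 f2(1)] H1 H2 Re_ip_commute[of f1 h2] by simp
      have e3: "\<omega> * (nrm f2)\<^sup>2 - Re (ip h2 f2) = Re (ip f1 f2)"
        using eq[of f2] H2 by (simp add: nrm_sq)
      have "Re (ip h1 f1) \<le> \<omega> * (nrm f1)\<^sup>2 + 2 * a * (\<omega> * Re (ip f1 f2) - Re (ip h2 f1))
          + a\<^sup>2 * (\<omega> * (nrm f2)\<^sup>2 - Re (ip h2 f2))"
        using 1 unfolding e2 by (simp add: algebra_simps)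
      also have "\<dots> = \<omega> * (nrm f1)\<^sup>2 + 2 * a * (nrm f1)\<^sup>2 + a\<^sup>2 * Re (ip f1 f2)" unfolding e1 e3 ..
      also have "Re (ip f1 f2) \<le> C * (nrm f1)\<^sup>2"
        using Re_ip_le[of f1 f2] mult_left_mono[OF C2, of "nrm f1"] H1 H2 by (simp add: power2_eq_square ac_simps)
      also have "\<omega> * (nrm f1)\<^sup>2 + 2 * a * (nrm f1)\<^sup>2 + a\<^sup>2 * (C * (nrm f1)\<^sup>2) = (\<omega> - 1 / C) * (nrm f1)\<^sup>2"
        using Cp by (simp add: a_def field_simps power2_eq_square)
      finally show ?thesis by (simp add: mult_left_mono)
    qed
    hence "\<omega> - 1 / C \<in> V" by (auto simp: V_def)
    hence "\<omega> \<le> \<omega> - 1 / C" unfolding \<omega>_def using bdd by (intro cInf_lower)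
    thus False using Cp by simp
  qed
  thus ?thesis using VD[OF _ fg] by blast
qed

end

end

end

section \<open>Symmetric perturbations\<close>

context semi_hilbert
begin

lemma bdd_op_zero: assumes "bdd_op T" shows "T 0 \<simeq> 0"
  using bdd_opD(6)[OF assms H_0, of 0] by simp

lemma bdd_op_sum:
  assumes T: "bdd_op T" and x: "\<And>i. i \<in> I \<Longrightarrow> x i \<in> H"
  shows "T (\<Sum>i\<in>I. c i \<cdot> x i) \<simeq> (\<Sum>i\<in>I. c i \<cdot> T (x i))"
  using x
proof (induction I rule: infinite_finite_induct)
  case (insert j I)
  have H: "x j \<in> H" "(\<Sum>i\<in>I. c i \<cdot> x i) \<in> H" "T (x j) \<in> H" "(\<Sum>i\<in>I. c i \<cdot> T (x i)) \<in> H"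
    using insert.prems bdd_opD(1)[OF T] by auto
  have "T (c j \<cdot> x j + (\<Sum>i\<in>I. c i \<cdot> x i)) \<simeq> c j \<cdot> T (x j) + T (\<Sum>i\<in>I. c i \<cdot> x i)"
    using bdd_opD(3)[OF T H(1,2), of "c j" 1] by simp
  moreover have "c j \<cdot> T (x j) + T (\<Sum>i\<in>I. c i \<cdot> x i) \<simeq> c j \<cdot> T (x j) + (\<Sum>i\<in>I. c i \<cdot> T (x i))"
    using insert H bdd_opD(1)[OF T] by (intro eqv_add) auto
  ultimately have "T (c j \<cdot> x j + (\<Sum>i\<in>I. c i \<cdot> x i)) \<simeq> c j \<cdot> T (x j) + (\<Sum>i\<in>I. c i \<cdot> T (x i))"
    by (rule eqv_trans) (use H bdd_opD(1)[OF T] in auto)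
  thus ?case using insert.hyps by simp
qed (auto intro: bdd_op_zero[OF T])

end

text \<open>\<open>R\<close> is given only as a right inverse of l - A modulo
  \<open>\<simeq>\<close>. Its uniqueness, additivity and Lipschitz bound are derived from
  \<open>T_form\<close>, that is, from coercivity of l - A with constant
  \<open>l - s\<close>.\<close>

locale symmetric_perturbation = semi_hilbert scl H ip
  for scl :: "complex \<Rightarrow> 'v::ab_group_add \<Rightarrow> 'v" (infixr "\<cdot>" 75) and H ip +
  fixes T :: "real \<Rightarrow> 'v \<Rightarrow> 'v" and B R :: "'v \<Rightarrow> 'v" and s \<beta> l :: real
  assumes T: "c0_sg T" and T_sym: "\<And>t. t \<ge> 0 \<Longrightarrow> sym_op (T t)"
    and T_form: "\<And>f g. (f, g) \<in> gen T \<Longrightarrow> Re (ip g f) \<le> s * (nrm f)\<^sup>2"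
    and B_sym: "sym_op B" and B_bound: "\<And>f. f \<in> H \<Longrightarrow> nrm (B f) \<le> \<beta> * nrm f" and \<beta>: "\<beta> \<ge> 0"
    and l: "s + \<beta> < l"
    and R: "\<And>f. f \<in> H \<Longrightarrow> \<exists>h. (R f, h) \<in> gen T \<and> of_real l \<cdot> R f - h \<simeq> f"
begin

lemmas B_H [simp, intro] = sym_opD(1)[OF B_sym]

lemma R_H [simp, intro]: "f \<in> H \<Longrightarrow> R f \<in> H"
  using R gen_H[OF T] by blast

lemma gen_resolvent_bound:
  assumes fh: "(f, h) \<in> gen T" shows "(l - s) * nrm f \<le> nrm (of_real l \<cdot> f - h)"
proof (cases "nrm f = 0")
  case False
  note H = gen_H[OF T fh]
  have p: "nrm f > 0" using False H by (simp add: less_le)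
  have "(l - s) * (nrm f)\<^sup>2 \<le> Re (ip (of_real l \<cdot> f - h) f)"
    using T_form[OF fh] H by (simp add: ip_simps nrm_sq algebra_simps)
  also have "\<dots> \<le> nrm (of_real l \<cdot> f - h) * nrm f" using H by (intro Re_ip_le) auto
  finally have "((l - s) * nrm f) * nrm f \<le> nrm (of_real l \<cdot> f - h) * nrm f"
    by (simp only: power2_eq_square ac_simps)
  thus ?thesis using p by (simp only: mult_le_cancel_right_pos)
qed (use gen_H[OF T fh] in simp)

lemma R_unique:
  assumes "(g, h) \<in> gen T" "of_real l \<cdot> g - h \<simeq> f" "f \<in> H"
  shows "R f \<simeq> g"
proof -
  note H = gen_H[OF T assms(1)]
  obtain h' where h': "(R f, h') \<in> gen T" "of_real l \<cdot> R f - h' \<simeq> f" using R assms(3) by blast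
  note H' = gen_H[OF T h'(1)]
  have d: "(R f + (-1) \<cdot> g, h' + (-1) \<cdot> h) \<in> gen T" by (rule gen_combination[OF T h'(1) assms(1)])
  have "of_real l \<cdot> (R f + (-1) \<cdot> g) - (h' + (-1) \<cdot> h) \<simeq> 0"
    using H H' assms(3) eqv_ip_left[OF assms(2)] eqv_ip_left[OF h'(2)]
    by (intro eqvI) (auto simp: ip_simps algebra_simps)
  hence "nrm (of_real l \<cdot> (R f + (-1) \<cdot> g) - (h' + (-1) \<cdot> h)) = 0" by (simp add: eqv_0_iff)
  hence "(l - s) * nrm (R f + (-1) \<cdot> g) \<le> 0" using gen_resolvent_bound[OF d] by simp
  hence "nrm (R f - g) \<le> 0" using l \<beta> by (simp add: mult_le_0_iff)
  thus ?thesis using H H' unfolding eqv_def by (intro antisym) auto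
qed

lemma R_add: assumes "f \<in> H" "g \<in> H" shows "R (f + g) \<simeq> R f + R g"
proof -
  obtain h where h: "(R f, h) \<in> gen T" "of_real l \<cdot> R f - h \<simeq> f" using R assms by blast
  obtain h' where h': "(R g, h') \<in> gen T" "of_real l \<cdot> R g - h' \<simeq> g" using R assms by blast
  note H = gen_H[OF T h(1)] gen_H[OF T h'(1)]
  have "(R f + 1 \<cdot> R g, h + 1 \<cdot> h') \<in> gen T" by (rule gen_combination[OF T h(1) h'(1)])
  moreover have "of_real l \<cdot> (R f + 1 \<cdot> R g) - (h + 1 \<cdot> h') \<simeq> f + g"
    using H assms eqv_ip_left[OF h(2)] eqv_ip_left[OF h'(2)]
    by (intro eqvI) (auto simp: ip_simps algebra_simps)
  ultimately show ?thesis using R_unique[of "R f + 1 \<cdot> R g" "h + 1 \<cdot> h'" "f + g"] assms by simp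
qed

lemma R_diff_bound: assumes "f \<in> H" "g \<in> H" shows "nrm (R f - R g) \<le> nrm (f - g) / (l - s)"
proof -
  obtain h where h: "(R f, h) \<in> gen T" "of_real l \<cdot> R f - h \<simeq> f" using R assms by blast
  obtain h' where h': "(R g, h') \<in> gen T" "of_real l \<cdot> R g - h' \<simeq> g" using R assms by blast
  note H = gen_H[OF T h(1)] gen_H[OF T h'(1)]
  have d: "(R f + (-1) \<cdot> R g, h + (-1) \<cdot> h') \<in> gen T" by (rule gen_combination[OF T h(1) h'(1)])
  have "of_real l \<cdot> (R f + (-1) \<cdot> R g) - (h + (-1) \<cdot> h') \<simeq> f - g"
    using H assms eqv_ip_left[OF h(2)] eqv_ip_left[OF h'(2)]
    by (intro eqvI) (auto simp: ip_simps algebra_simps)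
  hence "nrm (of_real l \<cdot> (R f + (-1) \<cdot> R g) - (h + (-1) \<cdot> h')) = nrm (f - g)"
    using H assms by (intro eqv_nrm) auto
  thus ?thesis using gen_resolvent_bound[OF d] l \<beta> by (simp add: field_simps)
qed

section \<open>Neumann iteration and the inverse of l - (A + B)\<close>

text \<open>The partial sums of the Neumann series, produced as the fixed-point iteration of
  \<open>g \<mapsto> R (f + B g)\<close>. Convergence then rests on Lipschitz estimates, with no
  expansion into powers of \<open>R\<close> and \<open>B\<close>.\<close>

definition neumann :: "'v \<Rightarrow> nat \<Rightarrow> 'v" where
  "neumann f n = ((\<lambda>g. R (f + B g)) ^^ n) 0"

lemma neumann_simps [simp]: "neumann f 0 = 0" "neumann f (Suc n) = R (f + B (neumann f n))"
  by (simp_all add: neumann_def)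

lemma neumann_H [simp, intro]: "f \<in> H \<Longrightarrow> neumann f n \<in> H"
  by (induction n) auto

text \<open>The abstract counterpart of \<open>add_bounded\<close>.\<close>

definition pert :: "('v \<times> 'v) set" where
  "pert = {(f, g). f \<in> H \<and> g \<in> H \<and> (\<exists>a. (f, a) \<in> gen T \<and> g \<simeq> a + B f)}"

text \<open>The iteration contracts with ratio \<open>\<beta> / (l - s)\<close>, which is below 1
  because \<open>l\<close> exceeds \<open>s + \<beta>\<close>.\<close>

lemma neumann_limit:
  assumes f: "f \<in> H"
  shows "\<exists>k h. (k, h) \<in> pert \<and> of_real l \<cdot> k - h \<simeq> f \<and> lim_to (neumann f) k"
proof -
  define q where "q = \<beta> / (l - s)"
  have q: "0 \<le> q" "q < 1" using l \<beta> by (auto simp: q_def)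
  have step: "nrm (R (f + B g) - R (f + B g')) \<le> q * nrm (g - g')" if g: "g \<in> H" "g' \<in> H" for g g'
  proof -
    have "nrm (R (f + B g) - R (f + B g')) \<le> nrm ((f + B g) - (f + B g')) / (l - s)"
      using f g by (intro R_diff_bound) auto
    also have "nrm ((f + B g) - (f + B g')) = nrm (B (g - g'))"
      using f g sym_opD(5)[OF B_sym g] by (intro eqv_nrm) (auto intro: eqv_sym)
    also have "\<dots> / (l - s) \<le> \<beta> * nrm (g - g') / (l - s)"
      using B_bound[of "g - g'"] g l \<beta> by (intro divide_right_mono) auto
    finally show ?thesis by (simp add: q_def)
  qed
  have "nrm (neumann f (Suc n) - neumann f n) \<le> nrm (neumann f (Suc 0) - neumann f 0) * q ^ n" for n
  proof (induction n)
    case (Suc n)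
    have "nrm (neumann f (Suc (Suc n)) - neumann f (Suc n)) \<le> q * nrm (neumann f (Suc n) - neumann f n)"
      using step[of "neumann f (Suc n)" "neumann f n"] f by simp
    also have "\<dots> \<le> q * (nrm (neumann f (Suc 0) - neumann f 0) * q ^ n)"
      using Suc q by (intro mult_left_mono) auto
    finally show ?case by (simp only: power_Suc ac_simps)
  qed simp
  then obtain k where k: "k \<in> H" "lim_to (neumann f) k"
    using geometric_limit[of "neumann f" _ q] f q by (metis neumann_H)
  \<comment> \<open>The limit \<open>k\<close> is only equivalent to \<open>k'\<close>. It is
    \<open>k'\<close>, being a value of \<open>R\<close>, that comes with a pair in the
    generator.\<close>
  define k' where "k' = R (f + B k)"
  have k'H: "k' \<in> H" using f k by (auto simp: k'_def)
  have lim': "lim_to (\<lambda>n. neumann f (Suc n)) k'"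
    unfolding lim_to_def
  proof (rule Lim_null_comparison)
    show "(\<lambda>n. q * nrm (neumann f n - k)) \<longlonglongrightarrow> 0"
      using k(2) unfolding lim_to_def by (rule tendsto_mult_right_zero)
    show "\<forall>\<^sub>F n in sequentially. norm (nrm (neumann f (Suc n) - k')) \<le> q * nrm (neumann f n - k)"
      using step f k k'H by (intro always_eventually) (auto simp: k'_def)
  qed
  have "lim_to (\<lambda>n. neumann f (Suc n)) k" using k(2) unfolding lim_to_def by (rule LIMSEQ_Suc)
  hence kk: "k \<simeq> k'" using lim' f k k'H by (intro lim_to_unique[of "\<lambda>n. neumann f (Suc n)"]) auto
  obtain h where h: "(k', h) \<in> gen T" "of_real l \<cdot> k' - h \<simeq> f + B k" using R[of "f + B k"] f k by (auto simp: k'_def)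
  note H = gen_H[OF T h(1)]
  have "B k \<simeq> B k'" using sym_opD(3)[OF B_sym k(1) k'H kk] .
  have "(k', h + B k') \<in> pert" using H h by (auto simp: pert_def)
  moreover have "of_real l \<cdot> k' - (h + B k') \<simeq> f"
  proof (rule eqvI)
    fix y assume y: "y \<in> H"
    show "ip (of_real l \<cdot> k' - (h + B k')) y = ip f y"
      using eqv_ip_left[OF h(2), of y] eqv_ip_left[OF \<open>B k \<simeq> B k'\<close>, of y] H f k y
      by (simp add: ip_simps algebra_simps)
  qed (use H f in auto)
  moreover have "lim_to (neumann f) k'" using lim' unfolding lim_to_def by (rule LIMSEQ_imp_Suc)
  ultimately show ?thesis by blast
qed

text \<open>Convergence of the iterates is made part of the choice, so that order relations valid
  for all iterates pass to \<open>K f\<close>.\<close>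

definition K :: "'v \<Rightarrow> 'v" where
  "K f = (SOME k. \<exists>h. (k, h) \<in> pert \<and> of_real l \<cdot> k - h \<simeq> f \<and> lim_to (neumann f) k)"

lemma K: assumes "f \<in> H"
  obtains h where "(K f, h) \<in> pert" "of_real l \<cdot> K f - h \<simeq> f" "lim_to (neumann f) (K f)"
  using someI_ex[OF neumann_limit[OF assms]] unfolding K_def by blast

lemma pert_H: "(f, g) \<in> pert \<Longrightarrow> f \<in> H \<and> g \<in> H"
  by (auto simp: pert_def)

lemma K_H [simp, intro]: "f \<in> H \<Longrightarrow> K f \<in> H"
  using K pert_H by metis

lemma pert_form: assumes "(f, g) \<in> pert" shows "(l - s - \<beta>) * (nrm f)\<^sup>2 \<le> Re (ip (of_real l \<cdot> f - g) f)"
proof -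
  obtain a where a: "(f, a) \<in> gen T" "g \<simeq> a + B f" using assms by (auto simp: pert_def)
  note H = gen_H[OF T a(1)] pert_H[OF assms]
  have "Re (ip g f) = Re (ip a f) + Re (ip (B f) f)"
    using eqv_ip_left[OF a(2), of f] H by (simp add: ip_simps)
  also have "Re (ip (B f) f) \<le> nrm (B f) * nrm f" using H by (intro Re_ip_le) auto
  also have "nrm (B f) * nrm f \<le> \<beta> * nrm f * nrm f" using H B_bound by (intro mult_right_mono) auto
  finally have "Re (ip g f) \<le> s * (nrm f)\<^sup>2 + \<beta> * (nrm f)\<^sup>2"
    using T_form[OF a(1)] by (simp add: power2_eq_square)
  thus ?thesis using H by (simp add: ip_simps nrm_sq algebra_simps)
qed

lemma pert_sym: assumes "(f, g) \<in> pert" "(f', g') \<in> pert" shows "ip g f' = ip f g'"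
proof -
  obtain a where a: "(f, a) \<in> gen T" "g \<simeq> a + B f" using assms by (auto simp: pert_def)
  obtain a' where a': "(f', a') \<in> gen T" "g' \<simeq> a' + B f'" using assms by (auto simp: pert_def)
  note H = gen_H[OF T a(1)] gen_H[OF T a'(1)] pert_H[OF assms(1)] pert_H[OF assms(2)]
  have "ip g f' = ip a f' + ip (B f) f'" using eqv_ip_left[OF a(2), of f'] H by (simp add: ip_simps)
  also have "\<dots> = ip f a' + ip f (B f')"
    using gen_sym[OF T T_sym a(1) a'(1)] sym_opD(2)[OF B_sym] H by simp
  also have "\<dots> = ip f g'" using eqv_ip_right[OF a'(2), of f] H by (simp add: ip_simps)
  finally show ?thesis .
qed

lemma pert_diff: assumes "(f, g) \<in> pert" "(f', g') \<in> pert" shows "(f - f', g - g') \<in> pert"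
proof -
  obtain a where a: "(f, a) \<in> gen T" "g \<simeq> a + B f" using assms by (auto simp: pert_def)
  obtain a' where a': "(f', a') \<in> gen T" "g' \<simeq> a' + B f'" using assms by (auto simp: pert_def)
  note H = gen_H[OF T a(1)] gen_H[OF T a'(1)] pert_H[OF assms(1)] pert_H[OF assms(2)]
  have "(f - f', a - a') \<in> gen T" using gen_combination[OF T a(1) a'(1), of "-1"] by simp
  moreover have "g - g' \<simeq> (a - a') + B (f - f')"
    using eqv_ip_left[OF a(2)] eqv_ip_left[OF a'(2)] H
      eqv_ip_left[OF sym_opD(5)[OF B_sym, of f f']] by (intro eqvI) (auto simp: ip_simps)
  ultimately show ?thesis using H by (auto simp: pert_def)
qed

lemma pert_eqv:
  assumes fg: "(f, g) \<in> pert" and e: "f \<simeq> f'" "g \<simeq> g'" "f' \<in> H" "g' \<in> H"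
  shows "(f', g') \<in> pert"
proof -
  obtain a where a: "(f, a) \<in> gen T" "g \<simeq> a + B f" using fg by (auto simp: pert_def)
  note H = gen_H[OF T a(1)] pert_H[OF fg]
  have "(f', a) \<in> gen T" using gen_eqv[OF T a(1) e(1) eqv_refl] e H by simp
  moreover have "g' \<simeq> a + B f'"
    using eqv_ip_left[OF a(2)] eqv_ip_left[OF e(2)] eqv_ip_left[OF sym_opD(3)[OF B_sym _ _ e(1)]] H e
    by (intro eqvI) (auto simp: ip_simps)
  ultimately show ?thesis using e by (auto simp: pert_def)
qed

lemma K_unique:
  assumes g: "(g, h) \<in> pert" "of_real l \<cdot> g - h \<simeq> f" and f: "f \<in> H"
  shows "g \<simeq> K f"
proof -
  obtain h' where h': "(K f, h') \<in> pert" "of_real l \<cdot> K f - h' \<simeq> f" using K[OF f] by blast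
  note H = pert_H[OF g(1)] pert_H[OF h'(1)]
  have "ip (of_real l \<cdot> (g - K f) - (h - h')) y = 0" if y: "y \<in> H" for y
    using eqv_ip_left[OF g(2), of y] eqv_ip_left[OF h'(2), of y] H f y
    by (simp add: ip_simps algebra_simps)
  from this[of "g - K f"]
  have "(l - s - \<beta>) * (nrm (g - K f))\<^sup>2 \<le> 0" using pert_form[OF pert_diff[OF g(1) h'(1)]] H by simp
  thus ?thesis using l by (simp add: eqv_def mult_le_0_iff)
qed

text \<open>The graph of A + B is recovered from \<open>K\<close> alone. From here on the semigroup
  can be studied through the eigenvectors of \<open>K\<close>, without reference to A and B.\<close>

lemma pert_iff: "(f, g) \<in> pert \<longleftrightarrow> f \<in> H \<and> g \<in> H \<and> f \<simeq> K (of_real l \<cdot> f - g)"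
proof
  assume "(f, g) \<in> pert"
  thus "f \<in> H \<and> g \<in> H \<and> f \<simeq> K (of_real l \<cdot> f - g)"
    using K_unique[of f g "of_real l \<cdot> f - g"] pert_H[of f g] by auto
next
  assume fg: "f \<in> H \<and> g \<in> H \<and> f \<simeq> K (of_real l \<cdot> f - g)"
  define k where "k = K (of_real l \<cdot> f - g)"
  have "of_real l \<cdot> f - g \<in> H" using fg by auto
  then obtain h where h: "(k, h) \<in> pert" "of_real l \<cdot> k - h \<simeq> of_real l \<cdot> f - g" using K unfolding k_def by blast
  note H = pert_H[OF h(1)]
  have fk: "f \<simeq> k" using fg by (simp add: k_def)
  have "h \<simeq> g"
  proof (rule eqvI)
    fix y assume y: "y \<in> H"
    show "ip h y = ip g y" using eqv_ip_left[OF h(2), of y] eqv_ip_left[OF fk, of y] H fg y by (simp add: ip_simps)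
  qed (use H fg in auto)
  thus "(f, g) \<in> pert" using pert_eqv[OF h(1) eqv_sym[OF fk]] H fg by auto
qed

lemma K_sym: "sym_op K"
proof -
  have "ip (K f) g = ip f (K g)" if f: "f \<in> H" "g \<in> H" for f g
  proof -
    obtain h where h: "(K f, h) \<in> pert" "of_real l \<cdot> K f - h \<simeq> f" using K f by blast
    obtain h' where h': "(K g, h') \<in> pert" "of_real l \<cdot> K g - h' \<simeq> g" using K f by blast
    note H = pert_H[OF h(1)] pert_H[OF h'(1)]
    have "ip (K f) g = ip (K f) (of_real l \<cdot> K g - h')" using H f by (intro eqv_ip_right[OF eqv_sym[OF h'(2)]]) auto
    also have "\<dots> = ip (of_real l \<cdot> K f - h) (K g)" using pert_sym[OF h(1) h'(1)] H by (simp add: ip_simps)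
    also have "\<dots> = ip f (K g)" using h(2) H f by (intro eqv_ip_left) auto
    finally show ?thesis .
  qed
  thus ?thesis by (auto simp: sym_op_def)
qed

lemma K_psd: assumes f: "f \<in> H" shows "(l - s - \<beta>) * (nrm (K f))\<^sup>2 \<le> Re (ip (K f) f)"
proof -
  obtain h where h: "(K f, h) \<in> pert" "of_real l \<cdot> K f - h \<simeq> f" using K f by blast
  have "ip (of_real l \<cdot> K f - h) (K f) = ip f (K f)" using h pert_H[OF h(1)] f by (intro eqv_ip_left) auto
  thus ?thesis using pert_form[OF h(1)] f by (simp add: Re_ip_commute)
qed

text \<open>If \<open>K f\<close> is null, then A and \<open>B\<close> send it to null vectors, by
  \<open>gen_zero\<close> and \<open>B_bound\<close>; so l - (A + B), which recovers
  \<open>f\<close>, yields a null vector too.\<close>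

lemma K_inj: assumes f: "f \<in> H" and 0: "nrm (K f) = 0" shows "nrm f = 0"
proof -
  obtain h where h: "(K f, h) \<in> pert" "of_real l \<cdot> K f - h \<simeq> f" using K f by blast
  obtain a where a: "(K f, a) \<in> gen T" "h \<simeq> a + B (K f)" using h by (auto simp: pert_def)
  note H = gen_H[OF T a(1)] pert_H[OF h(1)]
  have a0: "nrm a = 0" by (rule gen_zero[OF T a(1) 0])
  have "nrm (B (K f)) \<le> 0" using B_bound[of "K f"] H 0 by simp
  hence B0: "nrm (B (K f)) = 0" using H by (intro antisym) auto
  have z: "ip x y = 0" if "nrm x = 0" "x \<in> H" "y \<in> H" for x y using norm_ip_le[of x y] that by simp
  have "ip f y = 0" if "y \<in> H" for y
    using eqv_ip_left[OF h(2) _ f that] eqv_ip_left[OF a(2) _ _ that] H that z[OF a0] z[OF B0] z[OF 0] f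
    by (simp add: ip_simps)
  thus ?thesis using f by (simp add: nrm_def)
qed

end

section \<open>Semigroups generated by l - K^-1\<close>

context compact_psd
begin

text \<open>The eigenvalues of \<open>l - K\<^sup>-\<^sup>1\<close>; the value in the case \<open>eigvec n = 0\<close> is arbitrary.\<close>

definition log_eig :: "real \<Rightarrow> nat \<Rightarrow> real" where
  "log_eig l n = (if eigvec n = 0 then l - 1 / eigval 0 - 1 else l - 1 / eigval n)"

lemma log_eig_antimono:
  assumes "m \<le> n" "eigvec n \<noteq> 0" shows "log_eig l n \<le> log_eig l m"
  using eigval_antimono[OF assms] eigval_pos[of n] assms
  by (simp add: log_eig_def) (simp add: frac_le)

lemma log_eig_le: "eigvec n \<noteq> 0 \<Longrightarrow> log_eig l n \<le> log_eig l 0"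
  by (rule log_eig_antimono) auto

text \<open>The graph of l - K^-1, written without inverting \<open>K\<close>.\<close>

definition res_graph :: "real \<Rightarrow> ('v \<times> 'v) set" where
  "res_graph l = {(f, g). f \<in> H \<and> g \<in> H \<and> f \<simeq> K (of_real l \<cdot> f - g)}"

lemma ip_K_eigvec: "f \<in> H \<Longrightarrow> ip (K f) (eigvec n) = of_real (eigval n) * ip f (eigvec n)"
  using eqv_ip_right[OF eigvec_eq[of n], of f] by (simp add: K_ip ip_scl_right)

lemma res_graph_iff:
  assumes f: "f \<in> H" "g \<in> H"
  shows "(f, g) \<in> res_graph l \<longleftrightarrow> (\<forall>n. ip g (eigvec n) = of_real (log_eig l n) * ip f (eigvec n))"
proof -
  have 1: "ip f (eigvec n) = ip (K (of_real l \<cdot> f - g)) (eigvec n) \<longleftrightarrow>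
      ip g (eigvec n) = of_real (log_eig l n) * ip f (eigvec n)" for n
  proof (cases "eigvec n = 0")
    case False
    hence "eigval n \<noteq> 0" using eigval_pos[of n] by simp
    thus ?thesis using False f by (auto simp: ip_K_eigvec ip_simps log_eig_def field_simps)
  qed (use f in simp)
  have "f \<simeq> K (of_real l \<cdot> f - g) \<longleftrightarrow> (\<forall>n. ip f (eigvec n) = ip (K (of_real l \<cdot> f - g)) (eigvec n))"
    using f by (auto intro: eqv_coef eqv_ip_left)
  thus ?thesis using f 1 by (simp add: res_graph_def)
qed

lemma gen_exp_op: "gen (exp_op (log_eig l)) = res_graph l"
proof -
  have "(f, g) \<in> gen (exp_op (log_eig l)) \<longleftrightarrow> (f, g) \<in> res_graph l" for f g
  proof (cases "f \<in> H \<and> g \<in> H")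
    case True
    thus ?thesis using exp_op_generator_iff[of "log_eig l" "log_eig l 0" f g] log_eig_le
      by (simp add: gen_def res_graph_iff)
  qed (auto simp: gen_def res_graph_def)
  thus ?thesis by auto
qed

lemma c0_sg_exp_op: "c0_sg (exp_op (log_eig l))"
proof -
  have "bdd_op (exp_op (log_eig l) t)" if "t \<ge> 0" for t
    unfolding exp_op_def using mult_op_bdd[OF exp_bounded_mult[of "log_eig l" "log_eig l 0"]] log_eig_le that by auto
  thus ?thesis unfolding c0_sg_def
    using exp_op_0[of "log_eig l" "log_eig l 0"] exp_op_add[of "log_eig l" "log_eig l 0"]
      exp_op_cont[of "log_eig l" "log_eig l 0"] log_eig_le by auto
qed

lemma semigroup_coef:
  assumes S: "c0_sg S" "gen S = res_graph l" and t: "t \<ge> 0" and f: "f \<in> H"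
  shows "ip (S t f) (eigvec n) = of_real (exp (t * log_eig l n)) * ip f (eigvec n)"
proof (cases "eigvec n = 0")
  case False
  let ?e = eigvec and ?a = "\<lambda>m. exp (t * log_eig l m)"
  define P where "P N = (\<Sum>m<N. ip f (?e m) \<cdot> ?e m)" for N
  have PH: "P N \<in> H" for N by (auto simp: P_def)
  have St: "bdd_op (S t)" using sg_bdd[OF S(1) t] .
  have SH: "g \<in> H \<Longrightarrow> S t g \<in> H" for g using bdd_opD(1)[OF St] .
  have Se: "S t (?e m) \<simeq> of_real (?a m) \<cdot> ?e m" for m
  proof (rule sg_eigenvector[OF S(1) _ t])
    have "ip (of_real (log_eig l m) \<cdot> ?e m) (?e k) = of_real (log_eig l k) * ip (?e m) (?e k)" for k
      by (cases "k = m") (auto simp: ip_scl_left eigvec_orth)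
    thus "(?e m, of_real (log_eig l m) \<cdot> ?e m) \<in> gen S" unfolding S(2) by (subst res_graph_iff) auto
  qed
  have SP: "ip (S t (P N)) (?e n) = of_real (?a n) * ip f (?e n)" if N: "n < N" for N
  proof -
    have "ip (S t (P N)) (?e n) = ip (\<Sum>m<N. ip f (?e m) \<cdot> S t (?e m)) (?e n)"
      unfolding P_def by (intro eqv_ip_left bdd_op_sum[OF St] SH) (auto intro: SH)
    also have "\<dots> = (\<Sum>m<N. ip f (?e m) * ip (S t (?e m)) (?e n))"
      by (subst ip_sum_left) (auto simp: ip_scl_left SH)
    also have "\<dots> = (\<Sum>m<N. ip f (?e m) * ip (of_real (?a m) \<cdot> ?e m) (?e n))"
    proof (rule sum.cong)
      fix m
      show "ip f (?e m) * ip (S t (?e m)) (?e n) = ip f (?e m) * ip (of_real (?a m) \<cdot> ?e m) (?e n)"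
        using eqv_ip_left[OF Se SH, of m "?e n"] by simp
    qed simp
    also have "\<dots> = (\<Sum>m<N. if m = n then ip f (?e n) * of_real (?a n) else 0)"
      using False eigvec_norm[of n] by (intro sum.cong) (auto simp: ip_scl_left eigvec_orth ip_self)
    also have "\<dots> = of_real (?a n) * ip f (?e n)" using N by simp
    finally show ?thesis .
  qed
  have "lim_to (\<lambda>N. S t (P N)) (S t f)"
  proof -
    obtain C where C: "\<And>g. g \<in> H \<Longrightarrow> nrm (S t g) \<le> C * nrm g" using bdd_op_bound[OF St] by blast
    have "nrm (S t (P N) - S t f) \<le> C * nrm (P N - f)" for N
    proof -
      have "nrm (S t (P N) - S t f) = nrm (S t (P N - f))"
        using eqv_nrm[OF bdd_opD(5)[OF St PH f, of N]] PH f SH by simp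
      thus ?thesis using C[of "P N - f"] PH f by simp
    qed
    hence "\<forall>\<^sub>F N in sequentially. norm (nrm (S t (P N) - S t f)) \<le> C * nrm (P N - f)"
      using PH f SH by simp
    moreover have "(\<lambda>N. C * nrm (P N - f)) \<longlonglongrightarrow> 0"
      using expansion[OF f] unfolding lim_to_def P_def by (rule tendsto_mult_right_zero)
    ultimately show ?thesis unfolding lim_to_def by (rule Lim_null_comparison)
  qed
  hence "(\<lambda>N. ip (S t (P N)) (?e n)) \<longlonglongrightarrow> ip (S t f) (?e n)"
    by (rule lim_to_ip) (use PH f SH in auto)
  moreover have "\<forall>\<^sub>F N in sequentially. ip (S t (P N)) (?e n) = of_real (?a n) * ip f (?e n)"
    using eventually_gt_at_top[of n] by eventually_elim (rule SP)
  ultimately show ?thesis by (rule LIMSEQ_unique[OF _ tendsto_eventually])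
next
  case True
  thus ?thesis using bdd_opD(1)[OF sg_bdd[OF S(1) t] f] f by (simp only: ip_zero_right mult_zero_right)
qed

end

section \<open>The space of square integrable functions\<close>

definition cscale :: "complex \<Rightarrow> 'a cfun \<Rightarrow> 'a cfun" where
  "cscale c f = (\<lambda>x. c * f x)"

lemma cscale_apply [simp]: "cscale c f x = c * f x"
  by (simp add: cscale_def)

lemma sum_fun_apply [simp]: "(\<Sum>i\<in>I. f i) x = (\<Sum>i\<in>I. f i x :: complex)"
  by (induction I rule: infinite_finite_induct) auto

lemma L2_measurable [measurable_dest]: "f \<in> L2 M \<Longrightarrow> f \<in> borel_measurable M"
  by (simp add: L2_def)

lemma L2_integrable: "f \<in> L2 M \<Longrightarrow> integrable M (\<lambda>x. (cmod (f x))\<^sup>2)"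
  by (simp add: L2_def)

lemma L2_bound:
  assumes "g \<in> L2 M" "f \<in> borel_measurable M" "AE x in M. cmod (f x) \<le> c * cmod (g x)"
  shows "f \<in> L2 M"
proof -
  have [measurable]: "f \<in> borel_measurable M" "g \<in> borel_measurable M" using assms L2_measurable by auto
  have "integrable M (\<lambda>x. (cmod (f x))\<^sup>2)"
  proof (rule Bochner_Integration.integrable_bound)
    show "integrable M (\<lambda>x. c\<^sup>2 * (cmod (g x))\<^sup>2)" using L2_integrable[OF assms(1)] by simp
    show "AE x in M. norm ((cmod (f x))\<^sup>2) \<le> norm (c\<^sup>2 * (cmod (g x))\<^sup>2)"
      using assms(3)
    proof eventually_elim
      case (elim x)
      have "(cmod (f x))\<^sup>2 \<le> (c * cmod (g x))\<^sup>2" using elim by (intro power_mono) auto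
      thus ?case by (simp add: power_mult_distrib)
    qed
  qed measurable
  thus ?thesis using assms by (simp add: L2_def)
qed

lemma L2_add: assumes "f \<in> L2 M" "g \<in> L2 M" shows "f + g \<in> L2 M"
proof -
  have [measurable]: "f \<in> borel_measurable M" "g \<in> borel_measurable M" using assms L2_measurable by auto
  have "integrable M (\<lambda>x. (cmod (f x + g x))\<^sup>2)"
  proof (rule Bochner_Integration.integrable_bound)
    show "integrable M (\<lambda>x. 2 * (cmod (f x))\<^sup>2 + 2 * (cmod (g x))\<^sup>2)"
      using L2_integrable assms by (intro Bochner_Integration.integrable_add integrable_mult_right) auto
    have "(cmod (a + b))\<^sup>2 \<le> 2 * (cmod a)\<^sup>2 + 2 * (cmod b)\<^sup>2" for a b
    proof -
      have "(cmod (a + b))\<^sup>2 \<le> (cmod a + cmod b)\<^sup>2" by (intro power_mono norm_triangle_ineq) auto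
      also have "\<dots> \<le> 2 * (cmod a)\<^sup>2 + 2 * (cmod b)\<^sup>2"
        using zero_le_power2[of "cmod a - cmod b"] by (simp add: power2_sum power2_diff)
      finally show ?thesis .
    qed
    thus "AE x in M. norm ((cmod (f x + g x))\<^sup>2) \<le> norm (2 * (cmod (f x))\<^sup>2 + 2 * (cmod (g x))\<^sup>2)" by simp
  qed measurable
  thus ?thesis by (simp add: L2_def plus_fun_def)
qed

lemma L2_cscale: assumes "f \<in> L2 M" shows "cscale c f \<in> L2 M"
proof (rule L2_bound[OF assms])
  show "cscale c f \<in> borel_measurable M" using L2_measurable[OF assms] by (simp add: cscale_def)
qed (auto simp: norm_mult)

lemma L2_zero: "0 \<in> L2 M"
  by (simp add: L2_def zero_fun_def)

lemma L2_inner_integrable: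
  assumes "f \<in> L2 M" "g \<in> L2 M" shows "integrable M (\<lambda>x. f x * cnj (g x))"
proof (rule Bochner_Integration.integrable_bound)
  have [measurable]: "f \<in> borel_measurable M" "g \<in> borel_measurable M" using assms L2_measurable by auto
  show "integrable M (\<lambda>x. (cmod (f x))\<^sup>2 + (cmod (g x))\<^sup>2)"
    using L2_integrable assms by (intro Bochner_Integration.integrable_add) auto
  have [measurable]: "(\<lambda>x. cnj (g x)) \<in> borel_measurable M"
    by (rule measurable_compose[OF _ borel_measurable_continuous_onI[OF continuous_on_cnj]])
      (auto intro: continuous_on_id)
  show "(\<lambda>x. f x * cnj (g x)) \<in> borel_measurable M" by measurable
  have "cmod a * cmod b \<le> (cmod a)\<^sup>2 + (cmod b)\<^sup>2" for a b
  proof -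
    have "0 \<le> cmod a * cmod b" by simp
    moreover have "2 * (cmod a * cmod b) \<le> (cmod a)\<^sup>2 + (cmod b)\<^sup>2"
      using zero_le_power2[of "cmod a - cmod b"] by (simp add: power2_diff)
    ultimately show ?thesis by linarith
  qed
  thus "AE x in M. norm (f x * cnj (g x)) \<le> norm ((cmod (f x))\<^sup>2 + (cmod (g x))\<^sup>2)"
    by (simp add: norm_mult)
qed

lemma l2_inner_self: "l2_inner M f f = complex_of_real (\<integral>x. (cmod (f x))\<^sup>2 \<partial>M)"
proof -
  have "l2_inner M f f = (\<integral>x. complex_of_real ((cmod (f x))\<^sup>2) \<partial>M)"
    unfolding l2_inner_def by (simp only: complex_norm_square)
  thus ?thesis by (simp only: integral_complex_of_real)
qed

lemma l2_norm_conv: "l2_norm M f = sqrt (Re (l2_inner M f f))"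
  by (simp add: l2_inner_self l2_norm_def)

lemma l2_norm_power2: "(l2_norm M f)\<^sup>2 = (\<integral>x. (cmod (f x))\<^sup>2 \<partial>M)"
  by (simp add: l2_norm_def)

lemma nn_integral_L2:
  assumes "f \<in> L2 M" shows "(\<integral>\<^sup>+x. ennreal ((cmod (f x))\<^sup>2) \<partial>M) = ennreal ((l2_norm M f)\<^sup>2)"
  unfolding l2_norm_power2 by (rule nn_integral_eq_integral) (use L2_integrable assms in auto)

lemma L2_diff: "f \<in> L2 M \<Longrightarrow> g \<in> L2 M \<Longrightarrow> f - g \<in> L2 M"
proof -
  assume a: "f \<in> L2 M" "g \<in> L2 M"
  have "f - g = f + cscale (-1) g" by (auto simp: fun_eq_iff)
  thus "f - g \<in> L2 M" using L2_add[OF a(1) L2_cscale[OF a(2)], of "-1"] by (simp only:)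
qed

text \<open>Along a subsequence with increments \<open>d k\<close> of norm at most 2^-k, the
  weighted sum of 2^k |d k|^2 is integrable, hence finite almost everywhere. Pointwise the
  increments are then dominated by a geometric series with ratio \<open>sqrt (1/2)\<close>. Fatou's
  lemma, for fixed \<open>n\<close>, transfers the Cauchy bound to \<open>X n - l\<close>.\<close>

lemma L2_complete:
  assumes X: "\<And>n. X n \<in> L2 M"
    and cau: "\<And>e. e > 0 \<Longrightarrow> \<exists>N::nat. \<forall>m\<ge>N. \<forall>n\<ge>N. l2_norm M (X m - X n) < e"
  shows "\<exists>l\<in>L2 M. (\<lambda>n. l2_norm M (X n - l)) \<longlonglongrightarrow> 0"
proof -
  have [measurable]: "X n \<in> borel_measurable M" for n using X L2_measurable by auto
  have "\<forall>k. \<exists>N. \<forall>m\<ge>N. \<forall>n\<ge>N. l2_norm M (X m - X n) < (1/2) ^ k" using cau by simp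
  then obtain N where N: "\<And>k m n. m \<ge> N k \<Longrightarrow> n \<ge> N k \<Longrightarrow> l2_norm M (X m - X n) < (1/2) ^ k" by metis
  \<comment> \<open>The sum secures \<open>r k \<ge> N k\<close> and
    \<open>r (Suc k) \<ge> N k\<close>; the summand \<open>k\<close> makes the indices tend to
    infinity.\<close>
  define r where "r k = (\<Sum>i\<le>k. N i) + k" for k
  have rN: "r k \<ge> N k" "r (Suc k) \<ge> N k" "r k \<ge> k" for k
  proof -
    have "N k \<le> (\<Sum>i\<le>k. N i)" by (rule member_le_sum) auto
    thus "r k \<ge> N k" "r (Suc k) \<ge> N k" "r k \<ge> k" by (auto simp: r_def)
  qed
  define d where "d k x = X (r (Suc k)) x - X (r k) x" for k x
  have dm [measurable]: "d k \<in> borel_measurable M" for k unfolding d_def by measurable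
  have dL: "d k = X (r (Suc k)) - X (r k)" for k by (auto simp: d_def fun_eq_iff)
  have dn: "(\<integral>\<^sup>+x. ennreal ((cmod (d k x))\<^sup>2) \<partial>M) \<le> ennreal ((1/4) ^ k)" for k
  proof -
    have "l2_norm M (d k) \<le> (1/2) ^ k" using N[OF rN(2,1), of k] by (simp add: dL)
    hence "(l2_norm M (d k))\<^sup>2 \<le> ((1/2) ^ k)\<^sup>2" by (intro power_mono) (auto simp: l2_norm_def)
    also have "((1/2) ^ k)\<^sup>2 = ((1/4) ^ k :: real)" by (simp add: power2_eq_square flip: power_mult_distrib)
    finally show ?thesis using nn_integral_L2[of "d k" M] L2_diff[OF X X] by (simp add: dL ennreal_leI)
  qed
  have "(\<integral>\<^sup>+x. (\<Sum>k. ennreal (2 ^ k) * ennreal ((cmod (d k x))\<^sup>2)) \<partial>M)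
      = (\<Sum>k. \<integral>\<^sup>+x. ennreal (2 ^ k) * ennreal ((cmod (d k x))\<^sup>2) \<partial>M)"
    by (rule nn_integral_suminf) measurable
  also have "\<dots> \<le> (\<Sum>k. ennreal ((1/2) ^ k))"
  proof (intro suminf_le)
    fix k
    have "(\<integral>\<^sup>+x. ennreal (2 ^ k) * ennreal ((cmod (d k x))\<^sup>2) \<partial>M)
        = ennreal (2 ^ k) * (\<integral>\<^sup>+x. ennreal ((cmod (d k x))\<^sup>2) \<partial>M)" by (rule nn_integral_cmult) measurable
    also have "\<dots> \<le> ennreal (2 ^ k) * ennreal ((1/4) ^ k)" using dn by (intro mult_left_mono) auto
    also have "\<dots> = ennreal (2 ^ k * (1/4) ^ k)" by (simp add: ennreal_mult)
    also have "2 ^ k * (1/4) ^ k = (1/2 :: real) ^ k" by (simp flip: power_mult_distrib)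
    finally show "(\<integral>\<^sup>+x. ennreal (2 ^ k) * ennreal ((cmod (d k x))\<^sup>2) \<partial>M) \<le> ennreal ((1/2) ^ k)" .
  qed auto
  also have "\<dots> = ennreal (\<Sum>k. (1/2) ^ k)" by (rule suminf_ennreal2) auto
  also have "\<dots> < \<infinity>" by simp
  finally have "AE x in M. (\<Sum>k. ennreal (2 ^ k) * ennreal ((cmod (d k x))\<^sup>2)) \<noteq> \<infinity>"
    by (intro nn_integral_noteq_infinite) auto
  hence conv: "AE x in M. convergent (\<lambda>k. X (r k) x)"
  proof eventually_elim
    case (elim x)
    then obtain C where C: "C \<ge> 0" "(\<Sum>k. ennreal (2 ^ k) * ennreal ((cmod (d k x))\<^sup>2)) = ennreal C"
      by (cases "\<Sum>k. ennreal (2 ^ k) * ennreal ((cmod (d k x))\<^sup>2)") auto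
    have le: "cmod (d k x) \<le> sqrt C * sqrt (1/2) ^ k" for k
    proof -
      have "(\<Sum>i\<in>{k}. ennreal (2 ^ i) * ennreal ((cmod (d i x))\<^sup>2)) \<le> ennreal C"
        unfolding C(2)[symmetric] by (rule sum_le_suminf) auto
      hence "2 ^ k * (cmod (d k x))\<^sup>2 \<le> C" using C(1) by (simp flip: ennreal_mult)
      hence "(cmod (d k x))\<^sup>2 \<le> C * (1/2) ^ k" by (simp add: field_simps)
      hence "sqrt ((cmod (d k x))\<^sup>2) \<le> sqrt (C * (1/2) ^ k)" by (rule real_sqrt_le_mono)
      thus ?thesis by (simp add: real_sqrt_mult real_sqrt_power)
    qed
    have "summable (\<lambda>k. sqrt C * sqrt (1/2) ^ k)"
      by (intro summable_mult summable_geometric) (simp add: real_sqrt_divide)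
    hence "summable (\<lambda>k. d k x)" by (rule summable_comparison_test'[where N = 0]) (use le in auto)
    hence "convergent (\<lambda>n. \<Sum>k<n. d k x)" by (simp add: summable_iff_convergent)
    moreover have "(\<Sum>k<n. d k x) = X (r n) x - X (r 0) x" for n
      unfolding d_def by (rule sum_lessThan_telescope)
    ultimately have "convergent (\<lambda>n. (X (r n) x - X (r 0) x) + X (r 0) x)"
      by (intro convergent_add) (auto simp: convergent_const)
    thus ?case by simp
  qed
  \<comment> \<open>Where the subsequence diverges \<open>lim\<close> has an unspecified value, but
    by \<open>conv\<close> this happens only on a null set.\<close>
  define l where "l x = lim (\<lambda>k. X (r k) x)" for x
  have lm [measurable]: "l \<in> borel_measurable M" unfolding l_def by measurable
  have fatou: "(\<integral>\<^sup>+x. ennreal ((cmod (X n x - l x))\<^sup>2) \<partial>M) \<le> ennreal (e\<^sup>2)"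
    if e: "e > 0" and n: "\<And>m. m \<ge> N0 \<Longrightarrow> l2_norm M (X n - X m) < e" for n e N0
  proof -
    have "(\<integral>\<^sup>+x. ennreal ((cmod (X n x - l x))\<^sup>2) \<partial>M)
        = (\<integral>\<^sup>+x. liminf (\<lambda>k. ennreal ((cmod (X n x - X (r k) x))\<^sup>2)) \<partial>M)"
    proof (rule nn_integral_cong_AE)
      show "AE x in M. ennreal ((cmod (X n x - l x))\<^sup>2) = liminf (\<lambda>k. ennreal ((cmod (X n x - X (r k) x))\<^sup>2))"
        using conv
      proof eventually_elim
        case (elim x)
        hence "(\<lambda>k. X (r k) x) \<longlonglongrightarrow> l x" by (simp add: l_def convergent_LIMSEQ_iff)
        hence "(\<lambda>k. ennreal ((cmod (X n x - X (r k) x))\<^sup>2)) \<longlonglongrightarrow> ennreal ((cmod (X n x - l x))\<^sup>2)"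
          by (intro tendsto_intros)
        thus ?case by (rule lim_imp_Liminf[symmetric, rotated]) simp
      qed
    qed
    also have "\<dots> \<le> liminf (\<lambda>k. \<integral>\<^sup>+x. ennreal ((cmod (X n x - X (r k) x))\<^sup>2) \<partial>M)"
      by (rule nn_integral_liminf) measurable
    also have "\<dots> \<le> liminf (\<lambda>k. ennreal (e\<^sup>2))"
    proof (rule Liminf_mono)
      show "\<forall>\<^sub>F k in sequentially. (\<integral>\<^sup>+x. ennreal ((cmod (X n x - X (r k) x))\<^sup>2) \<partial>M) \<le> ennreal (e\<^sup>2)"
        using eventually_ge_at_top[of N0]
      proof eventually_elim
        case (elim k)
        have "l2_norm M (X n - X (r k)) < e" using n[of "r k"] rN(3)[of k] elim by simp
        hence "(l2_norm M (X n - X (r k)))\<^sup>2 \<le> e\<^sup>2" by (intro power_mono) (auto simp: l2_norm_def)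
        thus ?case using nn_integral_L2[OF L2_diff[OF X X], of n "r k"] by (simp add: ennreal_leI)
      qed
    qed
    also have "\<dots> = ennreal (e\<^sup>2)" by (simp add: Liminf_const)
    finally show ?thesis .
  qed
  have L2d: "X n - l \<in> L2 M \<and> l2_norm M (X n - l) \<le> e"
    if e: "e > 0" and n: "\<And>m. m \<ge> N0 \<Longrightarrow> l2_norm M (X n - X m) < e" for n e N0
  proof -
    have f: "(\<integral>\<^sup>+x. ennreal ((cmod (X n x - l x))\<^sup>2) \<partial>M) \<le> ennreal (e\<^sup>2)" by (rule fatou[OF that])
    hence "integrable M (\<lambda>x. (cmod (X n x - l x))\<^sup>2)"
      by (intro integrableI_bounded) (auto intro: le_less_trans)
    hence 1: "X n - l \<in> L2 M" by (simp add: L2_def fun_diff_def)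
    have "ennreal ((l2_norm M (X n - l))\<^sup>2) \<le> ennreal (e\<^sup>2)" using f nn_integral_L2[OF 1] by simp
    hence "(l2_norm M (X n - l))\<^sup>2 \<le> e\<^sup>2" by (simp add: ennreal_le_iff)
    thus ?thesis using 1 e by (auto intro: power2_le_imp_le)
  qed
  obtain N1 where "\<forall>m\<ge>N1. \<forall>n\<ge>N1. l2_norm M (X m - X n) < 1" using cau[of 1] by auto
  hence "X N1 - l \<in> L2 M" using L2d[of 1 N1 N1] by auto
  hence "X N1 - (X N1 - l) \<in> L2 M" using X L2_diff by blast
  hence lL: "l \<in> L2 M" by simp
  have "(\<lambda>n. l2_norm M (X n - l)) \<longlonglongrightarrow> 0"
  proof (rule LIMSEQ_I)
    fix e :: real assume "e > 0"
    then obtain N2 where N2: "\<forall>m\<ge>N2. \<forall>n\<ge>N2. l2_norm M (X m - X n) < e/2" using cau[of "e/2"] by auto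
    have "norm (l2_norm M (X n - l) - 0) < e" if "n \<ge> N2" for n
      using L2d[of "e/2" N2 n] N2 that \<open>e > 0\<close> by (auto simp: l2_norm_def)
    thus "\<exists>N2. \<forall>n\<ge>N2. norm (l2_norm M (X n - l) - 0) < e" by blast
  qed
  thus ?thesis using lL by blast
qed

locale L2_space = fixes M :: "'a measure"

sublocale L2_space \<subseteq> semi_hilbert cscale "L2 M" "l2_inner M"
proof unfold_locales
  show "module.subspace cscale (L2 M)"
  proof -
    interpret v: vector_space "cscale :: complex \<Rightarrow> 'a cfun \<Rightarrow> 'a cfun"
      by unfold_locales (auto simp: fun_eq_iff algebra_simps)
    show ?thesis by (rule v.subspaceI) (auto intro: L2_add L2_cscale L2_zero)
  qed
  show "l2_inner M (f + g) h = l2_inner M f h + l2_inner M g h"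
    if "f \<in> L2 M" "g \<in> L2 M" "h \<in> L2 M" for f g h
    using L2_inner_integrable that unfolding l2_inner_def
    by (subst Bochner_Integration.integral_add[symmetric]) (auto simp: algebra_simps)
  show "l2_inner M (cscale c f) g = c * l2_inner M f g" for c f g
    by (simp add: l2_inner_def mult.assoc)
  show "cnj (l2_inner M f g) = l2_inner M g f" for f g
    unfolding l2_inner_def by (subst Bochner_Integration.integral_cnj[symmetric]) (simp add: mult.commute)
  show "0 \<le> Re (l2_inner M f f)" for f by (simp add: l2_inner_self)
  show "\<exists>l\<in>L2 M. (\<lambda>n. sqrt (Re (l2_inner M (X n - l) (X n - l)))) \<longlonglongrightarrow> 0"
    if "\<And>n. X n \<in> L2 M"
      "\<And>e. e > 0 \<Longrightarrow> \<exists>N::nat. \<forall>m\<ge>N. \<forall>n\<ge>N. sqrt (Re (l2_inner M (X m - X n) (X m - X n))) < e" for X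
    using L2_complete[of X M] that unfolding l2_norm_conv by blast
qed (auto simp: fun_eq_iff algebra_simps)

section \<open>Translation between the concrete and the abstract notions\<close>

context L2_space
begin

notation eqv (infix "\<simeq>" 50)

lemma l2_norm_nrm: "l2_norm M f = nrm f"
  by (simp add: l2_norm_conv nrm_def)

lemma eqv_iff_AE: assumes "f \<in> L2 M" "g \<in> L2 M" shows "f \<simeq> g \<longleftrightarrow> (AE x in M. f x = g x)"
proof -
  have "f \<simeq> g \<longleftrightarrow> (\<integral>x. (cmod ((f - g) x))\<^sup>2 \<partial>M) = 0"
    by (simp add: eqv_def l2_norm_nrm[symmetric] l2_norm_def)
  also have "\<dots> \<longleftrightarrow> (AE x in M. (cmod ((f - g) x))\<^sup>2 = 0)"
    using L2_integrable[OF L2_diff[OF assms]] by (intro integral_nonneg_eq_0_iff_AE) auto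
  finally show ?thesis by simp
qed

lemma eqv_iff_eq_ae: "f \<in> L2 M \<Longrightarrow> g \<in> L2 M \<Longrightarrow> f \<simeq> g \<longleftrightarrow> eq_ae M f g"
  by (simp add: eqv_iff_AE eq_ae_def)

lemma nrm_mono_AE:
  assumes "f \<in> L2 M" "g \<in> L2 M" "AE x in M. cmod (f x) \<le> cmod (g x)"
  shows "nrm f \<le> nrm g"
proof -
  have "(\<integral>x. (cmod (f x))\<^sup>2 \<partial>M) \<le> (\<integral>x. (cmod (g x))\<^sup>2 \<partial>M)"
    using assms by (intro integral_mono_AE L2_integrable) (auto intro: power_mono)
  thus ?thesis unfolding l2_norm_nrm[symmetric] l2_norm_def by (rule real_sqrt_le_mono)
qed

lemma bounded_op_iff: "bounded_op M T \<longleftrightarrow> bdd_op T"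
proof -
  have c: "(\<lambda>x. a * f x + b * g x) = cscale a f + cscale b g" for a b f g
    by (auto simp: fun_eq_iff)
  show ?thesis unfolding bounded_op_def bdd_op_def c l2_norm_nrm
    by (intro iffI; elim conjE; intro conjI; (assumption | simp add: eqv_iff_eq_ae))
qed

lemma self_adjoint_op_iff: "self_adjoint_op M T \<longleftrightarrow> bdd_op T \<and> sym_op T"
  unfolding self_adjoint_op_def bounded_op_iff sym_op_def by (auto simp: bdd_op_def)

lemma fun_diff_eq: "(\<lambda>x. f x - g x) = f - g" for f g :: "'a cfun"
  by (simp add: fun_diff_def)

lemma C0_semigroup_iff: "C0_semigroup M S \<longleftrightarrow> c0_sg S"
proof (cases "\<forall>t\<ge>0. bdd_op (S t)")
  case True
  hence S: "S t f \<in> L2 M" if "t \<ge> 0" "f \<in> L2 M" for t f using that bdd_opD(1) by blast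
  have 1: "(\<forall>f\<in>L2 M. eq_ae M (S 0 f) f) \<longleftrightarrow> (\<forall>f\<in>L2 M. S 0 f \<simeq> f)"
    by (intro ball_cong refl eqv_iff_eq_ae[symmetric] S) auto
  have 2: "(\<forall>s\<ge>0. \<forall>t\<ge>0. \<forall>f\<in>L2 M. eq_ae M (S (s + t) f) (S s (S t f))) \<longleftrightarrow>
      (\<forall>s\<ge>0. \<forall>t\<ge>0. \<forall>f\<in>L2 M. S (s + t) f \<simeq> S s (S t f))"
  proof -
    have "eq_ae M (S (s + t) f) (S s (S t f)) \<longleftrightarrow> S (s + t) f \<simeq> S s (S t f)"
      if "s \<ge> 0" "t \<ge> 0" "f \<in> L2 M" for s t f
      using that by (intro eqv_iff_eq_ae[symmetric] S add_nonneg_nonneg)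
    thus ?thesis by blast
  qed
  show ?thesis unfolding C0_semigroup_def c0_sg_def bounded_op_iff fun_diff_eq l2_norm_nrm 1 2 ..
next
  case False
  thus ?thesis by (auto simp: C0_semigroup_def c0_sg_def bounded_op_iff)
qed

lemma generator_eq: "generator M S = gen S"
proof -
  have "(\<lambda>x. (S t f x - f x) / complex_of_real t - g x) = cscale (complex_of_real (1 / t)) (S t f - f) - g" for t f g
    by (auto simp: fun_eq_iff)
  thus ?thesis unfolding generator_def gen_def l2_norm_nrm by simp
qed

lemma op_norm_opn: "op_norm M S = opn S"
  by (simp add: op_norm_def opn_def l2_norm_nrm)

lemma pos_cone_iff: "f \<in> pos_cone M \<longleftrightarrow> f \<in> L2 M \<and> (AE x in M. Im (f x) = 0 \<and> 0 \<le> Re (f x))"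
  by (simp add: pos_cone_def le_ae_def eq_commute[of "0::real"])

text \<open>\<open>l' x\<close> is the point of the half-line [0, \<infinity>) nearest to
  \<open>l x\<close>, so \<open>l\<close> is at least as close to \<open>l'\<close> as to any
  \<open>X n\<close>. This avoids passing to a subsequence that converges almost everywhere.\<close>

lemma pos_cone_limit:
  assumes X: "\<And>n. X n \<in> pos_cone M" and l: "l \<in> L2 M" "lim_to X l"
  shows "l \<in> pos_cone M"
proof -
  have XL: "X n \<in> L2 M" for n using X pos_cone_iff by blast
  define l' where "l' x = complex_of_real (max 0 (Re (l x)))" for x
  have [measurable]: "l \<in> borel_measurable M" using l L2_measurable by auto
  have l'L: "l' \<in> L2 M"
  proof (rule L2_bound[OF l(1), of _ 1])
    show "l' \<in> borel_measurable M" unfolding l'_def by measurable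
    have "cmod (l' x) \<le> cmod (l x)" for x
      using abs_Re_le_cmod[of "l x"] by (auto simp: l'_def max_def)
    thus "AE x in M. cmod (l' x) \<le> 1 * cmod (l x)" by simp
  qed
  have "nrm (l - l') \<le> nrm (X n - l)" for n
  proof (rule nrm_mono_AE)
    show "AE x in M. cmod ((l - l') x) \<le> cmod ((X n - l) x)"
      using X[of n] unfolding pos_cone_iff
    proof (elim conjE AE_mp, intro AE_I2 impI)
      fix x assume x: "Im (X n x) = 0 \<and> 0 \<le> Re (X n x)"
      have "(Re (l x) - max 0 (Re (l x)))\<^sup>2 \<le> (Re (X n x) - Re (l x))\<^sup>2"
        using x by (intro abs_le_square_iff[THEN iffD1]) (auto simp: max_def)
      thus "cmod ((l - l') x) \<le> cmod ((X n - l) x)"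
        using x by (auto simp: cmod_def l'_def intro!: real_sqrt_le_mono)
    qed
  qed (use l l'L XL in auto)
  hence "nrm (l - l') \<le> 0"
    using l(2) unfolding lim_to_def by (intro LIMSEQ_le_const) auto
  hence "l \<simeq> l'" unfolding eqv_def using l l'L by (intro antisym) auto
  hence "AE x in M. l x = l' x" using eqv_iff_AE l l'L by blast
  hence "AE x in M. Im (l x) = 0 \<and> 0 \<le> Re (l x)"
    by eventually_elim (metis Im_complex_of_real Re_complex_of_real l'_def max.cobounded1)
  thus ?thesis using l by (simp add: pos_cone_iff)
qed

lemma pos_cone_ip:
  assumes "f \<in> pos_cone M" "g \<in> pos_cone M"
  shows "0 \<le> Re (l2_inner M f g)" "Im (l2_inner M f g) = 0"
proof -
  have i: "integrable M (\<lambda>x. f x * cnj (g x))" using assms pos_cone_iff L2_inner_integrable by blast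
  have ae: "AE x in M. (Im (f x) = 0 \<and> 0 \<le> Re (f x)) \<and> (Im (g x) = 0 \<and> 0 \<le> Re (g x))"
    using assms unfolding pos_cone_iff by simp
  have "Re (l2_inner M f g) = (\<integral>x. Re (f x * cnj (g x)) \<partial>M)"
    unfolding l2_inner_def using i by (rule integral_Re[symmetric])
  also have "\<dots> \<ge> 0" by (rule integral_nonneg_AE) (use ae in eventually_elim, auto)
  finally show "0 \<le> Re (l2_inner M f g)" .
  have "Im (l2_inner M f g) = (\<integral>x. Im (f x * cnj (g x)) \<partial>M)"
    unfolding l2_inner_def using i by (rule integral_Im[symmetric])
  also have "\<dots> = 0" by (rule integral_eq_zero_AE) (use ae in eventually_elim, auto)
  finally show "Im (l2_inner M f g) = 0" .
qed

end

section \<open>Resolvents dominated by \<open>u\<close>\<close>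

definition re_part :: "'a cfun \<Rightarrow> 'a cfun" where "re_part f = (\<lambda>x. of_real (Re (f x)))"
definition im_part :: "'a cfun \<Rightarrow> 'a cfun" where "im_part f = (\<lambda>x. of_real (Im (f x)))"
definition pos_part :: "'a cfun \<Rightarrow> 'a cfun" where "pos_part f = (\<lambda>x. of_real (max 0 (Re (f x))))"
definition conj_fun :: "'a cfun \<Rightarrow> 'a cfun" where "conj_fun f = (\<lambda>x. cnj (f x))"

lemma parts_apply [simp]:
  "re_part f x = of_real (Re (f x))" "im_part f x = of_real (Im (f x))"
  "pos_part f x = of_real (max 0 (Re (f x)))" "conj_fun f x = cnj (f x)"
  by (simp_all add: re_part_def im_part_def pos_part_def conj_fun_def)

context L2_space
begin

lemma pos_cone_L2 [intro]: "f \<in> pos_cone M \<Longrightarrow> f \<in> L2 M"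
  by (simp add: pos_cone_iff)

lemma pos_cone_AE: "f \<in> pos_cone M \<Longrightarrow> AE x in M. Im (f x) = 0 \<and> 0 \<le> Re (f x)"
  by (simp add: pos_cone_iff)

lemma pos_cone_add: "f \<in> pos_cone M \<Longrightarrow> g \<in> pos_cone M \<Longrightarrow> f + g \<in> pos_cone M"
  by (auto simp: pos_cone_iff)

lemma pos_cone_scale: "f \<in> pos_cone M \<Longrightarrow> 0 \<le> c \<Longrightarrow> cscale (of_real c) f \<in> pos_cone M"
  by (auto simp: pos_cone_iff)

lemma pos_cone_0: "0 \<in> pos_cone M"
  by (simp add: pos_cone_iff)

lemma pos_cone_sum: "(\<And>i. i \<in> I \<Longrightarrow> f i \<in> pos_cone M) \<Longrightarrow> sum f I \<in> pos_cone M"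
  by (induction I rule: infinite_finite_induct) (auto intro: pos_cone_add pos_cone_0)

lemma pos_cone_eqv: "f \<in> pos_cone M \<Longrightarrow> f \<simeq> g \<Longrightarrow> g \<in> L2 M \<Longrightarrow> g \<in> pos_cone M"
  using eqv_iff_AE[of f g] unfolding pos_cone_iff by (auto elim: AE_mp)

lemma pos_cone_trans: "g - f \<in> pos_cone M \<Longrightarrow> h - g \<in> pos_cone M \<Longrightarrow> h - f \<in> pos_cone M"
  using pos_cone_add[of "g - f" "h - g"] by simp

lemma positive_nonzero_iff: "positive_nonzero M f \<longleftrightarrow> f \<in> pos_cone M \<and> nrm f \<noteq> 0"
proof (cases "f \<in> pos_cone M")
  case True
  have "eq_ae M f (\<lambda>x. 0) \<longleftrightarrow> f \<simeq> 0"
    using eqv_iff_eq_ae[OF pos_cone_L2[OF True] H_0] by (simp add: zero_fun_def)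
  thus ?thesis using True by (simp add: positive_nonzero_def eqv_0_iff)
qed (simp add: positive_nonzero_def)

lemma strongly_positive_iff:
  assumes "f \<in> L2 M" "u \<in> pos_cone M"
  shows "strongly_positive M u f \<longleftrightarrow> (\<exists>\<epsilon>>0. f - cscale (of_real \<epsilon>) u \<in> pos_cone M)"
proof -
  have "le_ae M (\<lambda>x. complex_of_real \<epsilon> * u x) f \<longleftrightarrow> f - cscale (of_real \<epsilon>) u \<in> pos_cone M" for \<epsilon>
    using assms pos_cone_L2[OF assms(2)] unfolding le_ae_def pos_cone_iff
    by (auto simp: eq_commute[of "\<epsilon> * _"])
  thus ?thesis by (simp add: strongly_positive_def)
qed

lemma parts_L2 [simp, intro]:
  assumes "f \<in> L2 M"
  shows "re_part f \<in> L2 M" "im_part f \<in> L2 M" "pos_part f \<in> L2 M" "conj_fun f \<in> L2 M"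
proof -
  have [measurable]: "f \<in> borel_measurable M" using assms L2_measurable by auto
  show "re_part f \<in> L2 M"
    by (rule L2_bound[OF assms, of _ 1]) (auto simp: re_part_def abs_Re_le_cmod)
  show "im_part f \<in> L2 M"
    by (rule L2_bound[OF assms, of _ 1]) (auto simp: im_part_def abs_Im_le_cmod)
  have "cmod (pos_part f x) \<le> cmod (f x)" for x
    using abs_Re_le_cmod[of "f x"] by (auto simp: max_def)
  thus "pos_part f \<in> L2 M"
    by (intro L2_bound[OF assms, of _ 1]) (auto simp: pos_part_def)
  have "(\<lambda>x. cnj (f x)) \<in> borel_measurable M"
    by (rule measurable_compose[OF _ borel_measurable_continuous_onI[OF continuous_on_cnj]])
      (auto intro: continuous_on_id)
  thus "conj_fun f \<in> L2 M"
    by (intro L2_bound[OF assms, of _ 1]) (auto simp: conj_fun_def)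
qed

lemma pos_part_pos: "f \<in> L2 M \<Longrightarrow> pos_part f \<in> pos_cone M"
  by (simp add: pos_cone_iff)

lemma nrm_pos_part: "f \<in> L2 M \<Longrightarrow> nrm (pos_part f) \<le> nrm f"
proof (rule nrm_mono_AE)
  have "cmod (pos_part f x) \<le> cmod (f x)" for x
    using abs_Re_le_cmod[of "f x"] by (auto simp: max_def)
  thus "AE x in M. cmod (pos_part f x) \<le> cmod (f x)" by simp
qed auto

lemma re_im_decomposition: "f = re_part f + cscale \<i> (im_part f)"
  by (auto simp: fun_eq_iff complex_eq)

lemma re_part_decomposition: "re_part f = pos_part f - pos_part (- f)"
  by (auto simp: fun_eq_iff max_def)

lemma im_part_eq_re_part: "im_part f = re_part (cscale (- \<i>) f)"
  by (auto simp: fun_eq_iff)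

lemma ip_conj_fun: "l2_inner M (conj_fun f) g = cnj (l2_inner M f (conj_fun g))"
  by (simp add: l2_inner_def Bochner_Integration.integral_cnj[symmetric])

end

section \<open>Domination by u and the Hilbert-Schmidt bound\<close>

locale dominated_resolvent = L2_space M for M :: "'a measure" +
  fixes u :: "'a cfun" and K :: "'a operator" and c :: real
  assumes nontriv: "\<exists>f\<in>L2 M. nrm f \<noteq> 0"
    and u: "u \<in> pos_cone M" and u_quasi: "quasi_interior M u"
    and K_sym: "sym_op K" and c_pos: "c > 0"
    and K_psd: "f \<in> L2 M \<Longrightarrow> c * (nrm (K f))\<^sup>2 \<le> Re (l2_inner M (K f) f)"
    and K_inj: "f \<in> L2 M \<Longrightarrow> nrm (K f) = 0 \<Longrightarrow> nrm f = 0"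
    and K_pos: "f \<in> pos_cone M \<Longrightarrow> K f \<in> pos_cone M"
    and K_strong: "f \<in> pos_cone M \<Longrightarrow> nrm f \<noteq> 0 \<Longrightarrow> \<exists>\<epsilon>>0. K f - cscale (of_real \<epsilon>) u \<in> pos_cone M"
    and K_ideal: "f \<in> L2 M \<Longrightarrow> K f \<in> principal_ideal M u"
begin

lemma u_L2 [simp, intro]: "u \<in> L2 M" using u by auto

lemmas K_L2 [simp, intro] = sym_opD(1)[OF K_sym]

lemma principal_ideal_AE:
  assumes "f \<in> principal_ideal M u" obtains C where "C \<ge> 0" "AE x in M. cmod (f x) \<le> C * Re (u x)"
proof -
  obtain C where C: "C \<ge> 0" "le_ae M (\<lambda>x. complex_of_real (cmod (f x))) (\<lambda>x. complex_of_real C * u x)"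
    using assms by (auto simp: principal_ideal_def)
  have "AE x in M. cmod (f x) \<le> C * Re (u x)" using C(2) unfolding le_ae_def by eventually_elim simp
  with C(1) show ?thesis by (rule that)
qed

text \<open>The set \<open>{u = 0}\<close> need not be a null set, as the measure may have atoms of infinite mass.\<close>

lemma u_support: assumes f: "f \<in> L2 M" shows "AE x in M. u x = 0 \<longrightarrow> f x = 0"
proof -
  define h where "h x = (if u x = 0 then f x else 0)" for x
  have [measurable]: "f \<in> borel_measurable M" "u \<in> borel_measurable M" using f L2_measurable by auto
  have hL: "h \<in> L2 M"
  proof (rule L2_bound[OF f, of _ 1])
    show "h \<in> borel_measurable M" unfolding h_def by measurable
  qed (auto simp: h_def)
  have "nrm h < e" if "e > 0" for e
  proof -
    obtain g where g: "g \<in> principal_ideal M u" "l2_norm M (\<lambda>x. f x - g x) < e"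
      using u_quasi f \<open>e > 0\<close> by (auto simp: quasi_interior_def)
    obtain C where C: "AE x in M. cmod (g x) \<le> C * Re (u x)" using principal_ideal_AE[OF g(1)] by blast
    have gL: "g \<in> L2 M" using g by (simp add: principal_ideal_def)
    have "nrm h \<le> nrm (f - g)"
    proof (rule nrm_mono_AE)
      show "AE x in M. cmod (h x) \<le> cmod ((f - g) x)"
        using C by eventually_elim (auto simp: h_def)
    qed (use hL f gL in auto)
    also have "nrm (f - g) < e" using g(2) by (simp add: fun_diff_eq l2_norm_nrm)
    finally show ?thesis .
  qed
  hence "nrm h \<le> 0" by (meson linorder_not_le order_less_irrefl)
  hence "h \<simeq> 0" using hL by (simp add: eqv_0_iff order_antisym)
  hence "AE x in M. h x = 0" using eqv_iff_AE[OF hL H_0] by simp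
  thus ?thesis by eventually_elim (auto simp: h_def split: if_splits)
qed

lemma nrm_u: "nrm u > 0"
proof (rule ccontr)
  assume "\<not> ?thesis"
  hence "u \<simeq> 0" by (simp add: eqv_0_iff order_antisym)
  hence u0: "AE x in M. u x = 0" using eqv_iff_AE[OF u_L2 H_0] by simp
  obtain f where f: "f \<in> L2 M" "nrm f \<noteq> 0" using nontriv by blast
  have "AE x in M. f x = 0" using u_support[OF f(1)] u0 by eventually_elim auto
  hence "f \<simeq> 0" using eqv_iff_AE[OF f(1) H_0] by simp
  thus False using f by (simp add: eqv_0_iff)
qed

text \<open>Gliding hump: for positive \<open>g\<^sub>n\<close> with \<open>\<Sum> g\<^sub>n = F\<close>, positivity gives \<open>K g\<^sub>n \<le> K F \<le> C u\<close>.\<close>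

lemma K_dominated_pos:
  "\<exists>k\<ge>0. \<forall>f\<in>pos_cone M. AE x in M. Re (K f x) \<le> k * nrm f * Re (u x)"
proof (rule ccontr)
  assume no: "\<not> ?thesis"
  have "\<exists>g. g \<in> pos_cone M \<and> nrm g \<le> (1/2) ^ n \<and> \<not> (AE x in M. Re (K g x) \<le> 2 ^ n * Re (u x))" for n
  proof -
    \<comment> \<open>Rescaling \<open>f\<close> to norm \<open>(1/2) ^ n\<close> uses up one factor
      \<open>2 ^ n\<close>; failure of the constant \<open>4 ^ n\<close> for \<open>f\<close> leaves
      failure of \<open>2 ^ n\<close> for the rescaled vector.\<close>
    have "(4::real) ^ n \<ge> 0" by simp
    then obtain f where f: "f \<in> pos_cone M" "\<not> (AE x in M. Re (K f x) \<le> 4 ^ n * nrm f * Re (u x))"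
      using no by blast
    have fL: "f \<in> L2 M" using f by auto
    have f0: "nrm f \<noteq> 0"
    proof
      assume "nrm f = 0"
      hence "f \<simeq> 0" by (simp add: eqv_0_iff)
      hence "K f \<simeq> K 0" using fL by (intro sym_opD(3)[OF K_sym]) auto
      moreover have "K 0 \<simeq> 0" using sym_opD(6)[OF K_sym H_0, of 0] by simp
      ultimately have "K f \<simeq> 0" using fL by (rule_tac eqv_trans[of _ "K 0"]) auto
      hence "AE x in M. K f x = 0" using eqv_iff_AE[OF K_L2[OF fL] H_0] by simp
      hence "AE x in M. Re (K f x) \<le> 4 ^ n * nrm f * Re (u x)"
        using pos_cone_AE[OF u] by eventually_elim (simp add: \<open>nrm f = 0\<close>)
      thus False using f(2) by blast
    qed
    define s where "s = (1/2) ^ n / nrm f"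
    have np: "nrm f > 0" using f0 nrm_ge_0[OF fL] by linarith
    hence s: "s > 0" by (simp add: s_def)
    define g where "g = cscale (of_real s) f"
    have g: "g \<in> pos_cone M" using f(1) s by (auto simp: g_def intro: pos_cone_scale)
    have "nrm g = cmod (of_real s) * nrm f" unfolding g_def using fL by (rule nrm_scl)
    also have "cmod (of_real s) = s" using s by simp
    also have "s * nrm f = (1/2) ^ n" using np by (simp add: s_def)
    finally have "nrm g = (1/2) ^ n" .
    moreover have "\<not> (AE x in M. Re (K g x) \<le> 2 ^ n * Re (u x))"
    proof
      assume a: "AE x in M. Re (K g x) \<le> 2 ^ n * Re (u x)"
      have "K g \<simeq> cscale (of_real s) (K f)" unfolding g_def using fL by (rule sym_opD(6)[OF K_sym])
      hence "AE x in M. K g x = of_real s * K f x"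
        using eqv_iff_AE[of "K g" "cscale (of_real s) (K f)"] fL g by auto
      with a have "AE x in M. Re (K f x) \<le> 4 ^ n * nrm f * Re (u x)"
      proof eventually_elim
        case (elim x)
        have "s * Re (K f x) \<le> 2 ^ n * Re (u x)" using elim by simp
        hence "Re (K f x) \<le> 2 ^ n * Re (u x) / s" using s by (simp add: field_simps)
        also have "\<dots> = (2 ^ n * 2 ^ n) * nrm f * Re (u x)" using f0 by (simp add: s_def field_simps)
        also have "2 ^ n * 2 ^ n = (4 :: real) ^ n" by (simp flip: power_mult_distrib)
        finally show ?case .
      qed
      thus False using f(2) by blast
    qed
    ultimately show ?thesis using g by auto
  qed
  then obtain g where g: "\<And>n. g n \<in> pos_cone M" "\<And>n. nrm (g n) \<le> (1/2) ^ n"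
    "\<And>n. \<not> (AE x in M. Re (K (g n) x) \<le> 2 ^ n * Re (u x))" by metis
  have gL: "g n \<in> L2 M" for n using g(1) by auto
  define X where "X n = (\<Sum>i<n. g i)" for n
  have XL: "X n \<in> L2 M" for n using gL by (auto simp: X_def)
  have step: "nrm (X (Suc n) - X n) \<le> 1 * (1/2) ^ n" for n using g(2)[of n] by (simp add: X_def)
  have "\<exists>F. F \<in> L2 M \<and> lim_to X F"
  proof (rule geometric_limit[OF XL step])
    fix F assume "F \<in> L2 M" "lim_to X F"
    thus ?thesis by blast
  qed auto
  then obtain F where F: "F \<in> L2 M" "lim_to X F" by blast
  obtain C where C: "AE x in M. cmod (K F x) \<le> C * Re (u x)" using principal_ideal_AE[OF K_ideal[OF F(1)]] by blast
  have le: "AE x in M. Re (K (g n) x) \<le> C * Re (u x)" for n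
  proof -
    \<comment> \<open>The index starts at \<open>Suc n\<close> so that every partial sum already
      contains \<open>g n\<close>; removing it leaves a sum of positive functions.\<close>
    have "F - g n \<in> pos_cone M"
    proof (rule pos_cone_limit[of "\<lambda>m. X (Suc n + m) - g n"])
      fix m
      have "X (Suc n + m) - g n = (\<Sum>i\<in>{..<Suc n + m} - {n}. g i)"
        unfolding X_def by (subst sum_diff1) auto
      thus "X (Suc n + m) - g n \<in> pos_cone M" using g(1) by (auto intro: pos_cone_sum)
    next
      have "(\<lambda>m. nrm (X (m + Suc n) - F)) \<longlonglongrightarrow> 0"
        using F(2) unfolding lim_to_def by (rule LIMSEQ_ignore_initial_segment)
      thus "lim_to (\<lambda>m. X (Suc n + m) - g n) (F - g n)" by (simp add: lim_to_def add.commute)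
    qed (use F gL in auto)
    hence "K (F - g n) \<in> pos_cone M" by (rule K_pos)
    hence "K F - K (g n) \<in> pos_cone M"
      by (rule pos_cone_eqv[OF _ sym_opD(5)[OF K_sym F(1) gL]]) (use F gL in auto)
    from pos_cone_AE[OF this] C show ?thesis
    proof eventually_elim
      case (elim x)
      have "Re (K (g n) x) \<le> Re (K F x)" using elim by simp
      also have "\<dots> \<le> cmod (K F x)" by (rule complex_Re_le_cmod)
      finally show ?case using elim by simp
    qed
  qed
  obtain n :: nat where n: "C < 2 ^ n" using real_arch_pow[of 2 C] by auto
  have "AE x in M. Re (K (g n) x) \<le> 2 ^ n * Re (u x)"
    using le[of n] pos_cone_AE[OF u]
  proof eventually_elim
    case (elim x)
    have "C * Re (u x) \<le> 2 ^ n * Re (u x)" using elim n by (intro mult_right_mono) auto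
    thus ?case using elim by linarith
  qed
  thus False using g(3) by blast
qed

lemma K_decomposition:
  assumes f: "f \<in> L2 M"
  shows "AE x in M. K f x = K (re_part f) x + \<i> * K (im_part f) x"
    and "AE x in M. K (re_part f) x = K (pos_part f) x - K (pos_part (- f)) x"
proof -
  have 1: "K (re_part f + cscale \<i> (im_part f)) \<simeq> K (re_part f) + K (cscale \<i> (im_part f))"
    using f by (intro sym_opD(4)[OF K_sym]) auto
  have 2: "K (re_part f) + K (cscale \<i> (im_part f)) \<simeq> K (re_part f) + cscale \<i> (K (im_part f))"
    using f by (intro eqv_add eqv_refl sym_opD(6)[OF K_sym]) auto
  have "K (re_part f + cscale \<i> (im_part f)) \<simeq> K (re_part f) + cscale \<i> (K (im_part f))"
    by (rule eqv_trans[OF 1 2]) (use f in auto)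
  hence "K f \<simeq> K (re_part f) + cscale \<i> (K (im_part f))" using re_im_decomposition[of f] by simp
  thus "AE x in M. K f x = K (re_part f) x + \<i> * K (im_part f) x"
    using eqv_iff_AE[of "K f" "K (re_part f) + cscale \<i> (K (im_part f))"] f by simp
  have "K (pos_part f - pos_part (- f)) \<simeq> K (pos_part f) - K (pos_part (- f))"
    using f by (intro sym_opD(5)[OF K_sym]) auto
  thus "AE x in M. K (re_part f) x = K (pos_part f) x - K (pos_part (- f)) x"
    using eqv_iff_AE[of "K (re_part f)" "K (pos_part f) - K (pos_part (- f))"] f
    by (simp add: re_part_decomposition)
qed

lemma K_dominated: "\<exists>k\<ge>0. \<forall>f\<in>L2 M. AE x in M. cmod (K f x) \<le> k * nrm f * Re (u x)"
proof -
  obtain k where k: "k \<ge> 0" "\<And>f. f \<in> pos_cone M \<Longrightarrow> AE x in M. Re (K f x) \<le> k * nrm f * Re (u x)"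
    using K_dominated_pos by blast
  have pos: "AE x in M. cmod (K (pos_part g) x) \<le> k * nrm f * Re (u x)"
    if "g \<in> L2 M" "nrm g \<le> nrm f" "f \<in> L2 M" for f g
    using k(2)[OF pos_part_pos[OF that(1)]] pos_cone_AE[OF K_pos[OF pos_part_pos[OF that(1)]]] pos_cone_AE[OF u]
  proof eventually_elim
    case (elim x)
    have "cmod (K (pos_part g) x) = Re (K (pos_part g) x)" using elim by (simp add: cmod_eq_Re)
    also have "\<dots> \<le> k * nrm (pos_part g) * Re (u x)" using elim by simp
    also have "\<dots> \<le> k * nrm f * Re (u x)"
      using nrm_pos_part[OF that(1)] that elim k(1) by (intro mult_right_mono mult_left_mono) auto
    finally show ?case .
  qed
  \<comment> \<open>The factor 4 counts the positive and negative parts of the real and imaginary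
    parts of \<open>f\<close>.\<close>
  have "AE x in M. cmod (K f x) \<le> (4 * k) * nrm f * Re (u x)" if f: "f \<in> L2 M" for f
  proof -
    let ?g = "cscale (- \<i>) f"
    have g: "?g \<in> L2 M" "nrm ?g = nrm f" using f by (auto simp: nrm_scl)
    have p: "AE x in M. cmod (K (pos_part f) x) \<le> k * nrm f * Re (u x)"
      "AE x in M. cmod (K (pos_part (- f)) x) \<le> k * nrm f * Re (u x)"
      "AE x in M. cmod (K (pos_part ?g) x) \<le> k * nrm f * Re (u x)"
      "AE x in M. cmod (K (pos_part (- ?g)) x) \<le> k * nrm f * Re (u x)"
      using f g by (auto intro!: pos simp del: cscale_apply)
    show ?thesis
      using K_decomposition(1)[OF f] K_decomposition(2)[OF f] K_decomposition(2)[OF g(1)] p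
      unfolding im_part_eq_re_part[of f]
    proof eventually_elim
      case (elim x)
      have "cmod (K f x) \<le> cmod (K (pos_part f) x) + cmod (K (pos_part (- f)) x)
          + (cmod (K (pos_part ?g) x) + cmod (K (pos_part (- ?g)) x))"
        unfolding elim(1-3)
        by (intro order_trans[OF norm_triangle_ineq] add_mono)
          (simp_all add: norm_mult norm_triangle_ineq4)
      thus ?case using elim(4-7) by simp
    qed
  qed
  thus ?thesis using k(1) by (intro exI[of _ "4 * k"]) auto
qed

definition k :: real where
  "k = (SOME k. k \<ge> 0 \<and> (\<forall>f\<in>L2 M. AE x in M. cmod (K f x) \<le> k * nrm f * Re (u x)))"

lemma k: "k \<ge> 0" "f \<in> L2 M \<Longrightarrow> AE x in M. cmod (K f x) \<le> k * nrm f * Re (u x)"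
  using someI_ex[of "\<lambda>k. k \<ge> 0 \<and> (\<forall>f\<in>L2 M. AE x in M. cmod (K f x) \<le> k * nrm f * Re (u x))"]
    K_dominated unfolding k_def by blast+

text \<open>The pointwise bound holds simultaneously for all coefficient vectors \<open>a\<close> off one null set,
  because it does so for a countable dense set of them.\<close>

lemma K_hilbert_schmidt:
  assumes e: "orthonormal n e" shows "(\<Sum>i<n. (nrm (K (e i)))\<^sup>2) \<le> (k * nrm u)\<^sup>2"
proof -
  have eL: "e i \<in> L2 M" if "i < n" for i using e that by (auto simp: orthonormal_def)
  have ee: "l2_inner M (e i) (e j) = (if i = j then 1 else 0)" if "i < n" "j < n" for i j
    using e that by (auto simp: orthonormal_def)
  define P where "P x a \<longleftrightarrow> cmod (\<Sum>i<n. a i * K (e i) x) \<le> k * sqrt (\<Sum>i<n. (cmod (a i))\<^sup>2) * Re (u x)"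
    for x and a :: "nat \<Rightarrow> complex"
  have one: "AE x in M. P x a" for a
  proof -
    define f where "f = (\<Sum>i<n. cscale (a i) (e i))"
    have fL: "f \<in> L2 M" using eL by (auto simp: f_def)
    have SL: "(\<Sum>i<n. cscale (a i) (K (e i))) \<in> L2 M" using eL by auto
    have "K f \<simeq> (\<Sum>i<n. cscale (a i) (K (e i)))"
    proof (rule eqvI)
      fix h assume h: "h \<in> L2 M"
      have "l2_inner M (K f) h = (\<Sum>i<n. a i * l2_inner M (e i) (K h))"
        unfolding sym_opD(2)[OF K_sym fL h] unfolding f_def using h eL
        by (subst ip_sum_left) (auto simp: ip_scl_left)
      also have "\<dots> = l2_inner M (\<Sum>i<n. cscale (a i) (K (e i))) h"
        using h eL by (subst ip_sum_left) (auto simp: ip_scl_left sym_opD(2)[OF K_sym])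
      finally show "l2_inner M (K f) h = l2_inner M (\<Sum>i<n. cscale (a i) (K (e i))) h" .
    qed (use fL SL in auto)
    hence 1: "AE x in M. K f x = (\<Sum>i<n. a i * K (e i) x)"
      using eqv_iff_AE[OF K_L2[OF fL] SL] by simp
    have "l2_inner M g f = (\<Sum>j<n. cnj (a j) * l2_inner M g (e j))" if "g \<in> L2 M" for g
      unfolding f_def using that eL by (subst ip_sum_right) (auto simp: ip_scl_right)
    moreover have "l2_inner M f f = (\<Sum>i<n. a i * l2_inner M (e i) f)"
      using fL eL by (subst (1) f_def, subst ip_sum_left) (auto simp: ip_scl_left)
    ultimately have "l2_inner M f f = (\<Sum>i<n. \<Sum>j<n. a i * (cnj (a j) * l2_inner M (e i) (e j)))"
      using eL by (simp add: sum_distrib_left)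
    also have "\<dots> = (\<Sum>i<n. \<Sum>j<n. if j = i then a i * cnj (a i) else 0)"
      by (intro sum.cong) (auto simp: ee)
    also have "\<dots> = of_real (\<Sum>i<n. (cmod (a i))\<^sup>2)" by (simp add: complex_norm_square del: of_real_power)
    finally have "nrm f = sqrt (\<Sum>i<n. (cmod (a i))\<^sup>2)" by (simp add: nrm_def)
    with k(2)[OF fL] 1 show ?thesis unfolding P_def by (auto elim: AE_mp)
  qed
  obtain D :: "(nat \<Rightarrow> complex) set" where D: "countable D" "\<And>X. open X \<Longrightarrow> X \<noteq> {} \<Longrightarrow> \<exists>d\<in>D. d \<in> X"
    using countable_dense_exists[where 'a = "nat \<Rightarrow> complex"] by blast
  have "AE x in M. \<forall>a\<in>D. P x a" using one by (simp add: AE_ball_countable[OF D(1)])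
  hence "AE x in M. (\<Sum>i<n. (cmod (K (e i) x))\<^sup>2) \<le> k\<^sup>2 * (cmod (u x))\<^sup>2"
    using pos_cone_AE[OF u]
  proof eventually_elim
    case (elim x)
    have P: "P x a" for a
    proof (rule ccontr)
      assume a: "\<not> P x a"
      have "open {a. k * sqrt (\<Sum>i<n. (cmod (a i))\<^sup>2) * Re (u x) < cmod (\<Sum>i<n. a i * K (e i) x)}"
        by (intro open_Collect_less continuous_intros continuous_on_product_coordinates)
      hence "open {a. \<not> P x a}" by (simp add: P_def not_le)
      thus False using D(2)[of "{a. \<not> P x a}"] a elim(1) by blast
    qed
    define S where "S = (\<Sum>i<n. (cmod (K (e i) x))\<^sup>2)"
    have S0: "S \<ge> 0" by (simp add: S_def sum_nonneg)
    \<comment> \<open>The extremal coefficients at the point \<open>x\<close>: with them the left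
      side of \<open>P\<close> is \<open>S\<close> and the right side contains only
      \<open>sqrt S\<close>, so one factor \<open>sqrt S\<close> cancels.\<close>
    have "(\<Sum>i<n. cnj (K (e i) x) * K (e i) x) = of_real S"
      by (simp add: S_def complex_norm_square mult.commute del: of_real_power)
    hence "cmod (\<Sum>i<n. cnj (K (e i) x) * K (e i) x) = S" using S0 by (simp only: norm_of_real abs_of_nonneg)
    hence "S \<le> k * sqrt S * Re (u x)"
      using P[of "\<lambda>i. cnj (K (e i) x)"] by (simp add: P_def S_def[symmetric])
    hence "sqrt S * sqrt S \<le> (k * Re (u x)) * sqrt S" using S0 by (simp add: ac_simps)
    hence "sqrt S \<le> k * Re (u x)"
    proof (cases "S = 0")
      case False
      hence "sqrt S > 0" using S0 by simp
      with \<open>sqrt S * sqrt S \<le> (k * Re (u x)) * sqrt S\<close> show ?thesis by (simp only: mult_le_cancel_right_pos)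
    qed (use k(1) elim(2) in simp)
    hence "(sqrt S)\<^sup>2 \<le> (k * Re (u x))\<^sup>2" using S0 by (intro power_mono) auto
    moreover have "cmod (u x) = Re (u x)" using elim(2) by (simp add: cmod_eq_Re)
    ultimately show ?case using S0 by (simp add: S_def[symmetric] power_mult_distrib)
  qed
  moreover have KL: "integrable M (\<lambda>x. (cmod (K (e i) x))\<^sup>2)" if "i < n" for i
    using eL[OF that] by (intro L2_integrable) auto
  ultimately have "(\<integral>x. (\<Sum>i<n. (cmod (K (e i) x))\<^sup>2) \<partial>M) \<le> (\<integral>x. k\<^sup>2 * (cmod (u x))\<^sup>2 \<partial>M)"
    using L2_integrable[OF u_L2] by (intro integral_mono_AE Bochner_Integration.integrable_sum integrable_mult_right) auto
  also have "(\<integral>x. (\<Sum>i<n. (cmod (K (e i) x))\<^sup>2) \<partial>M) = (\<Sum>i<n. (nrm (K (e i)))\<^sup>2)"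
    using KL by (subst Bochner_Integration.integral_sum) (auto simp: l2_norm_power2 simp flip: l2_norm_nrm)
  also have "(\<integral>x. k\<^sup>2 * (cmod (u x))\<^sup>2 \<partial>M) = (k * nrm u)\<^sup>2"
    by (simp add: power_mult_distrib l2_norm_power2 flip: l2_norm_nrm)
  finally show ?thesis .
qed

end

sublocale dominated_resolvent \<subseteq> compact?: compact_psd cscale "L2 M" "l2_inner M" K c "(k * nrm u)\<^sup>2"
  by unfold_locales (auto intro: K_sym c_pos K_psd K_inj K_hilbert_schmidt)

section \<open>The leading eigenvalue and its eigenspace\<close>

context dominated_resolvent
begin

lemma K_real: assumes "f \<in> L2 M" shows "AE x in M. Im (K (re_part f) x) = 0" "AE x in M. Im (K (im_part f) x) = 0"
proof -
  have *: "AE x in M. Im (K (re_part f) x) = 0" if "f \<in> L2 M" for f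
    using K_decomposition(2)[OF that] pos_cone_AE[OF K_pos[OF pos_part_pos[OF that]]]
      pos_cone_AE[OF K_pos[OF pos_part_pos[OF H_minus[OF that]]]]
    by eventually_elim simp
  show "AE x in M. Im (K (re_part f) x) = 0" using assms by (rule *)
  show "AE x in M. Im (K (im_part f) x) = 0" unfolding im_part_eq_re_part using assms by (intro *) auto
qed

lemma K_conj: assumes f: "f \<in> L2 M" shows "K (conj_fun f) \<simeq> conj_fun (K f)"
proof -
  have 1: "re_part (conj_fun f) = re_part f" "im_part (conj_fun f) = cscale (-1) (im_part f)"
    by (auto simp: fun_eq_iff)
  have "K (cscale (-1) (im_part f)) \<simeq> cscale (-1) (K (im_part f))"
    using f by (intro sym_opD(6)[OF K_sym]) auto
  hence "AE x in M. K (cscale (-1) (im_part f)) x = - K (im_part f) x"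
    using eqv_iff_AE[of "K (cscale (-1) (im_part f))" "cscale (-1) (K (im_part f))"] f by simp
  moreover have "AE x in M. K (conj_fun f) x = K (re_part f) x + \<i> * K (cscale (-1) (im_part f)) x"
    using K_decomposition(1)[of "conj_fun f"] f by (simp add: 1)
  ultimately have "AE x in M. K (conj_fun f) x = conj_fun (K f) x"
    using K_decomposition(1)[OF f] K_real[OF f]
    by eventually_elim (simp add: complex_eq_iff)
  thus ?thesis using eqv_iff_AE[of "K (conj_fun f)" "conj_fun (K f)"] f by simp
qed

lemma eigval_0: "eigvec 0 \<noteq> 0" "eigval 0 > 0"
proof -
  obtain f where "f \<in> L2 M" "nrm f \<noteq> 0" using nontriv by blast
  thus "eigvec 0 \<noteq> 0" by (cases rule: eigvec_cases[of 0]) auto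
  thus "eigval 0 > 0" by (rule eigval_pos)
qed

abbreviation eigenspace0 :: "'a cfun \<Rightarrow> bool" where
  "eigenspace0 f \<equiv> f \<in> L2 M \<and> K f \<simeq> cscale (of_real (eigval 0)) f"

lemma eigenspace0_iff:
  assumes "f \<in> L2 M"
  shows "K f \<simeq> cscale (of_real (eigval 0)) f \<longleftrightarrow> (AE x in M. K f x = of_real (eigval 0) * f x)"
  using eqv_iff_AE[of "K f" "cscale (of_real (eigval 0)) f"] assms by simp

text \<open>In coefficients the form is the sum of \<open>eigval n * b n\<close>. Equality with the
  sum of \<open>eigval 0 * b n\<close> forces every termwise difference to vanish, so only
  coefficients with \<open>eigval n = eigval 0\<close> survive. Where \<open>eigvec n = 0\<close>
  the coefficient vanishes anyway.\<close>

lemma maximizer_eigenspace0: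
  assumes a: "a \<in> L2 M" and max: "Re (l2_inner M (K a) a) = eigval 0 * (nrm a)\<^sup>2"
  shows "eigenspace0 a"
proof -
  define b where "b n = (cmod (l2_inner M a (eigvec n)))\<^sup>2" for n
  have "(\<lambda>n. Re (l2_inner M (K a) (eigvec n) * cnj (l2_inner M a (eigvec n)))) sums Re (l2_inner M (K a) a)"
    using a by (intro sums_Re ip_sums) auto
  moreover have "Re (l2_inner M (K a) (eigvec n) * cnj (l2_inner M a (eigvec n))) = eigval n * b n" for n
  proof -
    have "l2_inner M (K a) (eigvec n) * cnj (l2_inner M a (eigvec n)) = of_real (eigval n) * of_real (b n)"
      unfolding b_def complex_norm_square using a by (simp add: ip_K_eigvec)
    thus ?thesis by simp
  qed
  ultimately have "(\<lambda>n. eigval n * b n) sums (eigval 0 * (nrm a)\<^sup>2)" using max by simp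
  moreover have "(\<lambda>n. eigval 0 * b n) sums (eigval 0 * (nrm a)\<^sup>2)"
    unfolding b_def using parseval[OF a] by (rule sums_mult)
  ultimately have s: "(\<lambda>n. eigval 0 * b n - eigval n * b n) sums 0"
    using sums_diff by fastforce
  have nn: "0 \<le> eigval 0 * b n - eigval n * b n" for n
  proof (cases "eigvec n = 0")
    case False
    thus ?thesis using eigval_antimono(2)[of 0 n] by (auto simp: b_def intro!: mult_right_mono)
  qed (use a in \<open>simp add: b_def\<close>)
  have z: "eigval 0 * b n - eigval n * b n = 0" for n
    using suminf_eq_zero_iff[OF sums_summable[OF s] nn] sums_unique[OF s] by auto
  have "K a \<simeq> cscale (of_real (eigval 0)) a"
  proof (rule eqv_coef)
    fix n
    have "eigval 0 = eigval n \<or> l2_inner M a (eigvec n) = 0" using z[of n] by (auto simp: b_def)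
    thus "l2_inner M (K a) (eigvec n) = l2_inner M (cscale (of_real (eigval 0)) a) (eigvec n)"
      using a by (auto simp: ip_K_eigvec ip_scl_left)
  qed (use a in auto)
  thus ?thesis using a by simp
qed

text \<open>An eigenvector is a positive multiple of its image under \<open>K\<close>, and images of
  nonzero positive vectors dominate a multiple of \<open>u\<close>.\<close>

lemma pos_eigenspace0:
  assumes f: "f \<in> pos_cone M" "nrm f \<noteq> 0" "K f \<simeq> cscale (of_real (eigval 0)) f"
  shows "\<exists>\<delta>>0. f - cscale (of_real \<delta>) u \<in> pos_cone M"
proof -
  have fL: "f \<in> L2 M" using f by auto
  obtain \<epsilon> where \<epsilon>: "\<epsilon> > 0" "K f - cscale (of_real \<epsilon>) u \<in> pos_cone M" using K_strong f by blast
  have "AE x in M. Im ((f - cscale (of_real (\<epsilon> / eigval 0)) u) x) = 0 \<and> 0 \<le> Re ((f - cscale (of_real (\<epsilon> / eigval 0)) u) x)"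
    using f(3)[unfolded eigenspace0_iff[OF fL]] pos_cone_AE[OF \<epsilon>(2)] pos_cone_AE[OF u] pos_cone_AE[OF f(1)]
    by eventually_elim (use eigval_0(2) in \<open>auto simp: field_simps\<close>)
  hence "f - cscale (of_real (\<epsilon> / eigval 0)) u \<in> pos_cone M" using fL by (subst pos_cone_iff) auto
  thus ?thesis using \<epsilon>(1) eigval_0(2) by (intro exI[of _ "\<epsilon> / eigval 0"]) auto
qed

text \<open>For a real eigenvector \<open>f\<close> also \<open>\<bar>f\<bar>\<close> maximises the quadratic form of \<open>K\<close>, so \<open>\<bar>f\<bar>\<close> and hence
  the positive and negative parts of \<open>f\<close> are eigenvectors; a nonzero one dominates a multiple of \<open>u\<close>,
  so that the other one vanishes.\<close>

lemma real_eigenspace0: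
  assumes f: "eigenspace0 f" and re: "AE x in M. Im (f x) = 0" and f0: "nrm f \<noteq> 0"
  shows "\<exists>\<delta>>0. f - cscale (of_real \<delta>) u \<in> pos_cone M \<or> - f - cscale (of_real \<delta>) u \<in> pos_cone M"
proof -
  have fL: "f \<in> L2 M" using f by simp
  let ?p = "pos_part f" and ?m = "pos_part (- f)"
  have pL: "?p \<in> L2 M" "?m \<in> L2 M" using fL by auto
  have pm: "?p \<in> pos_cone M" "?m \<in> pos_cone M" using fL by (auto intro: pos_part_pos)
  define a where "a = ?p + ?m"
  have aL: "a \<in> L2 M" using pL by (simp add: a_def)
  have fpm: "f \<simeq> ?p - ?m"
  proof -
    have "AE x in M. f x = (?p - ?m) x" using re by eventually_elim (auto simp: complex_eq_iff max_def)
    thus ?thesis using eqv_iff_AE[of f "?p - ?m"] fL pL by auto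
  qed
  have nrm_a: "nrm a = nrm f"
  proof (rule antisym)
    have "AE x in M. cmod (a x) = cmod (f x)"
      using re by eventually_elim (auto simp: a_def max_def cmod_eq_Re)
    thus "nrm a \<le> nrm f" "nrm f \<le> nrm a" using fL aL by (auto intro!: nrm_mono_AE elim: AE_mp)
  qed
  have Kadd: "l2_inner M (K a) h = l2_inner M (K ?p) h + l2_inner M (K ?m) h" if "h \<in> L2 M" for h
    using eqv_ip_left[OF sym_opD(4)[OF K_sym pL], of h] that pL by (simp add: a_def ip_simps)
  have Kdiff: "l2_inner M (K f) h = l2_inner M (K ?p) h - l2_inner M (K ?m) h" if "h \<in> L2 M" for h
  proof -
    have "l2_inner M (K f) h = l2_inner M (K (?p - ?m)) h"
      using sym_opD(3)[OF K_sym _ _ fpm] that fL pL by (intro eqv_ip_left) auto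
    also have "\<dots> = l2_inner M (K ?p - K ?m) h"
      using sym_opD(5)[OF K_sym pL] that pL by (intro eqv_ip_left) auto
    finally show ?thesis using that pL by (simp add: ip_simps)
  qed
  \<comment> \<open>Passing from \<open>?p - ?m\<close> to \<open>?p + ?m\<close> only reverses the
    sign of the cross terms, which are nonnegative since \<open>K\<close> is positive.\<close>
  have "Re (l2_inner M (K f) f) = Re (l2_inner M (K f) (?p - ?m))"
    using eqv_ip_right[OF fpm, of "K f"] fL pL by simp
  also have "\<dots> = Re (l2_inner M (K a) a) - 2 * Re (l2_inner M (K ?p) ?m) - 2 * Re (l2_inner M (K ?m) ?p)"
    using pL aL fL by (simp add: ip_diff_right Kdiff Kadd) (simp add: a_def ip_simps)
  also have "\<dots> \<le> Re (l2_inner M (K a) a)"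
    using pos_cone_ip(1)[OF K_pos[OF pm(1)] pm(2)] pos_cone_ip(1)[OF K_pos[OF pm(2)] pm(1)] by simp
  finally have "eigval 0 * (nrm f)\<^sup>2 \<le> Re (l2_inner M (K a) a)"
    using f eqv_ip_left[of "K f" "cscale (of_real (eigval 0)) f" f] fL by (simp add: ip_scl_left nrm_sq)
  hence "Re (l2_inner M (K a) a) = eigval 0 * (nrm a)\<^sup>2"
    using eigval_top[OF aL] nrm_a by simp
  hence ea: "K a \<simeq> cscale (of_real (eigval 0)) a" using maximizer_eigenspace0 aL by blast
  have Ka: "l2_inner M (K a) h = of_real (eigval 0) * l2_inner M a h" if "h \<in> L2 M" for h
    using eqv_ip_left[OF ea] aL that by (simp add: ip_scl_left)
  have Kf: "l2_inner M (K f) h = of_real (eigval 0) * (l2_inner M ?p h - l2_inner M ?m h)" if "h \<in> L2 M" for h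
    using f eqv_ip_left[of "K f" "cscale (of_real (eigval 0)) f" h] eqv_ip_left[OF fpm, of h] fL pL that
    by (simp add: ip_simps)
  have ep: "K ?p \<simeq> cscale (of_real (eigval 0)) ?p"
  proof (rule eqvI)
    fix h assume h: "h \<in> L2 M"
    have "2 * l2_inner M (K ?p) h = l2_inner M (K a) h + l2_inner M (K f) h" using Kadd Kdiff h by simp
    also have "\<dots> = 2 * (of_real (eigval 0) * l2_inner M ?p h)"
      unfolding Ka[OF h] Kf[OF h] using pL h by (simp add: a_def ip_simps algebra_simps)
    finally show "l2_inner M (K ?p) h = l2_inner M (cscale (of_real (eigval 0)) ?p) h"
      using pL h by (simp add: ip_scl_left)
  qed (use pL in auto)
  have em: "K ?m \<simeq> cscale (of_real (eigval 0)) ?m"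
  proof (rule eqvI)
    fix h assume h: "h \<in> L2 M"
    have "2 * l2_inner M (K ?m) h = l2_inner M (K a) h - l2_inner M (K f) h" using Kadd Kdiff h by simp
    also have "\<dots> = 2 * (of_real (eigval 0) * l2_inner M ?m h)"
      unfolding Ka[OF h] Kf[OF h] using pL h by (simp add: a_def ip_simps algebra_simps)
    finally show "l2_inner M (K ?m) h = l2_inner M (cscale (of_real (eigval 0)) ?m) h"
      using pL h by (simp add: ip_scl_left)
  qed (use pL in auto)
  \<comment> \<open>Where \<open>u\<close> is nonzero the positive part of \<open>g\<close> is
    strictly positive and so coincides with \<open>g\<close>. Where \<open>u\<close> vanishes the
    bound on the positive part would allow negative values of \<open>g\<close>; there
    \<open>u_support\<close> gives \<open>g x = 0\<close>.\<close>
  have dominate: "g - cscale (of_real \<delta>) u \<in> pos_cone M"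
    if g: "g \<in> L2 M" "AE x in M. Im (g x) = 0" "\<delta> > 0" "pos_part g - cscale (of_real \<delta>) u \<in> pos_cone M" for g \<delta>
  proof -
    have "AE x in M. Im ((g - cscale (of_real \<delta>) u) x) = 0 \<and> 0 \<le> Re ((g - cscale (of_real \<delta>) u) x)"
      using g(2) u_support[OF g(1)] pos_cone_AE[OF g(4)] pos_cone_AE[OF u]
    proof eventually_elim
      case (elim x)
      show ?case
      proof (cases "u x = 0")
        case False
        hence "Re (u x) > 0" using elim by (auto simp: complex_eq_iff less_le)
        hence "\<delta> * Re (u x) > 0" using g(3) by simp
        thus ?thesis using elim by (auto simp: max_def split: if_splits)
      qed (use elim in simp)
    qed
    thus ?thesis using g by (subst pos_cone_iff) auto
  qed
  show ?thesis
  proof (cases "nrm ?p = 0")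
    case False
    then obtain \<delta> where \<delta>: "\<delta> > 0" "?p - cscale (of_real \<delta>) u \<in> pos_cone M"
      using pos_eigenspace0[OF pm(1) _ ep] by blast
    thus ?thesis using dominate[OF fL re] by blast
  next
    case True
    have "nrm ?m \<noteq> 0"
    proof
      assume "nrm ?m = 0"
      hence "nrm f \<le> 0" using eqv_nrm[OF fpm] nrm_triangle_diff[of ?p ?m] fL pL True by simp
      thus False using f0 nrm_ge_0[OF fL] by linarith
    qed
    then obtain \<delta> where \<delta>: "\<delta> > 0" "?m - cscale (of_real \<delta>) u \<in> pos_cone M"
      using pos_eigenspace0[OF pm(2) _ em] by blast
    moreover have "AE x in M. Im ((- f) x) = 0" using re by simp
    ultimately show ?thesis using dominate[of "- f" \<delta>] fL by auto
  qed
qed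

lemma eigenspace0_parts:
  assumes f: "eigenspace0 f" shows "eigenspace0 (re_part f)" "eigenspace0 (im_part f)"
proof -
  have fL: "f \<in> L2 M" using f by simp
  have "AE x in M. K f x = of_real (eigval 0) * f x" using f eigenspace0_iff by blast
  hence "AE x in M. K (re_part f) x = of_real (eigval 0) * re_part f x \<and> K (im_part f) x = of_real (eigval 0) * im_part f x"
    using K_decomposition(1)[OF fL] K_real[OF fL] by eventually_elim (auto simp: complex_eq_iff)
  thus "eigenspace0 (re_part f)" "eigenspace0 (im_part f)"
    using fL eigenspace0_iff[of "re_part f"] eigenspace0_iff[of "im_part f"] by auto
qed

text \<open>\<open>eigvec 0\<close> was chosen with no control of its phase, but its real and
  imaginary parts are eigenvectors too and cannot both be null; a sign change then makes one of them
  positive.\<close>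

lemma eigenspace0_pos_exists:
  obtains q \<delta> where "eigenspace0 q" "\<delta> > 0" "q - cscale (of_real \<delta>) u \<in> pos_cone M"
proof -
  have e: "eigenspace0 (eigvec 0)" using eigvec_eq[of 0] by auto
  have "nrm (re_part (eigvec 0)) \<noteq> 0 \<or> nrm (im_part (eigvec 0)) \<noteq> 0"
  proof (rule ccontr)
    assume "\<not> ?thesis"
    moreover have "nrm (eigvec 0) \<le> nrm (re_part (eigvec 0)) + nrm (cscale \<i> (im_part (eigvec 0)))"
      using nrm_triangle[of "re_part (eigvec 0)" "cscale \<i> (im_part (eigvec 0))"] re_im_decomposition[of "eigvec 0"] by auto
    ultimately show False using eigvec_norm[OF eigval_0(1)] by (simp add: nrm_scl)
  qed
  then obtain f where f: "eigenspace0 f" "AE x in M. Im (f x) = 0" "nrm f \<noteq> 0"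
  proof
    assume "nrm (re_part (eigvec 0)) \<noteq> 0"
    thus ?thesis using that[of "re_part (eigvec 0)"] eigenspace0_parts(1)[OF e] by simp
  next
    assume "nrm (im_part (eigvec 0)) \<noteq> 0"
    thus ?thesis using that[of "im_part (eigvec 0)"] eigenspace0_parts(2)[OF e] by simp
  qed
  obtain \<delta> where d: "\<delta> > 0" "f - cscale (of_real \<delta>) u \<in> pos_cone M \<or> - f - cscale (of_real \<delta>) u \<in> pos_cone M"
    using real_eigenspace0[OF f] by blast
  have "eigenspace0 (- f)"
  proof -
    have "K (- f) \<simeq> cscale (of_real (eigval 0)) (- f)"
    proof (rule eqvI)
      fix h assume h: "h \<in> L2 M"
      have "l2_inner M (K (- f)) h = - l2_inner M (K f) h"
        using f h by (simp add: K_ip ip_minus_left)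
      thus "l2_inner M (K (- f)) h = l2_inner M (cscale (of_real (eigval 0)) (- f)) h"
        using f h eqv_ip_left[of "K f" "cscale (of_real (eigval 0)) f" h] by (simp add: ip_simps)
    qed (use f in auto)
    thus ?thesis using f by auto
  qed
  thus ?thesis using that f(1) d by blast
qed

lemma ip_lower_bound:
  assumes f: "f \<in> pos_cone M" and g: "g - cscale (of_real \<delta>) u \<in> pos_cone M" "g \<in> L2 M"
  shows "\<delta> * Re (l2_inner M f u) \<le> Re (l2_inner M f g)"
  using pos_cone_ip(1)[OF f g(1)] pos_cone_L2[OF f] g(2) by (simp add: ip_simps)

text \<open>A real nonzero eigenvector has one sign and dominates a multiple of \<open>u\<close>, so
  it cannot be orthogonal to \<open>q\<close>. As \<open>q\<close> is real, orthogonality of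
  \<open>g\<close> to \<open>q\<close> passes to the conjugate of \<open>g\<close>, hence to its
  real and imaginary parts.\<close>

lemma eigenspace0_simple:
  assumes q: "eigenspace0 q" "\<delta> > 0" "q - cscale (of_real \<delta>) u \<in> pos_cone M"
    and g: "eigenspace0 g" "l2_inner M g q = 0"
  shows "nrm g = 0"
proof -
  have gL: "g \<in> L2 M" and qL: "q \<in> L2 M" using q g by auto
  have "cscale (of_real \<delta>) u \<in> pos_cone M" using q(2) u by (intro pos_cone_scale) auto
  from pos_cone_add[OF q(3) this] have qp: "q \<in> pos_cone M" by simp
  have conj_q: "conj_fun q \<simeq> q"
  proof -
    have "AE x in M. conj_fun q x = q x" using pos_cone_AE[OF qp] by eventually_elim (simp add: complex_eq_iff)
    thus ?thesis using eqv_iff_AE[of "conj_fun q" q] qL by auto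
  qed
  have no: "l2_inner M f q \<noteq> 0" if f: "eigenspace0 f" "AE x in M. Im (f x) = 0" "nrm f \<noteq> 0" for f
  proof -
    obtain \<eta> where \<eta>: "\<eta> > 0" "f - cscale (of_real \<eta>) u \<in> pos_cone M \<or> - f - cscale (of_real \<eta>) u \<in> pos_cone M"
      using real_eigenspace0[OF f] by blast
    have fL: "f \<in> L2 M" using f by simp
    have uq: "0 < \<eta> * Re (l2_inner M q u)"
    proof -
      have "\<delta> * (nrm u)\<^sup>2 \<le> Re (l2_inner M q u)"
        using ip_lower_bound[OF u q(3) qL] Re_ip_commute[OF qL u_L2] by (simp add: nrm_sq)
      moreover have "0 < \<delta> * (nrm u)\<^sup>2" using q(2) nrm_u by simp
      ultimately show ?thesis using \<eta>(1) by simp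
    qed
    from \<eta>(2) show ?thesis
    proof
      assume "f - cscale (of_real \<eta>) u \<in> pos_cone M"
      hence "0 < Re (l2_inner M q f)" using ip_lower_bound[OF qp _ fL] uq by fastforce
      thus ?thesis using Re_ip_commute[OF qL fL] by auto
    next
      assume "- f - cscale (of_real \<eta>) u \<in> pos_cone M"
      hence "0 < Re (l2_inner M q (- f))" using ip_lower_bound[OF qp _ H_minus[OF fL]] uq by fastforce
      thus ?thesis using Re_ip_commute[OF qL fL] qL fL by (auto simp: ip_simps)
    qed
  qed
  have "l2_inner M (conj_fun g) q = cnj (l2_inner M g (conj_fun q))" by (rule ip_conj_fun)
  also have "\<dots> = 0" using eqv_ip_right[OF conj_q, of g] g(2) gL qL by simp
  finally have cg: "l2_inner M (conj_fun g) q = 0" .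
  have "re_part g = cscale (1/2) (g + conj_fun g)" "im_part g = cscale (1 / (2 * \<i>)) (g - conj_fun g)"
    by (auto simp: fun_eq_iff complex_eq_iff)
  hence "l2_inner M (re_part g) q = 0" "l2_inner M (im_part g) q = 0"
    using g(2) cg gL qL by (simp_all add: ip_simps)
  hence "nrm (re_part g) = 0" "nrm (im_part g) = 0"
    using no[of "re_part g"] no[of "im_part g"] eigenspace0_parts[OF g(1)] by auto
  moreover have "nrm g \<le> nrm (re_part g) + nrm (cscale \<i> (im_part g))"
    using nrm_triangle[of "re_part g" "cscale \<i> (im_part g)"] re_im_decomposition[of g] gL by auto
  ultimately have "nrm g \<le> 0" using gL by (simp add: nrm_scl)
  thus ?thesis using nrm_ge_0[OF gL] by linarith
qed

lemma eigenspace0_multiple: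
  assumes q: "eigenspace0 q" "\<delta> > 0" "q - cscale (of_real \<delta>) u \<in> pos_cone M" and g: "eigenspace0 g"
  obtains b where "g \<simeq> cscale b q"
proof -
  have gL: "g \<in> L2 M" and qL: "q \<in> L2 M" using q g by auto
  have "nrm q \<noteq> 0"
  proof
    assume "nrm q = 0"
    hence "l2_inner M u q = 0" using norm_ip_le[OF u_L2 qL] by simp
    thus False using ip_lower_bound[OF u q(3) qL] q(2) nrm_u by (simp add: nrm_sq[symmetric] mult_le_0_iff)
  qed
  define b where "b = l2_inner M g q / l2_inner M q q"
  define d where "d = g - cscale b q"
  have dL: "d \<in> L2 M" using gL qL by (auto simp: d_def)
  have "l2_inner M d q = 0" using gL qL \<open>nrm q \<noteq> 0\<close> by (simp add: d_def b_def ip_simps ip_self)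
  moreover have "eigenspace0 d"
  proof -
    have "K d \<simeq> cscale (of_real (eigval 0)) d"
    proof (rule eqvI)
      fix h assume h: "h \<in> L2 M"
      have "l2_inner M (K d) h = l2_inner M (K g) h - b * l2_inner M (K q) h"
        using gL qL dL h by (simp add: K_ip) (simp add: d_def ip_simps)
      thus "l2_inner M (K d) h = l2_inner M (cscale (of_real (eigval 0)) d) h"
        using g q h eqv_ip_left[of "K g" "cscale (of_real (eigval 0)) g" h]
          eqv_ip_left[of "K q" "cscale (of_real (eigval 0)) q" h] dL
        by (simp add: ip_scl_left) (simp add: d_def ip_simps algebra_simps)
    qed (use dL in auto)
    thus ?thesis using dL by simp
  qed
  ultimately have "nrm d = 0" using eigenspace0_simple[OF q] by blast
  thus ?thesis by (intro that[of b]) (simp add: eqv_def d_def)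
qed

text \<open>With equal eigenvalues both eigenvectors would be nonzero multiples of the same
  \<open>q\<close>, which contradicts their orthogonality.\<close>

lemma eigval_gap: assumes n: "n \<ge> 1" "eigvec n \<noteq> 0" shows "eigval n < eigval 0"
proof (rule ccontr)
  assume "\<not> ?thesis"
  hence eq: "eigval n = eigval 0" using eigval_antimono(2)[of 0 n] n by simp
  obtain q \<delta> where q: "eigenspace0 q" "\<delta> > 0" "q - cscale (of_real \<delta>) u \<in> pos_cone M"
    using eigenspace0_pos_exists by blast
  have qL: "q \<in> L2 M" using q by simp
  have e: "eigenspace0 (eigvec n)" "eigenspace0 (eigvec 0)" using eigvec_eq[of n] eigvec_eq[of 0] eq by auto
  obtain b where b: "eigvec n \<simeq> cscale b q" using eigenspace0_multiple[OF q e(1)] by blast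
  obtain b' where b': "eigvec 0 \<simeq> cscale b' q" using eigenspace0_multiple[OF q e(2)] by blast
  have nb: "cmod b * nrm q = 1" "cmod b' * nrm q = 1"
    using eqv_nrm[OF b] eqv_nrm[OF b'] eigvec_norm[OF n(2)] eigvec_norm[OF eigval_0(1)] qL by (auto simp: nrm_scl)
  have "l2_inner M (eigvec n) (eigvec 0) = 0" using n by (intro eigvec_orth) auto
  moreover have "l2_inner M (eigvec n) (eigvec 0) = b * (cnj b' * l2_inner M q q)"
  proof -
    have "l2_inner M (eigvec n) (eigvec 0) = l2_inner M (cscale b q) (eigvec 0)"
      using qL by (intro eqv_ip_left b) auto
    also have "\<dots> = l2_inner M (cscale b q) (cscale b' q)"
      using qL by (intro eqv_ip_right b') auto
    also have "\<dots> = b * (cnj b' * l2_inner M q q)" using qL by (simp add: ip_simps)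
    finally show ?thesis .
  qed
  ultimately show False using nb qL by (auto simp: ip_self)
qed

text \<open>Conjugation commutes with \<open>K\<close>, hence preserves the eigenspaces.\<close>

lemma semigroup_real:
  assumes S: "c0_sg S" "gen S = res_graph l" and t: "t \<ge> 0" and f: "f \<in> L2 M" "conj_fun f \<simeq> f"
  shows "AE x in M. Im (S t f x) = 0"
proof -
  define h where "h = S t f"
  have hL: "h \<in> L2 M" using bdd_opD(1)[OF sg_bdd[OF S(1) t] f(1)] by (simp add: h_def)
  have hc: "l2_inner M h (eigvec m) = of_real (exp (t * log_eig l m)) * l2_inner M f (eigvec m)" for m
    unfolding h_def by (rule semigroup_coef[OF S t f(1)])
  have "conj_fun h \<simeq> h"
  proof (rule eqv_coef)
    fix n
    show "l2_inner M (conj_fun h) (eigvec n) = l2_inner M h (eigvec n)"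
    proof (cases "eigvec n = 0")
      case False
      let ?E = "of_real (exp (t * log_eig l n)) :: complex"
      define j where "j = conj_fun (eigvec n)"
      have jL: "j \<in> L2 M" by (auto simp: j_def)
      have Kj: "l2_inner M (K j) g = of_real (eigval n) * l2_inner M j g" if g: "g \<in> L2 M" for g
      proof -
        have "l2_inner M (K j) g = l2_inner M (conj_fun (K (eigvec n))) g"
          unfolding j_def using g by (intro eqv_ip_left K_conj) auto
        also have "\<dots> = cnj (l2_inner M (K (eigvec n)) (conj_fun g))" by (rule ip_conj_fun)
        also have "l2_inner M (K (eigvec n)) (conj_fun g) = l2_inner M (cscale (of_real (eigval n)) (eigvec n)) (conj_fun g)"
          using g by (intro eqv_ip_left eigvec_eq) auto
        also have "cnj \<dots> = of_real (eigval n) * l2_inner M j g"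
          using g by (simp add: ip_scl_left j_def ip_conj_fun)
        finally show ?thesis .
      qed
      \<comment> \<open>The conjugate of \<open>eigvec n\<close> need not be a multiple of
        \<open>eigvec n\<close> when the eigenvalue is multiple, but its coefficients vanish outside
        the indices with the same eigenvalue, and there the exponential factors agree.\<close>
      have term_eq: "l2_inner M h (eigvec m) * cnj (l2_inner M j (eigvec m))
          = ?E * (l2_inner M f (eigvec m) * cnj (l2_inner M j (eigvec m)))" for m
      proof (cases "l2_inner M j (eigvec m) = 0")
        case nz: False
        hence m0: "eigvec m \<noteq> 0" using jL by auto
        have "of_real (eigval n) * l2_inner M j (eigvec m) = of_real (eigval m) * l2_inner M j (eigvec m)"
          using Kj[OF eigvec_H, of m] ip_K_eigvec[OF jL, of m] by (rule trans[OF sym])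
        hence "eigval n = eigval m" using nz by simp
        thus ?thesis using m0 False by (simp add: hc log_eig_def)
      qed simp
      have "(\<lambda>m. ?E * (l2_inner M f (eigvec m) * cnj (l2_inner M j (eigvec m)))) sums (?E * l2_inner M f j)"
        using f jL by (intro sums_mult ip_sums) auto
      moreover have "(\<lambda>m. ?E * (l2_inner M f (eigvec m) * cnj (l2_inner M j (eigvec m)))) sums l2_inner M h j"
        using ip_sums[OF hL jL] by (simp only: term_eq)
      ultimately have "l2_inner M h j = ?E * l2_inner M f j" using sums_unique2 by blast
      moreover have "l2_inner M (conj_fun h) (eigvec n) = cnj (l2_inner M h j)"
        unfolding j_def by (rule ip_conj_fun)
      moreover have "cnj (l2_inner M f j) = l2_inner M (conj_fun f) (eigvec n)"
        unfolding j_def by (rule ip_conj_fun[symmetric])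
      moreover have "\<dots> = l2_inner M f (eigvec n)" using f by (intro eqv_ip_left) auto
      ultimately show ?thesis by (simp add: hc)
    qed (use hL in simp)
  qed (use hL in auto)
  hence "AE x in M. conj_fun h x = h x" using eqv_iff_AE[of "conj_fun h" h] hL by blast
  thus ?thesis unfolding h_def by eventually_elim (simp add: complex_eq_iff)
qed

section \<open>Uniform eventual positivity\<close>

text \<open>The dual of the pointwise bound: the square of \<open>nrm (K f)\<close> is the pairing
  of \<open>f\<close> with \<open>K (K f)\<close>, and \<open>K (K f)\<close> is at most
  \<open>k * nrm (K f)\<close> times \<open>u\<close>. Positivity of \<open>f\<close> preserves the
  inequality.\<close>

lemma nrm_K_le: assumes f: "f \<in> pos_cone M" shows "nrm (K f) \<le> k * Re (l2_inner M f u)"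
proof (cases "nrm (K f) = 0")
  case True
  thus ?thesis using pos_cone_ip(1)[OF f u] k(1) by simp
next
  case False
  have fL: "f \<in> L2 M" using f by auto
  let ?C = "k * nrm (K f)"
  have "cscale (of_real ?C) u - K (K f) \<in> pos_cone M"
  proof (subst pos_cone_iff, intro conjI)
    show "AE x in M. Im ((cscale (of_real ?C) u - K (K f)) x) = 0 \<and> 0 \<le> Re ((cscale (of_real ?C) u - K (K f)) x)"
      using k(2)[OF K_L2[OF fL]] pos_cone_AE[OF u] pos_cone_AE[OF K_pos[OF K_pos[OF f]]]
    proof eventually_elim
      case (elim x)
      thus ?case using complex_Re_le_cmod[of "K (K f) x"] by simp
    qed
  qed (use fL in auto)
  from pos_cone_ip(1)[OF f this] have "Re (l2_inner M f (K (K f))) \<le> ?C * Re (l2_inner M f u)"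
    using fL by (simp add: ip_simps)
  moreover have "Re (l2_inner M f (K (K f))) = nrm (K f) * nrm (K f)"
    using K_ip[of f "K f"] nrm_sq[of "K f"] fL by (simp add: power2_eq_square)
  ultimately have "nrm (K f) * nrm (K f) \<le> (k * Re (l2_inner M f u)) * nrm (K f)"
    by (simp only: ac_simps)
  moreover have "nrm (K f) > 0" using False fL by (simp add: less_le)
  ultimately show ?thesis by (simp only: mult_le_cancel_right_pos)
qed

text \<open>If the pairing vanished, \<open>nrm_K_le\<close> would make \<open>K f\<close> null,
  against injectivity.\<close>

lemma ip_u_pos: assumes f: "f \<in> pos_cone M" "nrm f \<noteq> 0" shows "Re (l2_inner M f u) > 0"
proof (rule ccontr)
  assume "\<not> ?thesis"
  hence "k * Re (l2_inner M f u) \<le> 0" using k(1) by (simp add: mult_nonneg_nonpos)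
  hence "nrm (K f) \<le> 0" using nrm_K_le[OF f(1)] by simp
  hence "nrm (K f) = 0" using pos_cone_L2[OF f(1)] nrm_ge_0[OF K_L2] by (meson antisym)
  thus False using K_inj f pos_cone_L2 by blast
qed

lemma semigroup_eventually_positive:
  assumes S: "c0_sg S" "gen S = res_graph l"
  shows "unif_eventually_strongly_positive M u S"
proof -
  let ?e = eigvec and ?\<mu> = "log_eig l"
  obtain q \<delta> where q: "eigenspace0 q" "\<delta> > 0" "q - cscale (of_real \<delta>) u \<in> pos_cone M"
    using eigenspace0_pos_exists by blast
  have qL: "q \<in> L2 M" using q by simp
  have "eigenspace0 (?e 0)" using eigvec_eq[of 0] by auto
  then obtain b where b: "?e 0 \<simeq> cscale b q" using eigenspace0_multiple[OF q] by blast
  have b0: "cmod b > 0"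
    using eqv_nrm[OF b] eigvec_norm[OF eigval_0(1)] qL by (auto simp: nrm_scl)
  \<comment> \<open>If the sequence stops after \<open>eigvec 0\<close>, the condition is void and
    any positive value will do; otherwise the difference of the first two values works.\<close>
  obtain \<gamma> where \<gamma>: "\<gamma> > 0" "\<And>n. n \<ge> 1 \<Longrightarrow> ?e n \<noteq> 0 \<Longrightarrow> ?\<mu> n \<le> ?\<mu> 0 - \<gamma>"
  proof (cases "?e 1 = 0")
    case True
    show ?thesis
    proof (rule that[of 1])
      fix n :: nat assume "n \<ge> 1" "?e n \<noteq> 0"
      thus "?\<mu> n \<le> ?\<mu> 0 - 1" using eigval_antimono(1)[of 1 n] True by simp
    qed simp
  next
    case False
    show ?thesis
    proof (rule that[of "?\<mu> 0 - ?\<mu> 1"])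
      have "1 / eigval 0 < 1 / eigval 1"
        using eigval_gap[of 1] eigval_pos[OF False] False by (intro divide_strict_left_mono) auto
      thus "?\<mu> 0 - ?\<mu> 1 > 0" using False eigval_0(1) by (simp add: log_eig_def)
      fix n :: nat assume "n \<ge> 1" "?e n \<noteq> 0"
      thus "?\<mu> n \<le> ?\<mu> 0 - (?\<mu> 0 - ?\<mu> 1)" using log_eig_antimono[of 1 n l] by simp
    qed
  qed
  have l0: "?\<mu> 0 \<le> l" using eigval_0 by (simp add: log_eig_def)
  \<comment> \<open>\<open>D / t\<^sup>2\<close> is the factor in \<open>exp_gap_bound\<close>.
    \<open>A\<close> below is the constant of the leading term: \<open>(cmod b)\<^sup>2\<close>
    because \<open>eigvec 0\<close> is \<open>b\<close> times \<open>q\<close>, one \<delta> from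
    pairing \<open>f\<close> with \<open>q\<close>, and one from \<open>q\<close> dominating
    \<delta> times \<open>u\<close>.\<close>
  define D where "D = 4 * (1 + (l - ?\<mu> 0) / \<gamma>)\<^sup>2"
  define A where "A = (cmod b)\<^sup>2 * \<delta>\<^sup>2"
  have D0: "D \<ge> 0" by (simp add: D_def)
  have A0: "A > 0" using b0 q(2) by (simp add: A_def)
  \<comment> \<open>From this time on the remainder is at most half of the leading term, as
    \<open>kD\<close> shows; the summand 1 keeps \<open>t\<close> away from 0.\<close>
  define t0 where "t0 = 1 + sqrt (2 * k\<^sup>2 * D / A)"
  have t01: "t0 \<ge> 1" using D0 A0 by (simp add: t0_def)
  have main: "strongly_positive M u (S t f)" if t: "t \<ge> t0" and f: "positive_nonzero M f" for t f
  proof -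
    have tp: "t > 0" using t t01 by linarith
    have fp: "f \<in> pos_cone M" "nrm f \<noteq> 0" using f positive_nonzero_iff by auto
    have fL: "f \<in> L2 M" using fp by auto
    define F where "F = Re (l2_inner M f u)"
    have F: "F > 0" using ip_u_pos[OF fp] by (simp add: F_def)
    have kD: "k\<^sup>2 * D / t\<^sup>2 \<le> A / 2"
    proof -
      have "2 * k\<^sup>2 * D / A = (sqrt (2 * k\<^sup>2 * D / A))\<^sup>2" using D0 A0 by simp
      also have "\<dots> \<le> t\<^sup>2" using t D0 A0 by (intro power_mono) (auto simp: t0_def)
      finally show ?thesis using A0 tp by (simp add: field_simps)
    qed
    define E where "E = exp (t * ?\<mu> 0)"
    have E: "E > 0" by (simp add: E_def)
    \<comment> \<open>The two applications of \<open>K\<close> in \<open>K g\<close> multiply the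
      n-th coefficient by the square of \<open>eigval n\<close>, which the last factor undoes. The
      value 0 at index 0 takes out the leading term, treated separately as \<open>h\<close>.\<close>
    define \<psi> where "\<psi> n = (if n = 0 then 0 else exp (t * ?\<mu> n) * (1 / eigval n)\<^sup>2)" for n
    define C where "C = E * (D / t\<^sup>2)"
    have C0: "C \<ge> 0" using E D0 by (simp add: C_def)
    have \<psi>: "\<bar>\<psi> n\<bar> \<le> C" if "?e n \<noteq> 0" for n
    proof (cases "n = 0")
      case False
      hence "exp (t * ?\<mu> n) * (l - ?\<mu> n)\<^sup>2 \<le> C"
        unfolding C_def D_def E_def using \<gamma> that tp l0 by (intro exp_gap_bound) auto
      moreover have "l - ?\<mu> n = 1 / eigval n" using that by (simp add: log_eig_def)
      ultimately show ?thesis using False by (simp add: \<psi>_def)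
    qed (use C0 in \<open>simp add: \<psi>_def\<close>)
    have bm: "bounded_mult \<psi>" unfolding bounded_mult_def using \<psi> C0 by blast
    define g where "g = mult_op \<psi> (K f)"
    have gL: "g \<in> L2 M" unfolding g_def using mult_op(1)[OF bm] fL by auto
    have gc: "l2_inner M g (?e n) = of_real (\<psi> n) * l2_inner M (K f) (?e n)" for n
      unfolding g_def using mult_op(2)[OF bm] fL by auto
    have ng: "nrm g \<le> C * nrm (K f)"
    proof (rule nrm_le_coef)
      fix n show "cmod (l2_inner M g (?e n)) \<le> C * cmod (l2_inner M (K f) (?e n))"
      proof (cases "?e n = 0")
        case False
        thus ?thesis using \<psi>[OF False] by (simp add: gc norm_mult mult_right_mono)
      qed (use gL fL in simp)
    qed (use gL fL C0 in auto)
    define h where "h = cscale (of_real E * l2_inner M f (?e 0)) (?e 0)"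
    have hL: "h \<in> L2 M" by (auto simp: h_def)
    have SL: "S t f \<in> L2 M" using bdd_opD(1)[OF sg_bdd[OF S(1)] fL] tp by simp
    have "S t f \<simeq> h + K g"
    proof (rule eqv_coef)
      fix n
      have Sc: "l2_inner M (S t f) (?e n) = of_real (exp (t * ?\<mu> n)) * l2_inner M f (?e n)"
        using tp by (intro semigroup_coef[OF S _ fL]) simp
      have hc: "l2_inner M (h + K g) (?e n) = of_real E * l2_inner M f (?e 0) * l2_inner M (?e 0) (?e n)
          + of_real (eigval n) * (of_real (\<psi> n) * (of_real (eigval n) * l2_inner M f (?e n)))"
        using hL gL fL by (simp add: ip_add_left ip_K_eigvec gc) (simp add: h_def ip_scl_left)
      show "l2_inner M (S t f) (?e n) = l2_inner M (h + K g) (?e n)"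
      proof (cases "n = 0")
        case True
        thus ?thesis unfolding Sc hc using eigvec_norm[OF eigval_0(1)] by (simp add: ip_self \<psi>_def E_def)
      next
        case n0: False
        show ?thesis
        proof (cases "?e n = 0")
          case False
          hence "eigval n \<noteq> 0" using eigval_pos[of n] by simp
          thus ?thesis unfolding Sc hc using n0 by (simp add: eigvec_orth \<psi>_def power2_eq_square)
        qed (use SL hL gL in simp)
      qed
    qed (use SL hL gL in auto)
    hence SAE: "AE x in M. S t f x = h x + K g x" using eqv_iff_AE[of "S t f" "h + K g"] SL hL gL by simp
    have qp: "q \<in> pos_cone M"
      using pos_cone_add[OF q(3) pos_cone_scale[OF u less_imp_le[OF q(2)]]] by simp
    define Q where "Q = Re (l2_inner M f q)"
    have Q: "l2_inner M f q = of_real Q" using pos_cone_ip(2)[OF fp(1) qp] by (simp add: Q_def complex_eq_iff)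
    have QF: "\<delta> * F \<le> Q" unfolding Q_def F_def using ip_lower_bound[OF fp(1) q(3) qL] .
    have fe: "l2_inner M f (?e 0) = cnj b * of_real Q"
      using eqv_ip_right[OF b, of f] fL qL by (simp add: ip_scl_right Q)
    have eAE: "AE x in M. ?e 0 x = b * q x" using eqv_iff_AE[of "?e 0" "cscale b q"] b qL by simp
    have nKf: "nrm (K f) \<le> k * F" unfolding F_def by (rule nrm_K_le[OF fp(1)])
    \<comment> \<open>The bound on \<open>K g\<close> controls only its modulus, so the vanishing of
      the imaginary part of \<open>S t f\<close> needs an argument of its own.\<close>
    have realS: "AE x in M. Im (S t f x) = 0"
    proof (rule semigroup_real[OF S _ fL])
      have "AE x in M. conj_fun f x = f x"
        using pos_cone_AE[OF fp(1)] by eventually_elim (simp add: complex_eq_iff)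
      thus "conj_fun f \<simeq> f" using eqv_iff_AE[of "conj_fun f" f] fL by auto
    qed (use tp in simp)
    define \<epsilon> where "\<epsilon> = E * F * (A / 2)"
    have \<epsilon>: "\<epsilon> > 0" using E F A0 by (simp add: \<epsilon>_def)
    have "AE x in M. Im ((S t f - cscale (of_real \<epsilon>) u) x) = 0 \<and> 0 \<le> Re ((S t f - cscale (of_real \<epsilon>) u) x)"
      using SAE eAE realS k(2)[OF gL] pos_cone_AE[OF u] pos_cone_AE[OF q(3)]
    proof eventually_elim
      case (elim x)
      define U where "U = Re (u x)"
      have U: "U \<ge> 0" "Im (u x) = 0" using elim(5) by (auto simp: U_def)
      have qU: "\<delta> * U \<le> Re (q x)" using elim(6) by (simp add: U_def)
      \<comment> \<open>The unknown phase of \<open>eigvec 0\<close> cancels: \<open>b\<close>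
        enters once through \<open>eAE\<close> and once, conjugated, through
        \<open>fe\<close>.\<close>
      have "h x = of_real (E * (cmod b)\<^sup>2 * Q) * q x"
        using elim(2) complex_norm_square[of b] by (simp add: h_def fe ac_simps)
      hence "Re (h x) = E * (cmod b)\<^sup>2 * (Q * Re (q x))" by simp
      moreover have "(\<delta> * F) * (\<delta> * U) \<le> Q * Re (q x)"
        using QF qU q(2) F U(1) by (intro mult_mono) (auto intro: order_trans[OF mult_nonneg_nonneg QF])
      ultimately have "E * (cmod b)\<^sup>2 * ((\<delta> * F) * (\<delta> * U)) \<le> Re (h x)"
        using E by (simp add: mult_left_mono)
      hence 1: "E * F * A * U \<le> Re (h x)" by (simp add: A_def power2_eq_square ac_simps)
      have "k * nrm g * U \<le> k * (C * (k * F)) * U"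
        using ng mult_left_mono[OF nKf C0] k(1) U(1) by (intro mult_right_mono mult_left_mono) auto
      also have "\<dots> = E * F * (k\<^sup>2 * D / t\<^sup>2) * U" by (simp add: C_def power2_eq_square)
      also have "\<dots> \<le> E * F * (A / 2) * U"
        using kD E F U(1) by (intro mult_right_mono mult_left_mono) auto
      finally have "cmod (K g x) \<le> E * F * (A / 2) * U" using elim(4) by (simp add: U_def)
      hence 2: "- (E * F * (A / 2) * U) \<le> Re (K g x)" using abs_Re_le_cmod[of "K g x"] by linarith
      have "\<epsilon> * U \<le> Re (S t f x)" using 1 2 elim(1) by (simp add: \<epsilon>_def)
      thus ?case using elim(3) U by (simp add: U_def)
    qed
    hence "S t f - cscale (of_real \<epsilon>) u \<in> pos_cone M" using SL by (subst pos_cone_iff) auto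
    thus ?thesis using strongly_positive_iff[OF SL u] \<epsilon> by blast
  qed
  show ?thesis unfolding unif_eventually_strongly_positive_def
    using main t01 by (intro exI[of _ t0]) auto
qed

end

section \<open>The theorem\<close>

theorem theorem4p9:
  fixes M :: "'a measure"
    and u :: "'a \<Rightarrow> complex"
    and T :: "real \<Rightarrow> ('a \<Rightarrow> complex) \<Rightarrow> ('a \<Rightarrow> complex)"
    and A :: "(('a \<Rightarrow> complex) \<times> ('a \<Rightarrow> complex)) set"
    and B :: "('a \<Rightarrow> complex) \<Rightarrow> ('a \<Rightarrow> complex)"
    and \<mu>\<^sub>1 :: real
  assumes "\<exists>f\<in>L2 M. \<not> eq_ae M f (\<lambda>x. 0)"
    and "u \<in> pos_cone M" and "quasi_interior M u"
    and "C0_semigroup M T" and "A = generator M T"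
    and "self_adjoint_semigroup M T" and "real_semigroup M T"
    and "Domain A \<subseteq> principal_ideal M u"
    and "spectral_bound M A < ereal \<mu>\<^sub>1"
    and "\<And>r::real. spectral_bound M A < ereal r \<Longrightarrow> r < \<mu>\<^sub>1 \<Longrightarrow>
           strongly_positive_op M u (resolvent M A (complex_of_real r))"
    and "bounded_op M B" and "positive_op M B" and "self_adjoint_op M B"
    and "ereal (op_norm M B) < ereal \<mu>\<^sub>1 - spectral_bound M A"
  shows "(\<exists>S. C0_semigroup M S \<and> generator M S = add_bounded M A B) \<and>
         (\<forall>S. C0_semigroup M S \<and> generator M S = add_bounded M A B \<longrightarrow>
            unif_eventually_strongly_positive M u S)"
proof -
  interpret L2_space M .
  have sg: "c0_sg T" and A: "A = gen T" using assms(4,5) by (simp_all add: C0_semigroup_iff generator_eq)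
  have T_sym: "sym_op (T t)" if "t \<ge> 0" for t
    using assms(6) that by (simp add: self_adjoint_semigroup_def self_adjoint_op_iff)
  have B: "bdd_op B" "sym_op B" using assms(13) by (simp_all add: self_adjoint_op_iff)
  have B_pos: "f \<in> pos_cone M \<Longrightarrow> B f \<in> pos_cone M" for f using assms(12) by (auto simp: positive_op_def)
  define \<beta> where "\<beta> = opn B"
  have \<beta>: "\<beta> \<ge> 0" unfolding \<beta>_def by (rule opn_ge_0[OF B(1)])
  have B_bound: "nrm (B f) \<le> \<beta> * nrm f" if "f \<in> L2 M" for f
    unfolding \<beta>_def by (rule opn_bound[OF B(1) that])
  \<comment> \<open>A real substitute for the spectral bound, which is an extended real: its value
    when finite, and otherwise a number far enough below \<open>\<mu>\<^sub>1\<close>.\<close>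
  obtain s :: real where s: "spectral_bound M A \<le> ereal s" "\<beta> < \<mu>\<^sub>1 - s"
  proof (cases "spectral_bound M A")
    case (real r)
    thus ?thesis using assms(14) by (intro that[of r]) (simp_all add: \<beta>_def op_norm_opn)
  next
    case MInf
    thus ?thesis by (intro that[of "\<mu>\<^sub>1 - \<beta> - 1"]) auto
  qed (use assms(9) in auto)
  \<comment> \<open>The midpoint of the interval from \<open>s + \<beta>\<close> to
    \<open>\<mu>\<^sub>1\<close>: above the left end the Neumann series converges, below the right
    end the resolvent of A is strongly positive.\<close>
  define l where "l = (s + \<beta> + \<mu>\<^sub>1) / 2"
  have l: "s + \<beta> < l" "s < l" "l < \<mu>\<^sub>1" using s(2) \<beta> by (auto simp: l_def)
  have in_res: "complex_of_real r \<in> resolvent_set M A" if "s < r" for r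
  proof (rule ccontr)
    assume "\<not> ?thesis"
    hence "ereal (Re (complex_of_real r)) \<le> spectral_bound M A"
      unfolding spectral_bound_def by (intro SUP_upper) (simp add: op_spectrum_def)
    hence "ereal r \<le> spectral_bound M A" by simp
    also note s(1)
    finally show False using that by simp
  qed
  have res: "\<exists>h. (resolvent M A (complex_of_real r) f, h) \<in> gen T \<and>
      cscale (of_real r) (resolvent M A (complex_of_real r) f) - h \<simeq> f" if r: "s < r" and f: "f \<in> L2 M" for r f
  proof -
    have "\<exists>g. resolvent_eq M A (complex_of_real r) g f" using in_res[OF r] f by (auto simp: resolvent_set_def)
    from someI_ex[OF this]
    have "resolvent_eq M A (complex_of_real r) (resolvent M A (complex_of_real r) f) f" by (simp add: resolvent_def)
    then obtain h where h: "(resolvent M A (complex_of_real r) f, h) \<in> gen T"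
        "eq_ae M (\<lambda>x. complex_of_real r * resolvent M A (complex_of_real r) f x - h x) f"
      by (auto simp: resolvent_eq_def A)
    have "(\<lambda>x. complex_of_real r * resolvent M A (complex_of_real r) f x - h x)
        = cscale (of_real r) (resolvent M A (complex_of_real r) f) - h" by (auto simp: fun_eq_iff)
    with h show ?thesis using gen_H[OF sg h(1)] f by (auto simp: eqv_iff_eq_ae)
  qed
  have res_bdd: "bdd_op (resolvent M A (complex_of_real r))" if "s < r" for r
    using in_res[OF that] by (simp add: resolvent_set_def bounded_op_iff)
  have form: "Re (l2_inner M g f) \<le> s * (nrm f)\<^sup>2" if "(f, g) \<in> gen T" for f g
  proof (rule gen_form_bound[OF sg T_sym _ that])
    fix r assume r: "s < r"
    obtain C where C: "\<And>f. f \<in> L2 M \<Longrightarrow> nrm (resolvent M A (complex_of_real r) f) \<le> C * nrm f"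
      using bdd_op_bound[OF res_bdd[OF r]] by blast
    have "\<exists>g h. (g, h) \<in> gen T \<and> cscale (of_real r) g - h \<simeq> f \<and> nrm g \<le> C * nrm f" if "f \<in> L2 M" for f
      by (rule exI[of _ "resolvent M A (complex_of_real r) f"]) (use res[OF r that] C[OF that] in auto)
    thus "\<exists>C. \<forall>f\<in>L2 M. \<exists>g h. (g, h) \<in> gen T \<and> cscale (of_real r) g - h \<simeq> f \<and> nrm g \<le> C * nrm f"
      by metis
  qed
  define R where "R = resolvent M A (complex_of_real l)"
  interpret P: symmetric_perturbation cscale "L2 M" "l2_inner M" T B R s \<beta> l
    using sg T_sym form B(2) B_bound \<beta> l(1) res[OF l(2)] unfolding R_def by unfold_locales auto
  have R_strong: "\<exists>\<epsilon>>0. R f - cscale (of_real \<epsilon>) u \<in> pos_cone M" if f: "f \<in> pos_cone M" "nrm f \<noteq> 0" for f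
  proof -
    have "spectral_bound M A < ereal l" using s(1) l(2) by (simp add: le_less_trans)
    hence "strongly_positive M u (R f)"
      using assms(10) l(3) f positive_nonzero_iff unfolding R_def strongly_positive_op_def by blast
    thus ?thesis using strongly_positive_iff[OF P.R_H assms(2)] f by blast
  qed
  \<comment> \<open>Strong positivity says nothing about null \<open>f\<close>; there boundedness
    makes \<open>R f\<close> null as well.\<close>
  have R_pos: "R f \<in> pos_cone M" if f: "f \<in> pos_cone M" for f
  proof (cases "nrm f = 0")
    case True
    obtain C where C: "\<And>f. f \<in> L2 M \<Longrightarrow> nrm (R f) \<le> C * nrm f"
      using bdd_op_bound[OF res_bdd[OF l(2)]] unfolding R_def by blast
    have "nrm (R f) \<le> C * nrm f" using C pos_cone_L2[OF f] by blast
    hence "nrm (R f) = 0" using True nrm_ge_0[OF P.R_H, of f] f by (simp add: antisym pos_cone_L2)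
    thus ?thesis using f pos_cone_eqv[OF pos_cone_0, of "R f"] eqv_sym[of "R f" 0] by (auto simp: eqv_0_iff)
  next
    case False
    then obtain \<epsilon> where \<epsilon>: "\<epsilon> > 0" "R f - cscale (of_real \<epsilon>) u \<in> pos_cone M" using R_strong f by blast
    from pos_cone_add[OF \<epsilon>(2) pos_cone_scale[OF assms(2) less_imp_le[OF \<epsilon>(1)]]] show ?thesis by simp
  qed
  \<comment> \<open>Up to equivalence each iterate exceeds \<open>R f\<close> by \<open>R\<close>
    applied to \<open>B\<close> of the previous iterate, which is positive; the cone is closed, so
    the limit inherits this.\<close>
  have K_ge_R: "P.K f - R f \<in> pos_cone M" if f: "f \<in> pos_cone M" for f
  proof -
    have fL: "f \<in> L2 M" using f by auto
    have n_pos: "P.neumann f n \<in> pos_cone M" for n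
    proof (induction n)
      case 0
      show ?case unfolding P.neumann_simps by (rule pos_cone_0)
    next
      case (Suc n)
      thus ?case unfolding P.neumann_simps by (intro R_pos pos_cone_add f B_pos)
    qed
    have "lim_to (P.neumann f) (P.K f)" using P.K[OF fL] by blast
    hence lim: "lim_to (\<lambda>n. P.neumann f (Suc n) - R f) (P.K f - R f)"
      unfolding lim_to_def by (simp del: P.neumann_simps) (rule LIMSEQ_Suc)
    have "P.neumann f (Suc n) - R f \<in> pos_cone M" for n
    proof (rule pos_cone_eqv[OF R_pos[OF B_pos[OF n_pos[of n]]]])
      have n: "P.neumann f n \<in> L2 M" using fL by auto
      have H: "B (P.neumann f n) \<in> L2 M" "R f \<in> L2 M" "R (B (P.neumann f n)) \<in> L2 M"
          "R (f + B (P.neumann f n)) \<in> L2 M"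
        using fL n P.B_H P.R_H by auto
      have "R (f + B (P.neumann f n)) - R f \<simeq> (R f + R (B (P.neumann f n))) - R f"
        using H by (intro eqv_diff P.R_add eqv_refl fL) auto
      hence "P.neumann f (Suc n) - R f \<simeq> R (B (P.neumann f n))" by simp
      thus "R (B (P.neumann f n)) \<simeq> P.neumann f (Suc n) - R f" by (rule eqv_sym) (use H in auto)
    qed (use fL in auto)
    thus ?thesis by (rule pos_cone_limit[OF _ _ lim]) (use fL in auto)
  qed
  interpret D: dominated_resolvent M u P.K "l - s - \<beta>"
  proof unfold_locales
    obtain f where f: "f \<in> L2 M" "\<not> eq_ae M f (\<lambda>x. 0)" using assms(1) by blast
    have "f \<simeq> 0 \<longleftrightarrow> eq_ae M f (\<lambda>x. 0)" using eqv_iff_eq_ae[OF f(1) H_0] by (simp add: zero_fun_def)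
    thus "\<exists>f\<in>L2 M. nrm f \<noteq> 0" using f by (auto simp only: eqv_0_iff)
  next
    fix f assume f: "f \<in> pos_cone M"
    show "P.K f \<in> pos_cone M" using pos_cone_add[OF K_ge_R[OF f] R_pos[OF f]] by simp
  next
    fix f assume f: "f \<in> pos_cone M" "nrm f \<noteq> 0"
    then obtain \<epsilon> where "\<epsilon> > 0" "R f - cscale (of_real \<epsilon>) u \<in> pos_cone M" using R_strong by blast
    thus "\<exists>\<epsilon>>0. P.K f - cscale (of_real \<epsilon>) u \<in> pos_cone M"
      using pos_cone_trans[OF _ K_ge_R[OF f(1)]] by blast
  next
    fix f assume "f \<in> L2 M"
    then obtain h where "(P.K f, h) \<in> P.pert" using P.K by blast
    \<comment> \<open>A + B has the same domain as A, so the inclusion of that domain in the ideal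
      applies to the range of \<open>K\<close>.\<close>
    hence "P.K f \<in> Domain A" by (auto simp: P.pert_def A)
    thus "P.K f \<in> principal_ideal M u" using assms(8) by blast
  qed (use assms(2,3) l(1) P.K_sym P.K_psd P.K_inj in auto)
  have "add_bounded M A B = P.pert"
  proof -
    have "(f, h) \<in> add_bounded M A B \<longleftrightarrow> (f, h) \<in> P.pert" for f h
    proof -
      have "h \<in> L2 M \<and> (f, g) \<in> gen T \<and> eq_ae M h (\<lambda>x. g x + B f x) \<longleftrightarrow>
          f \<in> L2 M \<and> h \<in> L2 M \<and> (f, g) \<in> gen T \<and> h \<simeq> g + B f" for g
      proof (cases "h \<in> L2 M \<and> (f, g) \<in> gen T")
        case True
        hence H: "f \<in> L2 M" "g \<in> L2 M" "h \<in> L2 M" using gen_H[OF sg] by auto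
        hence "g + B f \<in> L2 M" using P.B_H by auto
        thus ?thesis using H True eqv_iff_eq_ae[of h "g + B f"] by (simp add: plus_fun_def)
      qed auto
      thus ?thesis unfolding add_bounded_def P.pert_def A by blast
    qed
    thus ?thesis by auto
  qed
  also have "P.pert = D.res_graph l" using P.pert_iff by (auto simp: D.res_graph_def)
  finally have graph: "add_bounded M A B = D.res_graph l" .
  \<comment> \<open>Existence is witnessed by the diagonal exponentials; the positivity statement
    covers every semigroup with this generator.\<close>
  show ?thesis unfolding C0_semigroup_iff generator_eq graph
    using D.c0_sg_exp_op[of l] D.gen_exp_op[of l] D.semigroup_eventually_positive[of _ l] by blast
qed

end
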